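(* Let $T_M$ be the Endo–Pajitnov manifold associated to a matrix $M$ as in the context (not assumed diagonalizable). Then $T_M$ admits a pluriclosed metric if and only if $M$ is diagonalizable and there exists $1\le i_0\le n$ such that $\alpha\,\beta_{i_0}\overline{\beta_{i_0}}=1$ and $|\beta_i|=1$ for all $1\le i\le n$ with $i\ne i_0$.
   Context: Endo–Pajitnov setup. Let $n\ge 2$ be an integer and let $M\in \mathrm{SL}(2n+1,\mathbb Z)$ be a matrix whose eigenvalues, listed with multiplicity, are $\alpha,\beta_1,\dots,\beta_n,\overline{\beta_1},\dots,\overline{\beta_n}$, where $\alpha$ is real, $\alpha>0$, $\alpha\neq 1$, and $\operatorname{Im}\beta_j>0$ for all $j$. Let $a=(a^1,\dots,a^{2n+1})^T\in\mathbb R^{2n+1}$ be a nonzero eigenvector of $M$ for $\alpha$. Let $W\subset\mathbb C^{2n+1}$ be the direct sum of the generalized eigenspaces $\{x:\exists N,\ (M-\beta_jI)^Nx=0\}$ over the $\beta_j$ (so $\dim_{\mathbb C}W=n$), and let $b_1,\dots,b_n$ be a $\mathbb C$-basis of $W$, $b_j=(b_j^1,\dots,b_j^{2n+1})^T$. For $1\le i\le 2n+1$ set $u_i=(a^i,b_1^i,\dots,b_n^i)\in\mathbb R\times\mathbb C^n$. Let $R=(r_{ij})\in M_n(\mathbb C)$ be the matrix of $M|_W:W\to W$ in the basis $\{b_j\}$, i.e. $Mb_j=\sum_i r_{ij}b_i$. Let $\mathbb H=\{w\in\mathbb C:\operatorname{Im}w>0\}$ and define automorphisms of $\mathbb H\times\mathbb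 C^n$ by $g_0(w,z)=(\alpha w,R^Tz)$ and $g_i(w,z)=(w,z)+u_i$, $1\le i\le 2n+1$. Let $G_M$ be the group generated by $g_0,\dots,g_{2n+1}$; it acts freely and properly discontinuously, and $T_M:=G_M\backslash(\mathbb H\times\mathbb C^n)$ is a compact complex manifold of complex dimension $n+1$ (the Endo–Pajitnov manifold of $M$). Its biholomorphism class does not depend on the choice of $a$ and of the basis $\{b_j\}$. A Hermitian metric with fundamental form $\omega$ is pluriclosed if $dd^c\omega=0$, where $d^c=-J^{-1}dJ$ (equivalently $i\partial\bar\partial\omega=0$). *)

theory Defs
  imports "HOL-Analysis.Analysis" "Jordan_Normal_Form.Char_Poly" "Jordan_Normal_Form.Matrix"
begin

definition gen_eigenspace :: "complex mat \<Rightarrow> complex \<Rightarrow> complex vec set" where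
  "gen_eigenspace A mu = {x \<in> carrier_vec (dim_row A).
     \<exists>N. ((A - mu \<cdot>\<^sub>m 1\<^sub>m (dim_row A)) ^\<^sub>m N) *\<^sub>v x = 0\<^sub>v (dim_row A)}"

definition EP_W :: "complex mat \<Rightarrow> nat \<Rightarrow> (nat \<Rightarrow> complex) \<Rightarrow> complex vec set" where
  "EP_W A n beta = {x. \<exists>y. (\<forall>j\<in>{1..n}. y j \<in> gen_eigenspace A (beta j)) \<and>
        x = vec (dim_row A) (\<lambda>i. \<Sum>j\<in>{1..n}. y j $ i)}"

definition is_basis_of :: "nat \<Rightarrow> nat \<Rightarrow> (nat \<Rightarrow> complex vec) \<Rightarrow> complex vec set \<Rightarrow> bool" where
  "is_basis_of d n b W \<longleftrightarrow>
     (\<forall>j\<in>{1..n}. b j \<in> W) \<and>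
     (\<forall>c. (\<forall>i<d. (\<Sum>j\<in>{1..n}. c j * b j $ i) = 0) \<longrightarrow> (\<forall>j\<in>{1..n}. c j = 0)) \<and>
     (\<forall>x\<in>W. \<exists>c. x = vec d (\<lambda>i. \<Sum>j\<in>{1..n}. c j * b j $ i))"

definition diagonalizable_C :: "complex mat \<Rightarrow> bool" where
  "diagonalizable_C A \<longleftrightarrow> (\<exists>D. diagonal_mat D \<and> similar_mat A D)"

text \<open>Points of H x C^n are encoded as p :: nat => complex with p 0 = w and
  p k = z_k for 1 <= k <= n, all other coordinates being 0.\<close>
definition EP_X :: "nat \<Rightarrow> (nat \<Rightarrow> complex) set" where
  "EP_X n = {p. 0 < Im (p 0) \<and> (\<forall>k>n. p k = 0)}"

definition EP_g0 :: "nat \<Rightarrow> real \<Rightarrow> (nat \<Rightarrow> nat \<Rightarrow> complex) \<Rightarrow> (nat \<Rightarrow> complex) \<Rightarrow> (nat \<Rightarrow> complex)" where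
  "EP_g0 n alpha R p = (\<lambda>k. if k = 0 then complex_of_real alpha * p 0
        else if k \<le> n then (\<Sum>l\<in>{1..n}. R l k * p l) else 0)"

text \<open>Translation by u_i = (a^i, b_1^i, ..., b_n^i), 1 <= i <= 2n+1
  (vectors of the Jordan_Normal_Form library are 0-indexed, hence i - 1).\<close>
definition EP_gi :: "nat \<Rightarrow> real vec \<Rightarrow> (nat \<Rightarrow> complex vec) \<Rightarrow> nat \<Rightarrow> (nat \<Rightarrow> complex) \<Rightarrow> (nat \<Rightarrow> complex)" where
  "EP_gi n a b i p = (\<lambda>k. if k = 0 then p 0 + complex_of_real (a $ (i - 1))
        else if k \<le> n then p k + b k $ (i - 1) else 0)"

definition EP_gens :: "nat \<Rightarrow> real \<Rightarrow> (nat \<Rightarrow> nat \<Rightarrow> complex) \<Rightarrow> real vec \<Rightarrow> (nat \<Rightarrow> complex vec)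
     \<Rightarrow> ((nat \<Rightarrow> complex) \<Rightarrow> (nat \<Rightarrow> complex)) set" where
  "EP_gens n alpha R a b = insert (EP_g0 n alpha R) (EP_gi n a b ` {1..2*n+1})"

inductive_set gen_group :: "'a set \<Rightarrow> ('a \<Rightarrow> 'a) set \<Rightarrow> ('a \<Rightarrow> 'a) set"
  for X :: "'a set" and S :: "('a \<Rightarrow> 'a) set" where
  gg_id: "id \<in> gen_group X S"
| gg_gen: "g \<in> S \<Longrightarrow> f \<in> gen_group X S \<Longrightarrow> g \<circ> f \<in> gen_group X S"
| gg_inv: "g \<in> S \<Longrightarrow> f \<in> gen_group X S \<Longrightarrow> inv_into X g \<circ> f \<in> gen_group X S"

definition rpd :: "((nat \<Rightarrow> complex) \<Rightarrow> complex) \<Rightarrow> nat \<Rightarrow> complex \<Rightarrow> (nat \<Rightarrow> complex) \<Rightarrow> complex" where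
  "rpd f l e p = vector_derivative (\<lambda>t::real. f (p(l := p l + of_real t * e))) (at 0)"

fun ipd :: "(nat \<times> complex) list \<Rightarrow> ((nat \<Rightarrow> complex) \<Rightarrow> complex) \<Rightarrow> (nat \<Rightarrow> complex) \<Rightarrow> complex" where
  "ipd [] f = f"
| "ipd ((l, e) # ds) f = rpd (ipd ds f) l e"

definition smooth_on :: "nat \<Rightarrow> (nat \<Rightarrow> complex) set \<Rightarrow> ((nat \<Rightarrow> complex) \<Rightarrow> complex) \<Rightarrow> bool" where
  "smooth_on n X f \<longleftrightarrow>
     (\<forall>ds. (\<forall>(l, e)\<in>set ds. l \<le> n \<and> e \<in> {1, \<i>}) \<longrightarrow>
        continuous_on X (ipd ds f) \<and>
        (\<forall>p\<in>X. \<forall>l\<le>n. \<forall>e\<in>{1, \<i>}.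
            (\<lambda>t::real. ipd ds f (p(l := p l + of_real t * e))) differentiable (at 0)))"

definition dz :: "((nat \<Rightarrow> complex) \<Rightarrow> complex) \<Rightarrow> nat \<Rightarrow> (nat \<Rightarrow> complex) \<Rightarrow> complex" where
  "dz f l p = (rpd f l 1 p - \<i> * rpd f l \<i> p) / 2"

definition dzb :: "((nat \<Rightarrow> complex) \<Rightarrow> complex) \<Rightarrow> nat \<Rightarrow> (nat \<Rightarrow> complex) \<Rightarrow> complex" where
  "dzb f l p = (rpd f l 1 p + \<i> * rpd f l \<i> p) / 2"

definition cpd :: "((nat \<Rightarrow> complex) \<Rightarrow> complex) \<Rightarrow> nat \<Rightarrow> (nat \<Rightarrow> complex) \<Rightarrow> complex" where
  "cpd f a p = deriv (\<lambda>t. f (p(a := p a + t))) 0"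

text \<open>A Hermitian metric on X, given by its coefficient matrix h p j k (0 <= j,k <= n),
  the fundamental form being omega = i * sum h_{j k} dz_j wedge d(conj z_k).\<close>
definition hermitian_metric :: "nat \<Rightarrow> (nat \<Rightarrow> complex) set \<Rightarrow> ((nat \<Rightarrow> complex) \<Rightarrow> nat \<Rightarrow> nat \<Rightarrow> complex) \<Rightarrow> bool" where
  "hermitian_metric n X h \<longleftrightarrow>
     (\<forall>j\<le>n. \<forall>k\<le>n. smooth_on n X (\<lambda>p. h p j k)) \<and>
     (\<forall>p\<in>X. \<forall>j\<le>n. \<forall>k\<le>n. h p j k = cnj (h p k j)) \<and>
     (\<forall>p\<in>X. \<forall>v::nat \<Rightarrow> complex. (\<exists>k\<le>n. v k \<noteq> 0) \<longrightarrow>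
        0 < Re (\<Sum>j\<le>n. \<Sum>k\<le>n. h p j k * v j * cnj (v k)))"

definition invariant_metric :: "nat \<Rightarrow> (nat \<Rightarrow> complex) set \<Rightarrow> ((nat \<Rightarrow> complex) \<Rightarrow> nat \<Rightarrow> nat \<Rightarrow> complex)
     \<Rightarrow> ((nat \<Rightarrow> complex) \<Rightarrow> (nat \<Rightarrow> complex)) \<Rightarrow> bool" where
  "invariant_metric n X h g \<longleftrightarrow>
     (\<forall>p\<in>X. \<forall>a\<le>n. \<forall>b\<le>n.
        h p a b = (\<Sum>j\<le>n. \<Sum>k\<le>n. h (g p) j k * cpd (\<lambda>q. g q j) a p * cnj (cpd (\<lambda>q. g q k) b p)))"

text \<open>dd^c omega = 0, i.e. i del delbar omega = 0, written out in coordinates: the coefficient of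
  dz_l wedge dz_j wedge d(conj z_m) wedge d(conj z_k) in del delbar omega vanishes.\<close>
definition pluriclosed :: "nat \<Rightarrow> (nat \<Rightarrow> complex) set \<Rightarrow> ((nat \<Rightarrow> complex) \<Rightarrow> nat \<Rightarrow> nat \<Rightarrow> complex) \<Rightarrow> bool" where
  "pluriclosed n X h \<longleftrightarrow>
     (\<forall>p\<in>X. \<forall>l\<le>n. \<forall>j\<le>n. \<forall>m\<le>n. \<forall>k\<le>n.
        let T = (\<lambda>l j m k. dz (dzb (\<lambda>q. h q j k) m) l p) in
        T l j m k - T j l m k - T l j k m + T j l k m = 0)"

text \<open>T_M = G_M \ (H x C^n) admits a pluriclosed metric: there is a G_M-invariant
  pluriclosed Hermitian metric on H x C^n.\<close>
definition EP_admits_pluriclosed :: "nat \<Rightarrow> real \<Rightarrow> (nat \<Rightarrow> nat \<Rightarrow> complex) \<Rightarrow> real vec \<Rightarrow> (nat \<Rightarrow> complex vec) \<Rightarrow> bool" where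
  "EP_admits_pluriclosed n alpha R a b \<longleftrightarrow>
     (\<exists>h. hermitian_metric n (EP_X n) h \<and> pluriclosed n (EP_X n) h \<and>
        (\<forall>g\<in>gen_group (EP_X n) (EP_gens n alpha R a b). invariant_metric n (EP_X n) h g))"

end

theory Submission
  imports Defs "Jordan_Normal_Form.Jordan_Normal_Form_Existence"
begin

text \<open>
  An invariant metric descends to a bundle of tori over the circle. Averaging its coefficients over the
  torus fibres leaves functions of \<open>y = Im w\<close> alone, and since every derivative in a direction
  tangent to the torus has mean zero, the pluriclosed condition forces the averaged coefficients
  \<open>h\<^sub>j\<^sub>k\<close> with \<open>j, k \<ge> 1\<close> to be affine in \<open>y\<close>, say \<open>A + y B\<close> with \<open>A + y B\<close> positive definite.
  Invariance under \<open>g\<^sub>0\<close> becomes \<open>A = R A R\<^sup>*\<close> and \<open>B = \<alpha> R B R\<^sup>*\<close>. Evaluating these two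
  identities on eigenvectors and Jordan chains of the transpose of \<open>R\<close> shows that \<open>R\<close>, hence \<open>M\<close>, is
  diagonalizable and that each \<open>\<beta>\<^sub>j\<close> satisfies \<open>\<bar>\<beta>\<^sub>j\<bar> = 1\<close> or \<open>\<alpha> \<bar>\<beta>\<^sub>j\<bar>\<^sup>2 = 1\<close>; then \<open>det M = 1\<close> and
  \<open>\<alpha> \<noteq> 1\<close> leave exactly one index of the second kind. Conversely, for an eigenbasis the form
  \<open>\<bar>dw\<bar>\<^sup>2 / y\<^sup>2 + y \<bar>dz\<^sub>i\<bar>\<^sup>2\<close> (for \<open>i = i\<^sub>0\<close>) plus the remaining \<open>\<bar>dz\<^sub>i\<bar>\<^sup>2\<close> is invariant and
  pluriclosed, because \<open>Im w\<close> is pluriharmonic.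
\<close>

unbundle no vec_syntax

section \<open>Jordan chains and diagonalizability\<close>

text \<open>The fibre average would naturally be an integral. Finite grids replace it: they are
  permuted exactly by the monodromy for every grid size N, while derivatives tangent to the torus
  have mean zero only as N grows. The averages are therefore only asymptotically affine in y, and
  the limit is taken along one subsequence at the heights 1 and 2, which determine an affine
  function. Only the coefficients of the pluriclosed equation with l = m = 0 and j, k at least 1
  enter. The obstacle there is that a y-derivative of a mean-zero function need not be visibly
  small; such terms are kept as total derivatives and integrated away. Neither A nor B is known to
  be definite: positivity at y = 1 says that A + B has no nonzero isotropic vector, and this is
  enough because A and B both vanish at the end of a Jordan chain. In the converse, repeated
  eigenvalues are handled without choosing an eigenbasis: every b_s is split into eigencomponents,
  and the metric sums the weighted squares of all resulting linear forms.\<close>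

definition shiftm :: "complex mat \<Rightarrow> complex \<Rightarrow> complex mat" where
  "shiftm A mu = A - mu \<cdot>\<^sub>m 1\<^sub>m (dim_row A)"

text \<open>Excludes Jordan chains of length two, hence all longer ones. Being a condition on single
  vectors, it passes easily between \<open>M\<close>, its restriction to W and \<open>R\<close>, and
  it can be tested with sesquilinear forms.\<close>

definition chain_free :: "complex mat \<Rightarrow> bool" where
  "chain_free A \<longleftrightarrow> (\<forall>mu. \<forall>x\<in>carrier_vec (dim_row A).
     shiftm A mu *\<^sub>v (shiftm A mu *\<^sub>v x) = 0\<^sub>v (dim_row A) \<longrightarrow> shiftm A mu *\<^sub>v x = 0\<^sub>v (dim_row A))"

lemma shiftm_carrier [simp]: "A \<in> carrier_mat m m \<Longrightarrow> shiftm A mu \<in> carrier_mat m m"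
  by (auto simp: shiftm_def)

lemma shiftm_vec_carrier [simp]:
  "A \<in> carrier_mat m m \<Longrightarrow> x \<in> carrier_vec m \<Longrightarrow> shiftm A mu *\<^sub>v x \<in> carrier_vec m"
  by (rule mult_mat_vec_carrier[OF shiftm_carrier])

lemma shiftm_mult_vec:
  assumes "A \<in> carrier_mat m m" "x \<in> carrier_vec m"
  shows "shiftm A mu *\<^sub>v x = A *\<^sub>v x - mu \<cdot>\<^sub>v x"
proof -
  have "shiftm A mu *\<^sub>v x = A *\<^sub>v x - (mu \<cdot>\<^sub>m 1\<^sub>m m) *\<^sub>v x"
    unfolding shiftm_def using assms by (subst minus_mult_distrib_mat_vec[of _ m m]) auto
  also have "(mu \<cdot>\<^sub>m 1\<^sub>m m) *\<^sub>v x = mu \<cdot>\<^sub>v (1\<^sub>m m *\<^sub>v x)"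
    using assms by (intro eq_vecI) auto
  finally show ?thesis using assms by simp
qed

lemma mult_mat_zero_vec: "A \<in> carrier_mat r m \<Longrightarrow> A *\<^sub>v 0\<^sub>v m = (0\<^sub>v r :: complex vec)"
  by (intro eq_vecI) auto

lemma shiftm_zero [simp]:
  assumes "A \<in> carrier_mat m m"
  shows "shiftm A mu *\<^sub>v 0\<^sub>v m = 0\<^sub>v m"
  by (rule mult_mat_zero_vec) (use assms in auto)

lemma shiftm_commute:
  assumes A: "A \<in> carrier_mat m m" and x: "x \<in> carrier_vec m"
  shows "shiftm A mu *\<^sub>v (shiftm A nu *\<^sub>v x) = shiftm A nu *\<^sub>v (shiftm A mu *\<^sub>v x)"
proof -
  have *: "shiftm A s *\<^sub>v (shiftm A t *\<^sub>v x) = A *\<^sub>v (A *\<^sub>v x) - t \<cdot>\<^sub>v (A *\<^sub>v x) - (s \<cdot>\<^sub>v (A *\<^sub>v x - t \<cdot>\<^sub>v x))" for s t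
    using A x mult_mat_vec_carrier[OF shiftm_carrier[OF A, of t] x]
    by (simp only: shiftm_mult_vec[OF A] mult_minus_distrib_mat_vec[of _ m m] mult_mat_vec[of _ m m]
      mult_mat_vec_carrier[OF A] smult_carrier_vec)
  show ?thesis unfolding * using A x by (intro eq_vecI) (auto simp: algebra_simps)
qed

text \<open>Stands for p(A) x with p a product of linear factors; the list of roots, with
  multiplicity, serves as an annihilating polynomial.\<close>

definition shiftms :: "complex mat \<Rightarrow> complex list \<Rightarrow> complex vec \<Rightarrow> complex vec" where
  "shiftms A ms x = foldr (\<lambda>mu y. shiftm A mu *\<^sub>v y) ms x"

lemma shiftms_simps [simp]:
  "shiftms A [] x = x" "shiftms A (mu # ms) x = shiftm A mu *\<^sub>v shiftms A ms x"
  "shiftms A (ms @ ns) x = shiftms A ms (shiftms A ns x)"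
  by (simp_all add: shiftms_def)

lemma shiftms_carrier [simp]:
  "A \<in> carrier_mat m m \<Longrightarrow> x \<in> carrier_vec m \<Longrightarrow> shiftms A ms x \<in> carrier_vec m"
  by (induction ms) (auto intro!: mult_mat_vec_carrier)

lemma shiftms_zero [simp]: "A \<in> carrier_mat m m \<Longrightarrow> shiftms A ms (0\<^sub>v m) = 0\<^sub>v m"
  by (induction ms) auto

lemma shiftms_shiftm:
  assumes "A \<in> carrier_mat m m" "x \<in> carrier_vec m"
  shows "shiftms A ms (shiftm A nu *\<^sub>v x) = shiftm A nu *\<^sub>v shiftms A ms x"
  using assms by (induction ms) (auto simp: shiftm_commute[of A m])

lemma shiftms_commute:
  assumes "A \<in> carrier_mat m m" "x \<in> carrier_vec m"
  shows "shiftms A ms (shiftms A ns x) = shiftms A ns (shiftms A ms x)"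
  using assms by (induction ms) (auto simp: shiftms_shiftm[of A m])

lemma shiftms_add:
  assumes "A \<in> carrier_mat m m" "x \<in> carrier_vec m" "y \<in> carrier_vec m"
  shows "shiftms A ms (x + y) = shiftms A ms x + shiftms A ms y"
  using assms by (induction ms) (auto simp: mult_add_distrib_mat_vec[of _ m m])

lemma shiftms_smult:
  assumes "A \<in> carrier_mat m m" "x \<in> carrier_vec m"
  shows "shiftms A ms (c \<cdot>\<^sub>v x) = c \<cdot>\<^sub>v shiftms A ms x"
  using assms by (induction ms) (auto simp: mult_mat_vec[of _ m m])

lemma shiftms_eigenvector:
  assumes A: "A \<in> carrier_mat m m" and x: "x \<in> carrier_vec m" and e: "shiftm A mu *\<^sub>v x = 0\<^sub>v m"
  shows "shiftms A ns x = (\<Prod>nu\<leftarrow>ns. mu - nu) \<cdot>\<^sub>v x"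
proof (induction ns)
  case (Cons nu ns)
  have Ax: "A *\<^sub>v x = mu \<cdot>\<^sub>v x"
  proof (intro eq_vecI)
    fix i assume "i < dim_vec (mu \<cdot>\<^sub>v x)"
    then show "(A *\<^sub>v x) $ i = (mu \<cdot>\<^sub>v x) $ i"
      using arg_cong[OF e[unfolded shiftm_mult_vec[OF A x]], of "\<lambda>v. v $ i"] A x by simp
  qed (use A x in auto)
  show ?case using Cons A x
    by (intro eq_vecI) (auto simp: mult_mat_vec[of _ m m] shiftm_mult_vec[OF A x] Ax algebra_simps)
qed (use x in auto)

lemma killed_by_disjoint:
  assumes A: "A \<in> carrier_mat m m" and x: "x \<in> carrier_vec m"
    and "shiftms A ms x = 0\<^sub>v m" and "shiftms A ns x = 0\<^sub>v m" and "set ms \<inter> set ns = {}"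
  shows "x = 0\<^sub>v m"
  using assms(3-)
proof (induction ms)
  case (Cons mu ms)
  let ?z = "shiftms A ms x"
  have z: "?z \<in> carrier_vec m" using A x by simp
  have "shiftms A ns ?z = 0\<^sub>v m" using Cons.prems A x by (simp add: shiftms_commute[of A m])
  moreover have "shiftms A ns ?z = (\<Prod>nu\<leftarrow>ns. mu - nu) \<cdot>\<^sub>v ?z"
    using Cons.prems z by (intro shiftms_eigenvector[OF A]) auto
  moreover have "(\<Prod>nu\<leftarrow>ns. mu - nu) \<noteq> 0" using Cons.prems by (auto simp: prod_list_zero_iff)
  ultimately have "?z = 0\<^sub>v m" using z by (auto simp: vec_eq_iff)
  then show ?case using Cons by auto
qed simp

lemma shiftms_replicate:
  assumes "A \<in> carrier_mat m m" "x \<in> carrier_vec m"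
  shows "shiftms A (replicate N mu) x = (shiftm A mu ^\<^sub>m N) *\<^sub>v x"
  using assms(2)
proof (induction N arbitrary: x)
  case (Suc N)
  have "shiftms A (replicate (Suc N) mu) x = shiftms A (replicate N mu) (shiftm A mu *\<^sub>v x)"
    using assms Suc by (simp add: shiftms_shiftm[of A m])
  also have "\<dots> = (shiftm A mu ^\<^sub>m N) *\<^sub>v (shiftm A mu *\<^sub>v x)" using assms Suc by (simp add: mult_mat_vec_carrier[of _ m m])
  also have "\<dots> = (shiftm A mu ^\<^sub>m N * shiftm A mu) *\<^sub>v x"
    using assms Suc by (subst assoc_mult_mat_vec[of _ m m _ m]) auto
  finally show ?case by simp
qed (use assms in \<open>auto simp: shiftm_def\<close>)

lemma gen_eigenspace_iff:
  assumes "A \<in> carrier_mat m m"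
  shows "x \<in> gen_eigenspace A mu \<longleftrightarrow> x \<in> carrier_vec m \<and> (\<exists>N. shiftms A (replicate N mu) x = 0\<^sub>v m)"
  using assms by (auto simp: gen_eigenspace_def shiftms_replicate[of A m] shiftm_def)

text \<open>If the power N = k + 2 kills x, the k-th power sends x to a vector killed by the square,
  so the exponent can be lowered by one.\<close>

lemma chain_free_replicate:
  assumes A: "A \<in> carrier_mat m m" and cf: "chain_free A" and x: "x \<in> carrier_vec m"
    and "shiftms A (replicate N mu) x = 0\<^sub>v m"
  shows "shiftm A mu *\<^sub>v x = 0\<^sub>v m"
  using assms(4)
proof (induction N)
  case (Suc N)
  show ?case
  proof (cases N)
    case 0
    then show ?thesis using Suc by simp
  next
    case (Suc k)
    let ?y = "shiftms A (replicate k mu) x"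
    have "?y \<in> carrier_vec (dim_row A)" using A x by simp
    moreover have "shiftm A mu *\<^sub>v (shiftm A mu *\<^sub>v ?y) = 0\<^sub>v (dim_row A)"
      using Suc.prems \<open>N = Suc k\<close> A by simp
    ultimately have "shiftm A mu *\<^sub>v ?y = 0\<^sub>v m" using cf A unfolding chain_free_def by auto
    then show ?thesis using Suc.IH \<open>N = Suc k\<close> by simp
  qed
qed (use A x in simp)

text \<open>The witness is the first block of size at least two, so \<open>lam\<close> may differ
  from \<open>mu\<close>: column \<open>i\<close> opens that block, and column \<open>Suc i\<close>
  carries its first superdiagonal 1.\<close>

lemma jordan_matrix_chain:
  fixes n_as :: "(nat \<times> complex) list"
  assumes "(k, mu) \<in> set n_as" "k \<ge> 2"
  shows "\<exists>i lam. Suc i < sum_list (map fst n_as) \<and> (\<forall>r < sum_list (map fst n_as).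
      jordan_matrix n_as $$ (r, i) = (if r = i then lam else 0) \<and>
      jordan_matrix n_as $$ (r, Suc i) = (if r = Suc i then lam else if r = i then 1 else 0))"
  using assms(1)
proof (induction n_as)
  case (Cons na n_as)
  obtain l nu where na: "na = (l, nu)" by (cases na)
  let ?m = "sum_list (map fst n_as)"
  have idx: "r < l + ?m \<Longrightarrow> c < l + ?m \<Longrightarrow> jordan_matrix (na # n_as) $$ (r, c) =
     (if r < l then if c < l then jordan_block l nu $$ (r, c) else 0
      else if c < l then 0 else jordan_matrix n_as $$ (r - l, c - l))" for r c
    unfolding na jordan_matrix_Cons by (subst index_mat_four_block) auto
  show ?case
  proof (cases "l \<ge> 2")
    case True
    then show ?thesis
      by (intro exI[of _ 0] exI[of _ nu]) (auto simp: idx[unfolded na] na)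
  next
    case False
    then have "(k, mu) \<in> set n_as" using Cons.prems assms(2) na by auto
    from Cons.IH[OF this] obtain i lam where i: "Suc i < ?m" and
      col: "\<forall>r < ?m. jordan_matrix n_as $$ (r, i) = (if r = i then lam else 0) \<and>
      jordan_matrix n_as $$ (r, Suc i) = (if r = Suc i then lam else if r = i then 1 else 0)" by blast
    moreover have "l + i < l + ?m" "l + Suc i < l + ?m" using i by auto
    ultimately have "Suc (l + i) < l + ?m \<and> (\<forall>r<l + ?m. jordan_matrix (na # n_as) $$ (r, l + i) = (if r = l + i then lam else 0) \<and>
      jordan_matrix (na # n_as) $$ (r, Suc (l + i)) = (if r = Suc (l + i) then lam else if r = l + i then 1 else 0))"
    proof (intro conjI allI impI)
      fix r assume r: "r < l + ?m"
      show "jordan_matrix (na # n_as) $$ (r, l + i) = (if r = l + i then lam else 0)"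
      proof (cases "r < l")
        case False
        then obtain q where "r = l + q" "q < ?m" using r by (metis add_diff_inverse_nat nat_add_left_cancel_less)
        then show ?thesis using col i r by (simp add: idx)
      qed (use i r in \<open>simp add: idx\<close>)
      show "jordan_matrix (na # n_as) $$ (r, Suc (l + i)) = (if r = Suc (l + i) then lam else if r = l + i then 1 else 0)"
      proof (cases "r < l")
        case False
        then obtain q where q: "r = l + q" "q < ?m" using r by (metis add_diff_inverse_nat nat_add_left_cancel_less)
        have "Suc (l + i) - l = Suc i" by simp
        then show ?thesis using col i r q by (simp add: idx)
      qed (use i r in \<open>simp add: idx\<close>)
    qed simp
    then show ?thesis by (intro exI[of _ "l + i"] exI[of _ lam]) (simp add: na)
  qed
qed simp

lemma jordan_matrix_diagonal:
  fixes n_as :: "(nat \<times> complex) list"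
  assumes "\<forall>(k, mu) \<in> set n_as. k = 1"
  shows "diagonal_mat (jordan_matrix n_as)"
  using assms
proof (induction n_as)
  case (Cons na n_as)
  obtain nu where na: "na = (1, nu)" using Cons.prems by (cases na) auto
  let ?m = "sum_list (map fst n_as)"
  have idx: "r < 1 + ?m \<Longrightarrow> c < 1 + ?m \<Longrightarrow> jordan_matrix (na # n_as) $$ (r, c) =
     (if r < 1 then if c < 1 then jordan_block 1 nu $$ (r, c) else 0
      else if c < 1 then 0 else jordan_matrix n_as $$ (r - 1, c - 1))" for r c
    unfolding na jordan_matrix_Cons by (subst index_mat_four_block) auto
  have "diagonal_mat (jordan_matrix n_as)" using Cons by auto
  then show ?case unfolding diagonal_mat_def using idx na by auto
qed (simp add: diagonal_mat_def)

lemma similar_shiftm: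
  assumes "similar_mat_wit A D P Q" "A \<in> carrier_mat m m" "x \<in> carrier_vec m"
  shows "shiftm A mu *\<^sub>v (P *\<^sub>v x) = P *\<^sub>v (shiftm D mu *\<^sub>v x)"
proof -
  have c: "D \<in> carrier_mat m m" "P \<in> carrier_mat m m" "Q \<in> carrier_mat m m"
    and QP: "Q * P = 1\<^sub>m m" and AP: "A = P * D * Q"
    using assms unfolding similar_mat_wit_def Let_def by auto
  have "A *\<^sub>v (P *\<^sub>v x) = (A * P) *\<^sub>v x"
    using assms c by (subst assoc_mult_mat_vec[of _ m m _ m]) auto
  also have "A * P = P * D * (Q * P)" unfolding AP using c by (intro assoc_mult_mat) auto
  also have "\<dots> = P * D" using c QP by simp
  also have "P * D *\<^sub>v x = P *\<^sub>v (D *\<^sub>v x)" using c assms by (intro assoc_mult_mat_vec) auto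
  finally have *: "A *\<^sub>v (P *\<^sub>v x) = P *\<^sub>v (D *\<^sub>v x)" .
  show ?thesis using assms c
    by (simp add: shiftm_mult_vec[of _ m] * mult_minus_distrib_mat_vec[of _ m m] mult_mat_vec[of _ m m])
qed

lemma similar_inj:
  fixes A :: "complex mat"
  assumes "similar_mat_wit A D P Q" "A \<in> carrier_mat m m" "x \<in> carrier_vec m" "P *\<^sub>v x = 0\<^sub>v m"
  shows "x = 0\<^sub>v m"
proof -
  have c: "D \<in> carrier_mat m m" "P \<in> carrier_mat m m" "Q \<in> carrier_mat m m"
    and QP: "Q * P = 1\<^sub>m m"
    using assms unfolding similar_mat_wit_def Let_def by auto
  have "x = (Q * P) *\<^sub>v x" using QP assms by simp
  also have "\<dots> = Q *\<^sub>v (P *\<^sub>v x)" using c assms by (intro assoc_mult_mat_vec) auto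
  also have "\<dots> = 0\<^sub>v m" unfolding assms(4) by (rule mult_mat_zero_vec) (use c in auto)
  finally show ?thesis .
qed

text \<open>For a diagonal matrix the condition holds coordinatewise, since a complex number with
  vanishing square is zero. Conversely, in the Jordan form a block of size at least two yields unit
  vectors with e_(i+1) mapped to e_i mapped to 0, which \<open>P\<close> carries to a chain of
  \<open>A\<close>.\<close>

lemma diagonalizable_iff_chain_free:
  assumes A: "A \<in> carrier_mat m m"
  shows "diagonalizable_C A \<longleftrightarrow> chain_free A"
proof
  assume "diagonalizable_C A"
  then obtain D P Q where D: "diagonal_mat D" and w: "similar_mat_wit A D P Q"
    unfolding diagonalizable_C_def similar_mat_def by blast
  have c: "D \<in> carrier_mat m m" "P \<in> carrier_mat m m" "Q \<in> carrier_mat m m" and PQ: "P * Q = 1\<^sub>m m"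
    using similar_mat_witD2[OF A w] by blast+
  show "chain_free A" unfolding chain_free_def
  proof (intro allI ballI impI)
    fix mu x assume x: "x \<in> carrier_vec (dim_row A)"
      and k: "shiftm A mu *\<^sub>v (shiftm A mu *\<^sub>v x) = 0\<^sub>v (dim_row A)"
    have xc: "x \<in> carrier_vec m" using x A by simp
    define y where "y = Q *\<^sub>v x"
    have y: "y \<in> carrier_vec m" using c xc by (simp add: y_def)
    have "x = (P * Q) *\<^sub>v x" using xc PQ by simp
    then have xy: "x = P *\<^sub>v y" unfolding y_def using c xc by (subst (asm) assoc_mult_mat_vec) auto
    have "P *\<^sub>v (shiftm D mu *\<^sub>v (shiftm D mu *\<^sub>v y)) = 0\<^sub>v m"
      using k A y c similar_shiftm[OF w A y, of mu] similar_shiftm[OF w A shiftm_vec_carrier[OF c(1) y], of mu mu]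
      unfolding xy by simp
    from similar_inj[OF w A _ this] have 0: "shiftm D mu *\<^sub>v (shiftm D mu *\<^sub>v y) = 0\<^sub>v m"
      using c y by (simp add: mult_mat_vec_carrier[of _ m m])
    have Dy: "(D *\<^sub>v z) $ i = D $$ (i, i) * z $ i" if "i < m" "z \<in> carrier_vec m" for i z
    proof -
      have "(D *\<^sub>v z) $ i = (\<Sum>k<m. D $$ (i, k) * z $ k)"
        using that c by (auto simp: scalar_prod_def lessThan_atLeast0)
      also have "\<dots> = (\<Sum>k<m. if k = i then D $$ (i, i) * z $ i else 0)"
        using that c D unfolding diagonal_mat_def by (intro sum.cong) auto
      finally show ?thesis using that by simp
    qed
    have sh: "(shiftm D mu *\<^sub>v z) $ i = (D $$ (i, i) - mu) * z $ i" if "i < m" "z \<in> carrier_vec m" for i z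
      using that c by (simp add: shiftm_mult_vec[of D m] Dy algebra_simps del: index_mult_mat_vec)
    have "shiftm D mu *\<^sub>v y = 0\<^sub>v m"
    proof (intro eq_vecI)
      fix i assume "i < dim_vec (0\<^sub>v m :: complex vec)"
      then have i: "i < m" by simp
      have "(D $$ (i, i) - mu) * ((D $$ (i, i) - mu) * y $ i) = 0"
        using arg_cong[OF 0, of "\<lambda>v. v $ i"] i y c
        by (simp add: sh mult_mat_vec_carrier[of _ m m] del: index_mult_mat_vec)
      then show "(shiftm D mu *\<^sub>v y) $ i = 0\<^sub>v m $ i" using i y by (auto simp: sh simp del: index_mult_mat_vec)
    qed (use c in \<open>auto simp: shiftm_def\<close>)
    then show "shiftm A mu *\<^sub>v x = 0\<^sub>v (dim_row A)"
      unfolding xy using A y mult_mat_zero_vec[OF c(2)] by (simp add: similar_shiftm[OF w A])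
  qed
next
  assume cf: "chain_free A"
  obtain as where "char_poly A = (\<Prod>a\<leftarrow>as. [:- a, 1:])"
    using char_poly_factorized[OF A] by blast
  then obtain n_as where jnf: "jordan_nf A n_as" using jordan_nf_exists[OF A] by blast
  let ?J = "jordan_matrix n_as"
  obtain P Q where w: "similar_mat_wit A ?J P Q" and nz: "0 \<notin> fst ` set n_as"
    using jnf unfolding jordan_nf_def similar_mat_def by blast
  have c: "?J \<in> carrier_mat m m" "P \<in> carrier_mat m m"
    using similar_mat_witD2[OF A w] by blast+
  have m: "sum_list (map fst n_as) = m" using c by auto
  have "\<forall>(k, mu) \<in> set n_as. k = 1"
  proof (rule ccontr)
    assume "\<not> (\<forall>(k, mu) \<in> set n_as. k = 1)"
    then obtain k mu where k: "(k, mu) \<in> set n_as" "k \<noteq> 1" by auto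
    \<comment> \<open>A Jordan normal form has no blocks of size 0, so a size other than 1 is at
      least 2.\<close>
    then have "k \<ge> 2" using nz by (cases k) (force simp: image_iff)+
    from jordan_matrix_chain[OF k(1) this] obtain i lam where i: "Suc i < m"
      and col: "\<And>r. r < m \<Longrightarrow> ?J $$ (r, i) = (if r = i then lam else 0)"
        "\<And>r. r < m \<Longrightarrow> ?J $$ (r, Suc i) = (if r = Suc i then lam else if r = i then 1 else 0)"
      unfolding m by blast
    have Je: "?J *\<^sub>v unit_vec m j = col ?J j" if "j < m" for j
      using that c by (intro eq_vecI) auto
    have J1: "shiftm ?J lam *\<^sub>v unit_vec m (Suc i) = unit_vec m i"
      using i c by (intro eq_vecI) (auto simp: shiftm_mult_vec[of _ m] Je col simp del: index_mult_mat_vec)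
    have J0: "shiftm ?J lam *\<^sub>v unit_vec m i = 0\<^sub>v m"
      using i c by (intro eq_vecI) (auto simp: shiftm_mult_vec[of _ m] Je col simp del: index_mult_mat_vec)
    let ?x = "P *\<^sub>v unit_vec m (Suc i)"
    have s1: "shiftm A lam *\<^sub>v ?x = P *\<^sub>v unit_vec m i"
      by (simp add: similar_shiftm[OF w A] J1)
    have "shiftm A lam *\<^sub>v (shiftm A lam *\<^sub>v ?x) = 0\<^sub>v m"
      unfolding s1 using mult_mat_zero_vec[OF c(2)] by (simp add: similar_shiftm[OF w A] J0)
    then have "P *\<^sub>v unit_vec m i = 0\<^sub>v m"
      using cf s1 A c unfolding chain_free_def by (metis carrier_matD(1) mult_mat_vec_carrier unit_vec_carrier)
    from similar_inj[OF w A _ this] have "unit_vec m i = (0\<^sub>v m :: complex vec)" by simp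
    then have "unit_vec m i $ i = (0\<^sub>v m :: complex vec) $ i" by simp
    then show False using i by simp
  qed
  then have "diagonal_mat ?J" by (rule jordan_matrix_diagonal)
  then show "diagonalizable_C A" using jnf unfolding diagonalizable_C_def jordan_nf_def by blast
qed

text \<open>Needed because the linear part of \<open>g_0\<close>, against which the metric is
  tested, is the transpose of \<open>R\<close>, whereas \<open>M\<close> on W has matrix
  \<open>R\<close>.\<close>

lemma chain_free_transpose:
  assumes A: "A \<in> carrier_mat m m" and "chain_free (transpose_mat A)"
  shows "chain_free A"
proof -
  have "diagonalizable_C (transpose_mat A)"
    using assms diagonalizable_iff_chain_free[of "transpose_mat A" m] by simp
  then obtain D P Q where D: "diagonal_mat D" and w: "similar_mat_wit (transpose_mat A) D P Q"
    unfolding diagonalizable_C_def similar_mat_def by blast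
  have c: "D \<in> carrier_mat m m" "P \<in> carrier_mat m m" "Q \<in> carrier_mat m m"
    and e: "P * Q = 1\<^sub>m m" "Q * P = 1\<^sub>m m" "transpose_mat A = P * D * Q"
    using A w unfolding similar_mat_wit_def Let_def by auto
  have "A = transpose_mat (P * D * Q)" using e(3) by (metis transpose_transpose)
  also have "\<dots> = transpose_mat Q * (transpose_mat D * transpose_mat P)"
    using c by (simp add: transpose_mult[of _ m m _ m])
  also have "\<dots> = transpose_mat Q * transpose_mat D * transpose_mat P"
    using c by (intro assoc_mult_mat[symmetric]) auto
  finally have A2: "A = transpose_mat Q * transpose_mat D * transpose_mat P" .
  have "transpose_mat Q * transpose_mat P = 1\<^sub>m m" "transpose_mat P * transpose_mat Q = 1\<^sub>m m"
    using c e by (metis transpose_mult transpose_one)+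
  then have "similar_mat_wit A (transpose_mat D) (transpose_mat Q) (transpose_mat P)"
    using A A2 c unfolding similar_mat_wit_def Let_def by auto
  moreover have "diagonal_mat (transpose_mat D)"
    using D c unfolding diagonal_mat_def by auto
  ultimately have "diagonalizable_C A" unfolding diagonalizable_C_def similar_mat_def by blast
  then show ?thesis using diagonalizable_iff_chain_free[OF A] by simp
qed

lemma mult_mat_vec_index_sum:
  fixes A :: "'a::comm_semiring_0 mat"
  shows "A \<in> carrier_mat r m \<Longrightarrow> x \<in> carrier_vec m \<Longrightarrow> i < r \<Longrightarrow> (A *\<^sub>v x) $ i = (\<Sum>l<m. A $$ (i, l) * x $ l)"
  by (auto simp: scalar_prod_def lessThan_atLeast0)

lemma obtain_inverse:
  fixes A :: "complex mat"
  assumes A: "A \<in> carrier_mat m m" and inj: "\<And>x. x \<in> carrier_vec m \<Longrightarrow> A *\<^sub>v x = 0\<^sub>v m \<Longrightarrow> x = 0\<^sub>v m"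
  obtains B where "B \<in> carrier_mat m m" "A * B = 1\<^sub>m m" "B * A = 1\<^sub>m m"
proof -
  have "det A \<noteq> 0" using det_0_iff_vec_prod_zero[OF A] inj by blast
  from det_non_zero_imp_unit[OF A this] obtain B where "B \<in> carrier_mat m m" "B * A = 1\<^sub>m m" "A * B = 1\<^sub>m m"
    unfolding Units_def by (auto simp: ring_mat_simps)
  then show ?thesis using that by blast
qed

section \<open>Eigenspaces and the lattice of translations\<close>

declare One_nat_def [simp del]

locale endo_pajitnov =
  fixes n :: nat and M :: "int mat" and alpha :: real and beta :: "nat \<Rightarrow> complex"
    and a :: "real vec" and b :: "nat \<Rightarrow> complex vec" and R :: "nat \<Rightarrow> nat \<Rightarrow> complex"
  assumes M_carrier0: "M \<in> carrier_mat (2*n+1) (2*n+1)"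
    and M_SL: "det M = 1"
    and eig: "char_poly (map_mat of_int M :: complex mat) =
              [:- complex_of_real alpha, 1:] * (\<Prod>j\<in>{1..n}. [:- beta j, 1:] * [:- cnj (beta j), 1:])"
    and alpha_pos: "alpha > 0" and alpha_ne1: "alpha \<noteq> 1"
    and beta_im: "\<And>j. j \<in> {1..n} \<Longrightarrow> Im (beta j) > 0"
    and a_carrier0: "a \<in> carrier_vec (2*n+1)" and a_nz0: "a \<noteq> 0\<^sub>v (2*n+1)"
    and a_eig: "(map_mat of_int M :: real mat) *\<^sub>v a = alpha \<cdot>\<^sub>v a"
    and b_carrier0: "\<And>j. j \<in> {1..n} \<Longrightarrow> b j \<in> carrier_vec (2*n+1)"
    and b_basis0: "is_basis_of (2*n+1) n b (EP_W (map_mat of_int M) n beta)"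
    and R_def0: "\<And>j. j \<in> {1..n} \<Longrightarrow> (map_mat of_int M :: complex mat) *\<^sub>v b j =
                 vec (2*n+1) (\<lambda>k. \<Sum>i\<in>{1..n}. R i j * b i $ k)"
begin

definition d :: nat where "d = 2*n+1"
abbreviation Mc :: "complex mat" where "Mc \<equiv> map_mat of_int M"
abbreviation W :: "complex vec set" where "W \<equiv> EP_W Mc n beta"

lemmas M_carrier = M_carrier0[folded d_def] and a_carrier = a_carrier0[folded d_def]
  and a_nz = a_nz0[folded d_def] and b_carrier = b_carrier0[folded d_def]
  and b_basis = b_basis0[folded d_def] and R_def = R_def0[folded d_def]

definition comb :: "(nat \<Rightarrow> complex) \<Rightarrow> complex vec" where
  "comb c = vec d (\<lambda>i. \<Sum>j\<in>{1..n}. c j * b j $ i)"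

lemma Mc_carrier [simp]: "Mc \<in> carrier_mat d d" using M_carrier by simp
lemma Mc_dim [simp]: "dim_row M = d" "dim_col M = d" using M_carrier by auto
lemma comb_carrier [simp]: "comb c \<in> carrier_vec d" by (simp add: comb_def)
lemma comb_dim [simp]: "dim_vec (comb c) = d" by (simp add: comb_def)
lemma a_dim [simp]: "dim_vec a = d" using a_carrier by simp

lemma Mc_b:
  assumes "j \<in> {1..n}" "k < d"
  shows "(\<Sum>l<d. of_int (M $$ (k, l)) * b j $ l) = (\<Sum>i\<in>{1..n}. R i j * b i $ k)"
  using arg_cong[OF R_def[OF assms(1)], of "\<lambda>v. v $ k"] assms b_carrier[OF assms(1)] M_carrier
  by (simp add: mult_mat_vec_index_sum[of _ d d] del: index_mult_mat_vec)

lemma M_a: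
  assumes "k < d"
  shows "(\<Sum>l<d. of_int (M $$ (k, l)) * a $ l) = alpha * a $ k"
  using arg_cong[OF a_eig, of "\<lambda>v. v $ k"] assms a_carrier M_carrier
  by (simp add: mult_mat_vec_index_sum[of _ d d] del: index_mult_mat_vec)

lemma Mc_comb: "Mc *\<^sub>v comb c = comb (\<lambda>i. \<Sum>j\<in>{1..n}. R i j * c j)"
proof (intro eq_vecI)
  fix k assume "k < dim_vec (comb (\<lambda>i. \<Sum>j\<in>{1..n}. R i j * c j))"
  then have k: "k < d" by (simp add: comb_def)
  have "(Mc *\<^sub>v comb c) $ k = (\<Sum>l<d. of_int (M $$ (k, l)) * (\<Sum>j\<in>{1..n}. c j * b j $ l))"
    using k M_carrier by (simp add: mult_mat_vec_index_sum[of _ d d] comb_def del: index_mult_mat_vec)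
  also have "\<dots> = (\<Sum>j\<in>{1..n}. c j * (\<Sum>l<d. of_int (M $$ (k, l)) * b j $ l))"
    unfolding sum_distrib_left by (subst sum.swap) (simp add: mult_ac)
  also have "\<dots> = (\<Sum>j\<in>{1..n}. c j * (\<Sum>i\<in>{1..n}. R i j * b i $ k))"
    using Mc_b[OF _ k] by simp
  also have "\<dots> = (\<Sum>i\<in>{1..n}. (\<Sum>j\<in>{1..n}. R i j * c j) * b i $ k)"
    unfolding sum_distrib_left sum_distrib_right by (subst sum.swap) (simp add: mult_ac)
  finally show "(Mc *\<^sub>v comb c) $ k = comb (\<lambda>i. \<Sum>j\<in>{1..n}. R i j * c j) $ k"
    using k by (simp add: comb_def)
qed (use M_carrier in \<open>simp add: comb_def\<close>)

lemma comb_zero: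
  assumes "comb c = 0\<^sub>v d" "j \<in> {1..n}"
  shows "c j = 0"
proof -
  have "\<forall>i<d. (\<Sum>j\<in>{1..n}. c j * b j $ i) = 0"
    using assms(1) by (auto simp: comb_def vec_eq_iff)
  then show ?thesis using b_basis assms(2) unfolding is_basis_of_def by blast
qed

lemma comb_diff: "comb c - k \<cdot>\<^sub>v comb c' = comb (\<lambda>j. c j - k * c' j)"
  by (intro eq_vecI) (auto simp: comb_def sum_subtractf sum_distrib_left algebra_simps)

lemma comb_eq:
  assumes "comb c = comb c'" "j \<in> {1..n}"
  shows "c j = c' j"
proof -
  have "comb (\<lambda>j. c j - 1 * c' j) = 0\<^sub>v d"
    unfolding comb_diff[symmetric] assms(1) by (intro eq_vecI) (auto simp: comb_def)
  from comb_zero[OF this assms(2)] show ?thesis by simp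
qed

lemma W_comb: "x \<in> W \<Longrightarrow> \<exists>c. x = comb c"
  using b_basis unfolding is_basis_of_def comb_def by blast

lemma gen_subset_W:
  assumes "j \<in> {1..n}" "x \<in> gen_eigenspace Mc (beta j)"
  shows "x \<in> W"
proof -
  let ?y = "\<lambda>i. if i = j then x else 0\<^sub>v d"
  have x: "x \<in> carrier_vec d" using assms by (simp add: gen_eigenspace_iff[OF Mc_carrier])
  have "0\<^sub>v d \<in> gen_eigenspace Mc mu" for mu
    unfolding gen_eigenspace_iff[OF Mc_carrier] by (simp add: shiftms_zero[OF Mc_carrier])
  moreover have "x = vec d (\<lambda>i. \<Sum>l\<in>{1..n}. ?y l $ i)"
  proof (intro eq_vecI)
    fix i assume "i < dim_vec (vec d (\<lambda>i. \<Sum>l\<in>{1..n}. ?y l $ i))"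
    then have "i < d" by simp
    then have "(\<Sum>l\<in>{1..n}. ?y l $ i) = (\<Sum>l\<in>{1..n}. if l = j then x $ i else 0)"
      by (intro sum.cong) auto
    then show "x $ i = vec d (\<lambda>i. \<Sum>l\<in>{1..n}. ?y l $ i) $ i" using assms \<open>i < d\<close> by simp
  qed (use x in auto)
  ultimately show ?thesis unfolding EP_W_def using assms
    by (intro CollectI exI[of _ ?y]) auto
qed

text \<open>Concatenate the annihilators of the summands: shifts commute, so each summand meets the
  factors that kill it.\<close>

lemma killed_sum:
  assumes "finite J" "\<And>j. j \<in> J \<Longrightarrow> y j \<in> carrier_vec d"
    "\<And>j. j \<in> J \<Longrightarrow> \<exists>ms. set ms \<subseteq> S \<and> shiftms Mc ms (y j) = 0\<^sub>v d"
  shows "\<exists>ms. set ms \<subseteq> S \<and> shiftms Mc ms (vec d (\<lambda>i. \<Sum>j\<in>J. y j $ i)) = 0\<^sub>v d"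
  using assms
proof (induction J rule: finite_induct)
  case empty
  have "vec d (\<lambda>i. 0) = (0\<^sub>v d :: complex vec)" by (intro eq_vecI) auto
  then show ?case by (intro exI[of _ "[]"]) simp
next
  case (insert j J)
  obtain ms where ms: "set ms \<subseteq> S" "shiftms Mc ms (vec d (\<lambda>i. \<Sum>j\<in>J. y j $ i)) = 0\<^sub>v d"
    using insert by auto
  obtain ns where ns: "set ns \<subseteq> S" "shiftms Mc ns (y j) = 0\<^sub>v d"
    using insert.prems(2)[of j] by auto
  have yj: "y j \<in> carrier_vec d" using insert by auto
  have "vec d (\<lambda>i. \<Sum>j\<in>insert j J. y j $ i) = y j + vec d (\<lambda>i. \<Sum>j\<in>J. y j $ i)"
    using insert yj by (intro eq_vecI) auto
  then have "shiftms Mc (ms @ ns) (vec d (\<lambda>i. \<Sum>j\<in>insert j J. y j $ i)) =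
      shiftms Mc (ms @ ns) (y j) + shiftms Mc (ms @ ns) (vec d (\<lambda>i. \<Sum>j\<in>J. y j $ i))"
    using yj by (simp only: shiftms_add[OF Mc_carrier] vec_carrier)
  also have "shiftms Mc (ms @ ns) (vec d (\<lambda>i. \<Sum>j\<in>J. y j $ i)) = shiftms Mc (ns @ ms) (vec d (\<lambda>i. \<Sum>j\<in>J. y j $ i))"
    unfolding shiftms_simps by (rule shiftms_commute[OF Mc_carrier vec_carrier])
  also have "shiftms Mc (ms @ ns) (y j) + \<dots> = 0\<^sub>v d" using ms ns by (simp add: shiftms_zero[OF Mc_carrier])
  finally show ?case using ms ns by (intro exI[of _ "ms @ ns"]) auto
qed

lemma W_killed:
  assumes "x \<in> W"
  shows "\<exists>ms. set ms \<subseteq> beta ` {1..n} \<and> shiftms Mc ms x = 0\<^sub>v d"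
proof -
  obtain y where "\<forall>j\<in>{1..n}. y j \<in> gen_eigenspace Mc (beta j)"
    and x: "x = vec d (\<lambda>i. \<Sum>j\<in>{1..n}. y j $ i)" using assms unfolding EP_W_def by auto
  then have y: "\<And>j. j \<in> {1..n} \<Longrightarrow> y j \<in> gen_eigenspace Mc (beta j)" by blast
  show ?thesis unfolding x
  proof (rule killed_sum)
    fix j assume j: "j \<in> {1..n}"
    show "y j \<in> carrier_vec d" using y[OF j] by (simp add: gen_eigenspace_iff[OF Mc_carrier])
    obtain N where "shiftms Mc (replicate N (beta j)) (y j) = 0\<^sub>v d"
      using y[OF j] by (auto simp: gen_eigenspace_iff[OF Mc_carrier])
    then show "\<exists>ms. set ms \<subseteq> beta ` {1..n} \<and> shiftms Mc ms (y j) = 0\<^sub>v d"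
      using j by (intro exI[of _ "replicate N (beta j)"]) auto
  qed simp
qed

lemma comb_killed: "\<exists>ms. set ms \<subseteq> beta ` {1..n} \<and> shiftms Mc ms (comb c) = 0\<^sub>v d"
proof -
  have "comb c = vec d (\<lambda>i. \<Sum>j\<in>{1..n}. (c j \<cdot>\<^sub>v b j) $ i)"
    unfolding comb_def by (intro eq_vecI) (auto intro!: sum.cong simp: carrier_vecD[OF b_carrier])
  moreover have "\<exists>ms. set ms \<subseteq> beta ` {1..n} \<and>
      shiftms Mc ms (vec d (\<lambda>i. \<Sum>j\<in>{1..n}. (c j \<cdot>\<^sub>v b j) $ i)) = 0\<^sub>v d"
  proof (rule killed_sum)
    fix j assume j: "j \<in> {1..n}"
    have "b j \<in> W" using b_basis j unfolding is_basis_of_def by blast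
    from W_killed[OF this] obtain ms where "set ms \<subseteq> beta ` {1..n}" "shiftms Mc ms (b j) = 0\<^sub>v d" by blast
    then show "\<exists>ms. set ms \<subseteq> beta ` {1..n} \<and> shiftms Mc ms (c j \<cdot>\<^sub>v b j) = 0\<^sub>v d"
      using b_carrier[OF j] by (intro exI[of _ ms]) (auto simp: shiftms_smult[OF Mc_carrier])
  qed (use b_carrier in auto)
  ultimately show ?thesis by simp
qed

section \<open>Complex conjugation and the splitting into the line of a, W and the conjugate of
  W\<close>

abbreviation cv :: "complex vec \<Rightarrow> complex vec" where "cv \<equiv> map_vec cnj"

lemma shiftm_cv:
  assumes x: "x \<in> carrier_vec d"
  shows "shiftm Mc (cnj mu) *\<^sub>v cv x = cv (shiftm Mc mu *\<^sub>v x)"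
proof -
  have "Mc *\<^sub>v cv x = cv (Mc *\<^sub>v x)"
    using x M_carrier by (intro eq_vecI) (auto simp: mult_mat_vec_index_sum[of _ d d] simp del: index_mult_mat_vec)
  then show ?thesis using x M_carrier
    by (intro eq_vecI) (auto simp: shiftm_mult_vec[OF Mc_carrier] simp del: index_mult_mat_vec)
qed

lemma shiftms_cv:
  "x \<in> carrier_vec d \<Longrightarrow> shiftms Mc (map cnj ms) (cv x) = cv (shiftms Mc ms x)"
  by (induction ms) (auto simp: shiftm_cv shiftms_carrier[OF Mc_carrier])

lemma cv_zero [simp]: "cv (0\<^sub>v m) = 0\<^sub>v m" by (intro eq_vecI) auto
lemma cv_cv [simp]: "cv (cv x) = x" by (intro eq_vecI) auto

lemma cv_comb_killed: "\<exists>ms. set ms \<subseteq> (cnj \<circ> beta) ` {1..n} \<and> shiftms Mc ms (cv (comb c)) = 0\<^sub>v d"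
proof -
  obtain ms where "set ms \<subseteq> beta ` {1..n}" "shiftms Mc ms (comb c) = 0\<^sub>v d" using comb_killed by blast
  then show ?thesis by (intro exI[of _ "map cnj ms"]) (auto simp: shiftms_cv)
qed

abbreviation ac :: "complex vec" where "ac \<equiv> map_vec of_real a"

lemma ac_carrier [simp]: "ac \<in> carrier_vec d" using a_carrier by simp

lemma ac_killed: "shiftm Mc alpha *\<^sub>v ac = 0\<^sub>v d"
proof (intro eq_vecI)
  fix k assume "k < dim_vec (0\<^sub>v d :: complex vec)"
  then have k: "k < d" by simp
  have "(shiftm Mc alpha *\<^sub>v ac) $ k = of_real (\<Sum>l<d. of_int (M $$ (k, l)) * a $ l) - alpha * a $ k"
    using k a_carrier M_carrier ac_carrier
    by (simp add: shiftm_mult_vec[OF Mc_carrier] mult_mat_vec_index_sum[of _ d d] del: index_mult_mat_vec)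
  then show "(shiftm Mc alpha *\<^sub>v ac) $ k = 0\<^sub>v d $ k" using k M_a[OF k] by simp
qed (use M_carrier in \<open>auto simp: shiftm_def\<close>)

lemma spectra_disjoint:
  "complex_of_real alpha \<notin> beta ` {1..n}" "complex_of_real alpha \<notin> (cnj \<circ> beta) ` {1..n}"
  "beta ` {1..n} \<inter> (cnj \<circ> beta) ` {1..n} = {}"
proof -
  show "complex_of_real alpha \<notin> beta ` {1..n}" "complex_of_real alpha \<notin> (cnj \<circ> beta) ` {1..n}"
    using beta_im by (force simp: complex_eq_iff)+
  have "beta i \<noteq> cnj (beta j)" if "i \<in> {1..n}" "j \<in> {1..n}" for i j
    using beta_im[OF that(1)] beta_im[OF that(2)] by (auto simp: complex_eq_iff)
  then show "beta ` {1..n} \<inter> (cnj \<circ> beta) ` {1..n} = {}" by auto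
qed

text \<open>Spectral separation: the three summands are annihilated by products of shifts with roots
  among the betas, their conjugates, and \<open>alpha\<close>. These sets are disjoint, so a summand
  equal to minus the sum of the others falls under \<open>killed_by_disjoint\<close>.\<close>

lemma abb_independent:
  assumes "c0 \<cdot>\<^sub>v ac + comb c + cv (comb c') = 0\<^sub>v d"
  shows "c0 = 0 \<and> comb c = 0\<^sub>v d \<and> comb c' = 0\<^sub>v d"
proof -
  obtain ms where ms: "set ms \<subseteq> beta ` {1..n}" "shiftms Mc ms (comb c) = 0\<^sub>v d" using comb_killed by blast
  obtain ns where ns: "set ns \<subseteq> (cnj \<circ> beta) ` {1..n}" "shiftms Mc ns (cv (comb c')) = 0\<^sub>v d"
    using cv_comb_killed by blast
  let ?w = "cv (comb c')"
  have w: "?w \<in> carrier_vec d" by simp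
  have e: "comb c = (-1) \<cdot>\<^sub>v (c0 \<cdot>\<^sub>v ac + ?w)"
  proof (intro eq_vecI)
    fix i assume "i < dim_vec ((-1) \<cdot>\<^sub>v (c0 \<cdot>\<^sub>v ac + ?w))"
    then have i: "i < d" using carrier_vecD[OF comb_carrier, of c'] by simp
    then show "comb c $ i = ((-1) \<cdot>\<^sub>v (c0 \<cdot>\<^sub>v ac + ?w)) $ i"
      using arg_cong[OF assms, of "\<lambda>v. v $ i"] a_carrier carrier_vecD[OF comb_carrier]
      by (simp add: algebra_simps eq_neg_iff_add_eq_0)
  qed (use carrier_vecD[OF comb_carrier] in simp)
  \<comment> \<open>The two summands are killed by different factors; reordering brings the right
    factor next to each of them.\<close>
  have k1: "shiftms Mc (ns @ [complex_of_real alpha]) (c0 \<cdot>\<^sub>v ac + ?w) = 0\<^sub>v d"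
  proof -
    have "shiftms Mc (ns @ [complex_of_real alpha]) (c0 \<cdot>\<^sub>v ac + ?w) =
       c0 \<cdot>\<^sub>v shiftms Mc (ns @ [complex_of_real alpha]) ac + shiftms Mc ([complex_of_real alpha] @ ns) ?w"
      using w by (simp add: shiftms_add[OF Mc_carrier] shiftms_smult[OF Mc_carrier] shiftms_shiftm[OF Mc_carrier]
          mult_add_distrib_mat_vec[OF shiftm_carrier[OF Mc_carrier]] mult_mat_vec[OF shiftm_carrier[OF Mc_carrier]]
          shiftm_vec_carrier[OF Mc_carrier] shiftms_carrier[OF Mc_carrier] del: map_carrier_vec)
    also have "\<dots> = 0\<^sub>v d" using ns
      by (intro eq_vecI) (simp_all add: ac_killed shiftms_zero[OF Mc_carrier] shiftm_zero[OF Mc_carrier])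
    finally show ?thesis .
  qed
  have c0: "comb c = 0\<^sub>v d"
  proof (rule killed_by_disjoint[OF Mc_carrier comb_carrier ms(2), where ns = "ns @ [complex_of_real alpha]"])
    show "shiftms Mc (ns @ [complex_of_real alpha]) (comb c) = 0\<^sub>v d"
      unfolding e by (subst shiftms_smult[OF Mc_carrier]) (use k1 w ac_carrier in auto)
    show "set ms \<inter> set (ns @ [complex_of_real alpha]) = {}" using ms ns spectra_disjoint by auto
  qed
  have e2: "?w = (- c0) \<cdot>\<^sub>v ac"
  proof (intro eq_vecI)
    fix i assume "i < dim_vec ((- c0) \<cdot>\<^sub>v ac)"
    then have i: "i < d" using a_carrier by simp
    then show "?w $ i = ((- c0) \<cdot>\<^sub>v ac) $ i"
      using arg_cong[OF assms, of "\<lambda>v. v $ i"] a_carrier c0 carrier_vecD[OF comb_carrier]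
      by (simp add: algebra_simps eq_neg_iff_add_eq_0)
  qed (use carrier_vecD[OF comb_carrier] a_carrier in simp)
  have w0: "?w = 0\<^sub>v d"
  proof (rule killed_by_disjoint[OF Mc_carrier w ns(2), where ns = "[complex_of_real alpha]"])
    show "shiftms Mc [complex_of_real alpha] ?w = 0\<^sub>v d"
      unfolding e2 by (subst shiftms_smult[OF Mc_carrier]) (use ac_killed a_carrier in auto)
    show "set ns \<inter> set [complex_of_real alpha] = {}" using ns spectra_disjoint by auto
  qed
  obtain i where i: "i < d" "a $ i \<noteq> 0" using a_nz a_carrier by (metis carrier_vecD eq_vecI index_zero_vec)
  have "c0 = 0"
    using arg_cong[OF e2[unfolded w0], of "\<lambda>v. v $ i"] i a_carrier by simp
  moreover have "comb c' = 0\<^sub>v d" using w0 by (metis cv_cv cv_zero)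
  ultimately show ?thesis using c0 by blast
qed

text \<open>The period matrix: row i consists of u_i followed by the conjugates of its complex
  entries. It is invertible exactly when the u_i form a real basis of R x C^n.\<close>

definition Cm :: "complex mat" where
  "Cm = mat d d (\<lambda>(i, k). if k = 0 then of_real (a $ i) else if k \<le> n then b k $ i else cnj (b (k - n) $ i))"

lemma Cm_index: "i < d \<Longrightarrow> Cm $$ (i, 0) = of_real (a $ i)"
  "i < d \<Longrightarrow> k \<in> {1..n} \<Longrightarrow> Cm $$ (i, k) = b k $ i"
  "i < d \<Longrightarrow> k \<in> {1..n} \<Longrightarrow> Cm $$ (i, n + k) = cnj (b k $ i)"
  by (auto simp: Cm_def d_def)

lemma sum_d_split: "(\<Sum>k<d. f k) = f 0 + (\<Sum>k\<in>{1..n}. f k) + (\<Sum>k\<in>{1..n}. f (n + k))"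
  for f :: "nat \<Rightarrow> 'b::comm_monoid_add"
proof -
  have "{..<d} = insert 0 ({1..n} \<union> (\<lambda>k. n + k) ` {1..n})"
    by (auto simp: image_iff d_def)
  moreover have "sum f ((\<lambda>k. n + k) ` {1..n}) = (\<Sum>k\<in>{1..n}. f (n + k))"
    by (subst sum.reindex) auto
  ultimately show ?thesis by (simp add: sum.union_disjoint[of "{1..n}"] add.assoc)
qed

lemma Cm_mult: 
  assumes x: "x \<in> carrier_vec d"
  shows "Cm *\<^sub>v x = x $ 0 \<cdot>\<^sub>v ac + comb (\<lambda>j. x $ j) + cv (comb (\<lambda>j. cnj (x $ (n + j))))"
proof (intro eq_vecI)
  fix i assume "i < dim_vec (x $ 0 \<cdot>\<^sub>v ac + comb (\<lambda>j. x $ j) + cv (comb (\<lambda>j. cnj (x $ (n + j)))))"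
  then have i: "i < d" using carrier_vecD[OF comb_carrier] by simp
  have C: "Cm \<in> carrier_mat d d" by (simp add: Cm_def)
  have "(Cm *\<^sub>v x) $ i = (\<Sum>l<d. Cm $$ (i, l) * x $ l)"
    by (rule mult_mat_vec_index_sum[OF C x i])
  also have "\<dots> = Cm $$ (i, 0) * x $ 0 + (\<Sum>l\<in>{1..n}. Cm $$ (i, l) * x $ l) + (\<Sum>l\<in>{1..n}. Cm $$ (i, n + l) * x $ (n + l))"
    by (rule sum_d_split)
  also have "(\<Sum>l\<in>{1..n}. Cm $$ (i, l) * x $ l) = comb (\<lambda>j. x $ j) $ i"
    using i by (auto simp: comb_def Cm_index mult.commute intro!: sum.cong)
  also have "(\<Sum>l\<in>{1..n}. Cm $$ (i, n + l) * x $ (n + l)) = cv (comb (\<lambda>j. cnj (x $ (n + j)))) $ i"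
    using i by (auto simp: comb_def Cm_index mult.commute intro!: sum.cong)
  finally show "(Cm *\<^sub>v x) $ i = (x $ 0 \<cdot>\<^sub>v ac + comb (\<lambda>j. x $ j) + cv (comb (\<lambda>j. cnj (x $ (n + j))))) $ i"
    using i a_carrier carrier_vecD[OF comb_carrier] by (simp add: Cm_index del: index_mult_mat_vec)
qed (use carrier_vecD[OF comb_carrier] in \<open>simp add: Cm_def\<close>)

lemma Cm_inverse: obtains B where "B \<in> carrier_mat d d" "Cm * B = 1\<^sub>m d" "B * Cm = 1\<^sub>m d"
proof -
  have C: "Cm \<in> carrier_mat d d" by (simp add: Cm_def)
  have "x = 0\<^sub>v d" if x: "x \<in> carrier_vec d" and 0: "Cm *\<^sub>v x = 0\<^sub>v d" for x
  proof -
    from abb_independent[OF 0[unfolded Cm_mult[OF x]]]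
    have z: "x $ 0 = 0" "\<And>j. j \<in> {1..n} \<Longrightarrow> x $ j = 0" "\<And>j. j \<in> {1..n} \<Longrightarrow> x $ (n + j) = 0"
      using comb_zero by fastforce+
    show ?thesis
    proof (intro eq_vecI)
      fix i assume "i < dim_vec (0\<^sub>v d :: complex vec)"
      then have i: "i < d" by simp
      then consider "i = 0" | "i \<in> {1..n}" | "i - n \<in> {1..n}" "i = n + (i - n)"
        unfolding d_def by force
      then show "x $ i = 0\<^sub>v d $ i"
      proof cases
        case 3
        then show ?thesis using z(3)[OF 3(1)] i by simp
      qed (use z i in auto)
    qed (use x in auto)
  qed
  from obtain_inverse[OF C this] show ?thesis using that by blast
qed

text \<open>The dimension count 2n+1 = 1 + n + n in matrix form: independence makes the square
  matrix \<open>Cm\<close> injective, hence surjective.\<close>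

lemma abb_span:
  assumes x: "x \<in> carrier_vec d"
  shows "\<exists>c0 c c'. x = c0 \<cdot>\<^sub>v ac + comb c + cv (comb c')"
proof -
  obtain B where B: "B \<in> carrier_mat d d" "Cm * B = 1\<^sub>m d" by (rule Cm_inverse)
  have C: "Cm \<in> carrier_mat d d" by (simp add: Cm_def)
  have "x = (Cm * B) *\<^sub>v x" using B x by simp
  also have "\<dots> = Cm *\<^sub>v (B *\<^sub>v x)" using C B x by (intro assoc_mult_mat_vec) auto
  finally show ?thesis using Cm_mult[of "B *\<^sub>v x"] B x by (metis mult_mat_vec_carrier)
qed

text \<open>The solution of the complex linear system may be replaced by its real part, because the
  system consists of conjugate pairs of equations.\<close>
lemma lattice_spans:
  fixes t :: "nat \<Rightarrow> complex" and t0 :: real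
  shows "\<exists>s :: nat \<Rightarrow> real. (\<Sum>i<d. s i * a $ i) = t0 \<and> (\<forall>k\<in>{1..n}. (\<Sum>i<d. of_real (s i) * b k $ i) = t k)"
proof -
  obtain B where B: "B \<in> carrier_mat d d" "B * Cm = 1\<^sub>m d" by (rule Cm_inverse)
  define T where "T k = (if k = 0 then of_real t0 else if k \<le> n then t k else cnj (t (k - n)))" for k
  define s where "s i = (\<Sum>l<d. T l * B $$ (l, i))" for i
  have C: "Cm \<in> carrier_mat d d" by (simp add: Cm_def)
  have key: "(\<Sum>i<d. s i * Cm $$ (i, k)) = T k" if k: "k < d" for k
  proof -
    have "(\<Sum>i<d. s i * Cm $$ (i, k)) = (\<Sum>l<d. T l * (\<Sum>i<d. B $$ (l, i) * Cm $$ (i, k)))"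
      unfolding s_def sum_distrib_left sum_distrib_right by (subst sum.swap) (simp add: mult_ac)
    also have "\<dots> = (\<Sum>l<d. T l * (B * Cm) $$ (l, k))"
      using B(1) C k by (intro sum.cong) (auto simp: scalar_prod_def lessThan_atLeast0 simp del: B(2))
    also have "\<dots> = (\<Sum>l<d. if l = k then T k else 0)"
      unfolding B(2) using k by (intro sum.cong) auto
    finally show ?thesis using k by simp
  qed
  have 1: "(\<Sum>i<d. Re (s i) * a $ i) = t0"
    using arg_cong[OF key[of 0], of Re] by (simp add: Cm_index T_def d_def)
  have 2: "(\<Sum>i<d. of_real (Re (s i)) * b k $ i) = t k" if k: "k \<in> {1..n}" for k
  proof -
    have e1: "(\<Sum>i<d. s i * b k $ i) = t k" using key[of k] k by (simp add: Cm_index T_def d_def)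
    have "(\<Sum>i<d. s i * cnj (b k $ i)) = cnj (t k)" using key[of "n + k"] k by (simp add: Cm_index T_def d_def)
    from arg_cong[OF this, of cnj] have e2: "(\<Sum>i<d. cnj (s i) * b k $ i) = t k" by simp
    have "(\<Sum>i<d. of_real (Re (s i)) * b k $ i) = (\<Sum>i<d. (s i + cnj (s i)) / 2 * b k $ i)"
      by (simp add: complex_add_cnj)
    also have "\<dots> = ((\<Sum>i<d. s i * b k $ i) + (\<Sum>i<d. cnj (s i) * b k $ i)) / 2"
      unfolding sum.distrib[symmetric] sum_divide_distrib by (intro sum.cong) (auto simp: field_simps)
    finally show ?thesis using e1 e2 by simp
  qed
  show ?thesis using 1 2 by (intro exI[of _ "\<lambda>i. Re (s i)"]) auto
qed

end

section \<open>Sesquilinear forms scaled by the monodromy\<close>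

definition sesq :: "nat \<Rightarrow> (nat \<Rightarrow> nat \<Rightarrow> complex) \<Rightarrow> (nat \<Rightarrow> complex) \<Rightarrow> (nat \<Rightarrow> complex) \<Rightarrow> complex" where
  "sesq n P u v = (\<Sum>j\<in>{1..n}. \<Sum>k\<in>{1..n}. P j k * u j * cnj (v k))"

lemma sesq_cong:
  "(\<And>j. j \<in> {1..n} \<Longrightarrow> u j = u' j) \<Longrightarrow> (\<And>j. j \<in> {1..n} \<Longrightarrow> v j = v' j) \<Longrightarrow> sesq n P u v = sesq n P u' v'"
  by (simp add: sesq_def)

lemma sesq_linear:
  "sesq n P (\<lambda>j. c * u j + w j) v = c * sesq n P u v + sesq n P w v"
  "sesq n P u (\<lambda>j. c * v j) = cnj c * sesq n P u v"
  "sesq n P (\<lambda>j. c * u j) v = c * sesq n P u v"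
  "sesq n (\<lambda>j k. P j k + Q j k) u v = sesq n P u v + sesq n Q u v"
  by (simp_all add: sesq_def sum.distrib sum_distrib_left algebra_simps)

text \<open>Substituting the transpose of \<open>R\<close> in both arguments replaces the
  coefficient matrix P by R P R*, the expression that invariance under \<open>g_0\<close>
  produces.\<close>

lemma sesq_pullback:
  "sesq n P (\<lambda>k. \<Sum>i\<in>{1..n}. R i k * u i) (\<lambda>l. \<Sum>j\<in>{1..n}. R j l * v j) =
   sesq n (\<lambda>i j. \<Sum>k\<in>{1..n}. \<Sum>l\<in>{1..n}. P k l * R i k * cnj (R j l)) u v"
proof -
  have "sesq n P (\<lambda>k. \<Sum>i\<in>{1..n}. R i k * u i) (\<lambda>l. \<Sum>j\<in>{1..n}. R j l * v j) =
    (\<Sum>k\<in>{1..n}. \<Sum>l\<in>{1..n}. \<Sum>i\<in>{1..n}. \<Sum>j\<in>{1..n}. P k l * R i k * cnj (R j l) * u i * cnj (v j))"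
    unfolding sesq_def sum_distrib_left sum_distrib_right cnj_sum
    by (rule sum.cong[OF refl], rule sum.cong[OF refl], subst sum.swap) (simp add: mult_ac)
  also have "\<dots> = (\<Sum>k\<in>{1..n}. \<Sum>i\<in>{1..n}. \<Sum>j\<in>{1..n}. \<Sum>l\<in>{1..n}. P k l * R i k * cnj (R j l) * u i * cnj (v j))"
    by (rule sum.cong[OF refl], subst sum.swap, rule sum.cong[OF refl], subst sum.swap) simp
  also have "\<dots> = (\<Sum>i\<in>{1..n}. \<Sum>j\<in>{1..n}. \<Sum>k\<in>{1..n}. \<Sum>l\<in>{1..n}. P k l * R i k * cnj (R j l) * u i * cnj (v j))"
    by (subst sum.swap, rule sum.cong[OF refl], subst sum.swap) simp
  finally show ?thesis unfolding sesq_def sum_distrib_left sum_distrib_right .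
qed

lemma sesq_eigenvector:
  assumes inv: "\<And>u v. kap * sesq n P (S u) (S v) = sesq n P u v"
    and v: "\<And>j. j \<in> {1..n} \<Longrightarrow> S v j = lam * v j"
  shows "kap * (lam * cnj lam) = 1 \<or> sesq n P v v = 0"
proof -
  have "sesq n P (S v) (S v) = lam * cnj lam * sesq n P v v"
    using v by (subst sesq_cong[where u' = "\<lambda>j. lam * v j" and v' = "\<lambda>j. lam * v j"]) (auto simp: sesq_linear)
  then show ?thesis using inv[of v v] by (simp add: algebra_simps) (metis mult_cancel_right1 mult.assoc)
qed

text \<open>If v were not isotropic, then \<open>kap * (lam * cnj lam) = 1\<close>. Invariance at
  the pair (z, v) then cancels the value at (z, v) on both sides and leaves
  \<open>kap * cnj lam\<close> times the value at (v, v), which would have to be zero.\<close>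

lemma sesq_jordan_chain:
  assumes inv: "\<And>u v. kap * sesq n P (S u) (S v) = sesq n P u v"
    and v: "\<And>j. j \<in> {1..n} \<Longrightarrow> S v j = lam * v j"
    and z: "\<And>j. j \<in> {1..n} \<Longrightarrow> S z j = lam * z j + v j"
  shows "sesq n P v v = 0"
proof (rule ccontr)
  assume nz: "sesq n P v v \<noteq> 0"
  then have 1: "kap * (lam * cnj lam) = 1" using sesq_eigenvector[of kap n P S v lam] inv v by blast
  have "sesq n P (S z) (S v) = cnj lam * (lam * sesq n P z v + sesq n P v v)"
    using v z by (subst sesq_cong[where u' = "\<lambda>j. lam * z j + v j" and v' = "\<lambda>j. lam * v j"]) (simp_all only: sesq_linear distrib_left mult_ac)
  then have "sesq n P z v = kap * (lam * cnj lam) * sesq n P z v + kap * cnj lam * sesq n P v v"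
    using inv[of z v] by (simp add: algebra_simps)
  then show False using 1 nz by auto
qed

section \<open>Transfer between M on W and the matrix R, and the spectral conclusion\<close>

context endo_pajitnov
begin

definition Rm :: "complex mat" where "Rm = mat n n (\<lambda>(i, j). R (Suc i) (Suc j))"
definition pack :: "(nat \<Rightarrow> complex) \<Rightarrow> complex vec" where "pack c = vec n (\<lambda>i. c (Suc i))"

lemma Rm_carrier [simp]: "Rm \<in> carrier_mat n n" by (simp add: Rm_def)
lemma RmT_carrier [simp]: "transpose_mat Rm \<in> carrier_mat n n" by (simp add: Rm_def)
lemma pack_carrier [simp]: "pack c \<in> carrier_vec n" by (simp add: pack_def)

lemma sum_1n: "(\<Sum>j\<in>{1..n}. f j) = (\<Sum>j<n. f (Suc j))" for f :: "nat \<Rightarrow> 'b::comm_monoid_add"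
  unfolding One_nat_def by (rule sum.atLeast1_atMost_eq)

lemma pack_eq: "pack c = pack c' \<longleftrightarrow> (\<forall>j\<in>{1..n}. c j = c' j)"
proof
  assume e: "pack c = pack c'"
  show "\<forall>j\<in>{1..n}. c j = c' j"
  proof
    fix j assume "j \<in> {1..n}"
    then obtain i where "j = Suc i" "i < n" by (cases j) auto
    then show "c j = c' j" using arg_cong[OF e, of "\<lambda>v. v $ i"] by (simp add: pack_def)
  qed
qed (auto simp: pack_def)

lemma pack_surj: "x \<in> carrier_vec n \<Longrightarrow> \<exists>c. x = pack c"
  by (intro exI[of _ "\<lambda>j. x $ (j - 1)"] eq_vecI) (auto simp: pack_def)

lemma pack_zero: "pack (\<lambda>_. 0) = 0\<^sub>v n" by (intro eq_vecI) (auto simp: pack_def)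

lemma Rm_mult: "Rm *\<^sub>v pack c = pack (\<lambda>i. \<Sum>j\<in>{1..n}. R i j * c j)"
  unfolding sum_1n
  by (intro eq_vecI) (auto simp: Rm_def pack_def scalar_prod_def lessThan_atLeast0)

lemma RmT_mult: "transpose_mat Rm *\<^sub>v pack c = pack (\<lambda>j. \<Sum>i\<in>{1..n}. R i j * c i)"
  unfolding sum_1n
  by (intro eq_vecI) (auto simp: Rm_def pack_def scalar_prod_def lessThan_atLeast0)

lemma shiftm_Rm: "shiftm Rm mu *\<^sub>v pack c = pack (\<lambda>i. (\<Sum>j\<in>{1..n}. R i j * c j) - mu * c i)"
  unfolding shiftm_mult_vec[OF Rm_carrier pack_carrier] Rm_mult
  by (intro eq_vecI) (auto simp: pack_def)

lemma shiftm_RmT: "shiftm (transpose_mat Rm) mu *\<^sub>v pack c = pack (\<lambda>j. (\<Sum>i\<in>{1..n}. R i j * c i) - mu * c j)"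
  unfolding shiftm_mult_vec[OF RmT_carrier pack_carrier] RmT_mult
  by (intro eq_vecI) (auto simp: pack_def)

text \<open>\<open>comb\<close> intertwines \<open>R\<close> with \<open>M\<close> on W; being
  injective as well (\<open>comb_zero_iff\<close>), it identifies kernels and Jordan chains of the
  two.\<close>

lemma shiftm_comb: "shiftm Mc mu *\<^sub>v comb c = comb (\<lambda>i. (\<Sum>j\<in>{1..n}. R i j * c j) - mu * c i)"
  unfolding shiftm_mult_vec[OF Mc_carrier comb_carrier] Mc_comb comb_diff ..

lemma comb_zero_iff: "comb c = 0\<^sub>v d \<longleftrightarrow> pack c = 0\<^sub>v n"
proof
  assume "comb c = 0\<^sub>v d"
  then show "pack c = 0\<^sub>v n" unfolding pack_zero[symmetric] pack_eq using comb_zero by blast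
next
  assume "pack c = 0\<^sub>v n"
  then have "\<forall>j\<in>{1..n}. c j = 0" unfolding pack_zero[symmetric] pack_eq .
  then show "comb c = 0\<^sub>v d" by (intro eq_vecI) (auto simp: comb_def)
qed

text \<open>An eigenvector of \<open>M\<close> for \<open>beta j\<close> lies in W, so its
  coordinates in the basis b form an eigenvector of \<open>R\<close>.\<close>

lemma beta_eigenvector:
  assumes j: "j \<in> {1..n}"
  shows "\<exists>c. pack c \<noteq> 0\<^sub>v n \<and> shiftm Rm (beta j) *\<^sub>v pack c = 0\<^sub>v n"
proof -
  have "poly (char_poly Mc) (beta j) = 0" unfolding eig poly_mult poly_prod
    using j by (intro mult_eq_0_iff[THEN iffD2, OF disjI2] prod_zero) (simp, rule bexI[of _ j], simp, simp)
  then have "eigenvalue Mc (beta j)" using eigenvalue_root_char_poly[OF Mc_carrier] by simp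
  then obtain v where v: "v \<in> carrier_vec d" "v \<noteq> 0\<^sub>v d" "Mc *\<^sub>v v = beta j \<cdot>\<^sub>v v"
    unfolding eigenvalue_def eigenvector_def by auto
  have k: "shiftm Mc (beta j) *\<^sub>v v = 0\<^sub>v d"
    unfolding shiftm_mult_vec[OF Mc_carrier v(1)] v(3) using v(1) by (intro eq_vecI) auto
  have "v \<in> gen_eigenspace Mc (beta j)"
    unfolding gen_eigenspace_iff[OF Mc_carrier] using v k by (intro conjI exI[of _ "1"]) (auto simp: One_nat_def)
  then obtain c where c: "v = comb c" using W_comb gen_subset_W[OF j] by blast
  show ?thesis using k v(2) unfolding c shiftm_comb comb_zero_iff shiftm_Rm by blast
qed

text \<open>By the location of mu. Among the betas, the chain lies in W and is seen by
  \<open>R\<close>. Among their conjugates, conjugation reduces to the first case because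
  \<open>M\<close> is real. At \<open>alpha\<close>, the components in W and its conjugate vanish,
  leaving a multiple of the eigenvector a. Elsewhere the whole vector vanishes.\<close>

lemma chain_free_Mc:
  assumes "chain_free Rm"
  shows "chain_free Mc"
  unfolding chain_free_def
proof (intro allI ballI impI)
  have dr: "dim_row Mc = d" by simp
  fix mu x assume "x \<in> carrier_vec (dim_row Mc)" 
    and k2: "shiftm Mc mu *\<^sub>v (shiftm Mc mu *\<^sub>v x) = 0\<^sub>v (dim_row Mc)"
  then have x: "x \<in> carrier_vec d" and k: "shiftm Mc mu *\<^sub>v (shiftm Mc mu *\<^sub>v x) = 0\<^sub>v d" by simp_all
  have in_W: "shiftm Mc nu *\<^sub>v y = 0\<^sub>v d" if y: "y \<in> carrier_vec d"
      and k: "shiftm Mc nu *\<^sub>v (shiftm Mc nu *\<^sub>v y) = 0\<^sub>v d" and nu: "nu \<in> beta ` {1..n}" for nu y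
  proof -
    obtain j where j: "j \<in> {1..n}" "nu = beta j" using nu by blast
    have "y \<in> gen_eigenspace Mc (beta j)"
      unfolding gen_eigenspace_iff[OF Mc_carrier] using y k j by (intro conjI exI[of _ "2"]) (auto simp: numeral_2_eq_2)
    then obtain c where c: "y = comb c" using W_comb gen_subset_W[OF j(1)] by blast
    have "shiftm Rm nu *\<^sub>v (shiftm Rm nu *\<^sub>v pack c) = 0\<^sub>v n"
      using k unfolding c shiftm_comb comb_zero_iff shiftm_Rm .
    then have "shiftm Rm nu *\<^sub>v pack c = 0\<^sub>v n"
      using assms unfolding chain_free_def by (metis Rm_carrier carrier_matD(1) pack_carrier)
    then show ?thesis unfolding c shiftm_comb comb_zero_iff shiftm_Rm .
  qed
  have "shiftm Mc mu *\<^sub>v x = 0\<^sub>v d"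
  proof (cases "mu \<in> beta ` {1..n}")
    case True
    then show ?thesis using in_W x k by blast
  next
    case nb: False
    show ?thesis
    proof (cases "mu \<in> (cnj \<circ> beta) ` {1..n}")
      case True
      then obtain j where j: "j \<in> {1..n}" "mu = cnj (beta j)" by auto
      have xx: "cv x \<in> carrier_vec d" "shiftm Mc mu *\<^sub>v x \<in> carrier_vec d"
        using x by (auto simp: shiftm_vec_carrier[OF Mc_carrier])
      have s: "shiftm Mc (beta j) *\<^sub>v cv y = cv (shiftm Mc mu *\<^sub>v y)" if "y \<in> carrier_vec d" for y
        using shiftm_cv[OF that, of mu] j by simp
      have "shiftm Mc (beta j) *\<^sub>v cv x = 0\<^sub>v d"
      proof (rule in_W[OF xx(1)])
        show "shiftm Mc (beta j) *\<^sub>v (shiftm Mc (beta j) *\<^sub>v cv x) = 0\<^sub>v d"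
          using k by (simp add: s[OF x] s[OF xx(2)])
      qed (use j in auto)
      then show ?thesis using s[OF x] by (metis cv_cv cv_zero)
    next
      case nc: False
      obtain c0 c c' where xe: "x = c0 \<cdot>\<^sub>v ac + comb c + cv (comb c')" using abb_span[OF x] by blast
      obtain ms where ms: "set ms \<subseteq> beta ` {1..n}" "shiftms Mc ms (comb c) = 0\<^sub>v d" using comb_killed by blast
      obtain ns where ns: "set ns \<subseteq> (cnj \<circ> beta) ` {1..n}" "shiftms Mc ns (cv (comb c')) = 0\<^sub>v d"
        using cv_comb_killed by blast
      have cvc: "cv (comb c') \<in> carrier_vec d" by simp
      have k3: "shiftms Mc (ms @ ns) (comb c + cv (comb c')) = 0\<^sub>v d"
      proof -
        have "shiftms Mc (ms @ ns) (comb c + cv (comb c')) = shiftms Mc (ms @ ns) (comb c) + shiftms Mc (ms @ ns) (cv (comb c'))"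
          by (rule shiftms_add[OF Mc_carrier comb_carrier cvc])
        also have "shiftms Mc (ms @ ns) (comb c) = shiftms Mc ns (shiftms Mc ms (comb c))"
          unfolding shiftms_simps by (rule shiftms_commute[OF Mc_carrier comb_carrier])
        finally show ?thesis using ms ns by (simp add: shiftms_zero[OF Mc_carrier])
      qed
      \<comment> \<open>The product of shifts over the three parts of the spectrum kills x, whatever
        its components are.\<close>
      have k4: "shiftms Mc (ms @ ns @ [complex_of_real alpha]) x = 0\<^sub>v d"
      proof -
        have e: "x = c0 \<cdot>\<^sub>v ac + (comb c + cv (comb c'))" unfolding xe
          by (rule assoc_add_vec[of _ d]) (use a_carrier in auto)
        have "shiftms Mc (ms @ ns @ [complex_of_real alpha]) x =
          c0 \<cdot>\<^sub>v shiftms Mc (ms @ ns @ [complex_of_real alpha]) ac + shiftms Mc ((ms @ ns) @ [complex_of_real alpha]) (comb c + cv (comb c'))"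
          unfolding e using a_carrier by (subst shiftms_add[OF Mc_carrier]) (auto simp: shiftms_smult[OF Mc_carrier] simp del: shiftms_simps)
        also have "shiftms Mc ((ms @ ns) @ [complex_of_real alpha]) (comb c + cv (comb c')) = 
          shiftm Mc alpha *\<^sub>v shiftms Mc (ms @ ns) (comb c + cv (comb c'))"
          by (subst shiftms_shiftm[OF Mc_carrier, symmetric]) auto
        finally show ?thesis unfolding k3
          by (auto simp: ac_killed shiftms_zero[OF Mc_carrier] shiftm_zero[OF Mc_carrier] intro!: eq_vecI)
      qed
      have k2': "shiftms Mc [mu, mu] x = 0\<^sub>v d" using k by simp
      show ?thesis
      proof (cases "mu = alpha")
        case False
        have "x = 0\<^sub>v d" by (rule killed_by_disjoint[OF Mc_carrier x k2' k4]) (use False nb nc ms ns in auto)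
        then show ?thesis by (simp add: shiftm_zero[OF Mc_carrier])
      next
        case True
        have w: "comb c + cv (comb c') = 0\<^sub>v d"
        proof (rule killed_by_disjoint[OF Mc_carrier _ _ k3])
          \<comment> \<open>Removing the multiple of a keeps the vector killed by the square of the
            shift, since a is killed by the shift itself.\<close>
          have "comb c + cv (comb c') = x + (- c0) \<cdot>\<^sub>v ac"
            unfolding xe by (intro eq_vecI) auto
          then have "shiftms Mc [mu, mu] (comb c + cv (comb c')) = shiftms Mc [mu, mu] x + (- c0) \<cdot>\<^sub>v shiftms Mc [mu, mu] ac"
            using x a_carrier by (simp only:) (subst shiftms_add[OF Mc_carrier], auto simp: shiftms_smult[OF Mc_carrier] simp del: shiftms_simps)
          also have "\<dots> = 0\<^sub>v d" unfolding k2' using ac_killed True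
            by (auto simp: shiftm_zero[OF Mc_carrier] intro!: eq_vecI)
          finally show "shiftms Mc [mu, mu] (comb c + cv (comb c')) = 0\<^sub>v d" .
        qed (use nb nc ms ns in auto)
        have "x = c0 \<cdot>\<^sub>v ac + (comb c + cv (comb c'))" unfolding xe by (rule assoc_add_vec[of _ d]) (use a_carrier in auto)
        then have "x = c0 \<cdot>\<^sub>v ac" unfolding w using a_carrier by simp
        then have "shiftm Mc mu *\<^sub>v x = c0 \<cdot>\<^sub>v (shiftm Mc mu *\<^sub>v ac)"
          using mult_mat_vec[OF shiftm_carrier[OF Mc_carrier] ac_carrier] by simp
        then show ?thesis using ac_killed True by (auto intro!: eq_vecI)
      qed
    qed
  qed
  then show "shiftm Mc mu *\<^sub>v x = 0\<^sub>v (dim_row Mc)" by simp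
qed

text \<open>The characteristic polynomial at 0: the determinant gives (-1)^d with d odd, and the
  factorization gives minus the product of all eigenvalues.\<close>

lemma beta_norm_prod: "alpha * (\<Prod>j\<in>{1..n}. (cmod (beta j))\<^sup>2) = 1"
proof -
  have neg: "- char_matrix Mc 0 = (-1) \<cdot>\<^sub>m Mc" by (intro eq_matI) (auto simp: char_matrix_def)
  have "poly (char_poly Mc) 0 = (-1) ^ d * det Mc"
    unfolding char_poly_matrix[OF Mc_carrier] neg by simp
  also have "det Mc = of_int (det M)" by simp
  also have "(-1) ^ d = (-1 :: complex)" by (simp add: d_def)
  finally have "poly (char_poly Mc) 0 = -1" using M_SL by simp
  moreover have "poly (char_poly Mc) 0 = - of_real (alpha * (\<Prod>j\<in>{1..n}. (cmod (beta j))\<^sup>2))"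
    unfolding eig by (simp add: poly_prod complex_norm_square mult.commute del: of_real_power)
  ultimately have "of_real (alpha * (\<Prod>j\<in>{1..n}. (cmod (beta j))\<^sup>2)) = (1 :: complex)" by simp
  then show ?thesis using of_real_eq_1_iff by blast
qed

text \<open>The factors 1 and \<open>alpha\<close> are the possible values of \<open>kap\<close> in
  the preceding lemmas. A vector that is not isotropic for the sum is not isotropic for one of the
  two forms, and that form dictates the modulus of the eigenvalue.\<close>

lemma forms_imp_spectrum:
  fixes P Q :: "nat \<Rightarrow> nat \<Rightarrow> complex"
  assumes P: "\<And>i j. i \<in> {1..n} \<Longrightarrow> j \<in> {1..n} \<Longrightarrow>
      P i j = (\<Sum>k\<in>{1..n}. \<Sum>l\<in>{1..n}. P k l * R i k * cnj (R j l))"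
    and Q: "\<And>i j. i \<in> {1..n} \<Longrightarrow> j \<in> {1..n} \<Longrightarrow>
      Q i j = alpha * (\<Sum>k\<in>{1..n}. \<Sum>l\<in>{1..n}. Q k l * R i k * cnj (R j l))"
    and pos: "\<And>v. (\<exists>k\<in>{1..n}. v k \<noteq> 0) \<Longrightarrow> sesq n (\<lambda>j k. P j k + Q j k) v v \<noteq> 0"
  shows "diagonalizable_C Mc \<and>
     (\<exists>i0\<in>{1..n}. complex_of_real alpha * beta i0 * cnj (beta i0) = 1 \<and>
        (\<forall>i\<in>{1..n}. i \<noteq> i0 \<longrightarrow> cmod (beta i) = 1))"
proof
  \<comment> \<open>The transpose of \<open>R\<close>, that is, the linear part of
    \<open>g_0\<close> on C^n.\<close>
  define S where "S v = (\<lambda>k. \<Sum>i\<in>{1..n}. R i k * v i)" for v :: "nat \<Rightarrow> complex"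
  have PS: "1 * sesq n P (S u) (S v) = sesq n P u v" for u v
    unfolding S_def sesq_pullback by (simp add: sesq_def P[symmetric])
  have QS: "alpha * sesq n Q (S u) (S v) = sesq n Q u v" for u v
  proof -
    have "alpha * sesq n Q (S u) (S v) =
      sesq n (\<lambda>i j. alpha * (\<Sum>k\<in>{1..n}. \<Sum>l\<in>{1..n}. Q k l * R i k * cnj (R j l))) u v"
      unfolding S_def sesq_pullback by (simp add: sesq_def sum_distrib_left mult_ac)
    then show ?thesis by (simp add: sesq_def Q[symmetric])
  qed
  have cf: "chain_free Rm"
  proof (rule chain_free_transpose[OF Rm_carrier], unfold chain_free_def, intro allI ballI impI)
    fix mu x assume x: "x \<in> carrier_vec (dim_row (transpose_mat Rm))"
      and k: "shiftm (transpose_mat Rm) mu *\<^sub>v (shiftm (transpose_mat Rm) mu *\<^sub>v x) = 0\<^sub>v (dim_row (transpose_mat Rm))"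
    have dr: "dim_row (transpose_mat Rm) = n" by (simp add: Rm_def)
    obtain z where z: "x = pack z" using pack_surj x dr by auto
    define v where "v j = S z j - mu * z j" for j
    have "\<forall>j\<in>{1..n}. S v j - mu * v j = 0"
      using k unfolding z dr shiftm_RmT pack_zero[symmetric] pack_eq v_def S_def .
    then have v: "\<And>j. j \<in> {1..n} \<Longrightarrow> S v j = mu * v j" by simp
    have zv: "\<And>j. j \<in> {1..n} \<Longrightarrow> S z j = mu * z j + v j" by (simp add: v_def)
    \<comment> \<open>Here v is the end of a Jordan chain starting at z, so it is isotropic for both
      forms.\<close>
    have "sesq n (\<lambda>j k. P j k + Q j k) v v = 0"
      using sesq_jordan_chain[of 1 n P S v mu z, OF PS v zv] sesq_jordan_chain[of alpha n Q S v mu z, OF QS v zv]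
      by (simp add: sesq_linear)
    then have "\<forall>j\<in>{1..n}. v j = 0" using pos by blast
    then show "shiftm (transpose_mat Rm) mu *\<^sub>v x = 0\<^sub>v (dim_row (transpose_mat Rm))"
      unfolding z dr shiftm_RmT pack_zero[symmetric] pack_eq v_def S_def .
  qed
  show "diagonalizable_C Mc"
    using chain_free_Mc[OF cf] diagonalizable_iff_chain_free[OF Mc_carrier] by simp
  have ev: "alpha * (cmod (beta j))\<^sup>2 = 1 \<or> cmod (beta j) = 1" if j: "j \<in> {1..n}" for j
  proof -
    obtain c where c: "pack c \<noteq> 0\<^sub>v n" "shiftm Rm (beta j) *\<^sub>v pack c = 0\<^sub>v n" using beta_eigenvector[OF j] by blast
    have "Rm *\<^sub>v pack c = beta j \<cdot>\<^sub>v pack c"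
    proof (intro eq_vecI)
      fix i assume "i < dim_vec (beta j \<cdot>\<^sub>v pack c)"
      then have i: "i < n" by (simp add: pack_def)
      show "(Rm *\<^sub>v pack c) $ i = (beta j \<cdot>\<^sub>v pack c) $ i"
        using arg_cong[OF c(2)[unfolded shiftm_mult_vec[OF Rm_carrier pack_carrier]], of "\<lambda>v. v $ i"] i 
        by (simp add: pack_def Rm_def)
    qed (simp add: pack_def Rm_def)
    then have "eigenvalue Rm (beta j)" unfolding eigenvalue_def eigenvector_def using c(1)
      by (intro exI[of _ "pack c"]) (simp add: Rm_def)
    \<comment> \<open>The forms must be evaluated on eigenvectors of the transpose, which shares its
      characteristic polynomial with \<open>R\<close>.\<close>
    then have "eigenvalue (transpose_mat Rm) (beta j)"
      using eigenvalue_root_char_poly[OF Rm_carrier] eigenvalue_root_char_poly[of "transpose_mat Rm" n]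
        char_poly_transpose_mat[OF Rm_carrier] by simp
    then obtain x where x: "x \<in> carrier_vec n" "x \<noteq> 0\<^sub>v n" "transpose_mat Rm *\<^sub>v x = beta j \<cdot>\<^sub>v x"
      unfolding eigenvalue_def eigenvector_def by (auto simp: Rm_def)
    obtain v where xv: "x = pack v" using pack_surj x by blast
    have "pack (S v) = pack (\<lambda>k. beta j * v k)"
      using x(3) unfolding xv RmT_mult S_def[symmetric] by (auto simp: pack_def)
    then have v: "\<And>k. k \<in> {1..n} \<Longrightarrow> S v k = beta j * v k" unfolding pack_eq by blast
    have "\<exists>k\<in>{1..n}. v k \<noteq> 0" using x(2) unfolding xv pack_zero[symmetric] pack_eq by blast
    from pos[OF this] have "sesq n P v v \<noteq> 0 \<or> sesq n Q v v \<noteq> 0" by (auto simp: sesq_linear)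
    then have "beta j * cnj (beta j) = 1 \<or> alpha * (beta j * cnj (beta j)) = 1"
      using sesq_eigenvector[of 1 n P S v "beta j", OF PS v] sesq_eigenvector[of alpha n Q S v "beta j", OF QS v] by auto
    then have "(cmod (beta j))\<^sup>2 = 1 \<or> alpha * (cmod (beta j))\<^sup>2 = 1"
      unfolding complex_norm_square[symmetric] by (metis of_real_1 of_real_eq_iff of_real_mult)
    then show ?thesis by (auto simp: power2_eq_1_iff) (smt (verit) norm_ge_zero)
  qed
  define I where "I = {j\<in>{1..n}. alpha * (cmod (beta j))\<^sup>2 = 1}"
  have I: "finite I" "I \<subseteq> {1..n}" by (auto simp: I_def)
  have nI: "cmod (beta j) = 1" if "j \<in> {1..n} - I" for j using ev[of j] that by (auto simp: I_def)
  have "(\<Prod>j\<in>{1..n}. (cmod (beta j))\<^sup>2) = (\<Prod>j\<in>I. (cmod (beta j))\<^sup>2) * (\<Prod>j\<in>{1..n} - I. (cmod (beta j))\<^sup>2)"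
    using I by (simp add: prod.subset_diff mult.commute)
  also have "\<dots> = (\<Prod>j\<in>I. 1 / alpha) * (\<Prod>j\<in>{1..n} - I. 1)"
    using nI alpha_pos by (intro arg_cong2[where f = "(*)"] prod.cong) (simp_all add: I_def field_simps del: Diff_iff)
  \<comment> \<open>So \<open>alpha ^ card I = alpha\<close>. Distinct exponents give distinct
    powers of a positive number other than 1, hence \<open>I\<close> is a singleton.\<close>
  finally have "alpha * (1 / alpha) ^ card I = 1" using beta_norm_prod by simp
  then have "alpha = alpha ^ card I" using alpha_pos by (simp add: field_simps)
  then have "card I = 1"
    using alpha_pos alpha_ne1 by (metis power_inject_exp' power_one_right)
  then obtain i0 where i0: "I = {i0}" by (meson card_1_singletonE)
  have "complex_of_real alpha * beta i0 * cnj (beta i0) = of_real (alpha * (cmod (beta i0))\<^sup>2)"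
    by (simp add: mult.assoc complex_norm_square[symmetric])
  also have "alpha * (cmod (beta i0))\<^sup>2 = 1" using i0 unfolding I_def by blast
  finally have "complex_of_real alpha * beta i0 * cnj (beta i0) = 1" by simp
  then show "\<exists>i0\<in>{1..n}. complex_of_real alpha * beta i0 * cnj (beta i0) = 1 \<and>
        (\<forall>i\<in>{1..n}. i \<noteq> i0 \<longrightarrow> cmod (beta i) = 1)"
    using i0 I nI by (intro bexI[of _ i0]) auto
qed

end

section \<open>Averages over finite subgroups of the torus\<close>

text \<open>Tychonoff. Points are functions on all of \<open>nat\<close>, so closed bounded sets are
  of no help, and compact sets are produced as products.\<close>

lemma compact_product_UNIV:
  fixes C :: "'a \<Rightarrow> 'b::topological_space set"
  assumes "\<And>k. compact (C k)"
  shows "compact {p. \<forall>k. p k \<in> C k}"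
proof -
  have "compactin (product_topology (\<lambda>_. euclidean) UNIV) (PiE UNIV C)"
    unfolding compactin_PiE using assms by auto
  moreover have "PiE UNIV C = {p. \<forall>k. p k \<in> C k}" by (auto simp: PiE_iff)
  ultimately show ?thesis by (simp add: euclidean_product_topology)
qed

lemma vector_derivative_norm_bound:
  fixes f :: "real \<Rightarrow> 'a::real_normed_vector"
  assumes "\<And>x. x \<in> {l..u} \<Longrightarrow> (f has_vector_derivative f' x) (at x)"
    and "\<And>x. x \<in> {l..u} \<Longrightarrow> norm (f' x) \<le> B" and "x \<in> {l..u}" "y \<in> {l..u}"
  shows "norm (f x - f y) \<le> B * \<bar>x - y\<bar>"
proof -
  have "norm (f x - f y) \<le> B * norm (x - y)"
  proof (rule differentiable_bound[of "{l..u}" f "\<lambda>x h. h *\<^sub>R f' x"])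
    fix z assume z: "z \<in> {l..u}"
    show "(f has_derivative (\<lambda>h. h *\<^sub>R f' z)) (at z within {l..u})"
      using assms(1)[OF z] unfolding has_vector_derivative_def by (rule has_derivative_at_withinI)
    show "onorm (\<lambda>h. h *\<^sub>R f' z) \<le> B"
      by (rule onorm_le) (use assms(2)[OF z] in \<open>simp add: mult.commute[of B] mult_left_mono\<close>)
  qed (use assms in auto)
  then show ?thesis by simp
qed

text \<open>\<open>rpd\<close> differentiates at parameter 0 only; with this lemma the derivatives
  at the points of a line become the derivative of one curve.\<close>

lemma has_vector_derivative_shift_0:
  assumes "((\<lambda>z. f (x + z)) has_vector_derivative D) (at 0)"
  shows "(f has_vector_derivative D) (at x)"
proof -
  have "((\<lambda>z. z - x) has_vector_derivative 1) (at x)" by (auto intro!: derivative_eq_intros)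
  moreover have "((\<lambda>z. f (x + z)) has_vector_derivative D) (at (x - x))" using assms by simp
  ultimately have "((\<lambda>z. f (x + z)) \<circ> (\<lambda>z. z - x) has_vector_derivative (1 *\<^sub>R D)) (at x)"
    by (rule vector_diff_chain_at)
  then show ?thesis by (simp add: o_def)
qed

section \<open>Translations along the torus and partial derivatives\<close>

definition tr :: "(nat \<Rightarrow> complex) \<Rightarrow> real \<Rightarrow> (nat \<Rightarrow> complex) \<Rightarrow> nat \<Rightarrow> complex" where
  "tr p r e = (\<lambda>k. p k + of_real r * e k)"

text \<open>Directions tangent to the level sets of Im w, which contain the torus fibres; moving
  along them never leaves the half space.\<close>

definition flat_dir :: "nat \<Rightarrow> (nat \<Rightarrow> complex) \<Rightarrow> bool" where
  "flat_dir n e \<longleftrightarrow> Im (e 0) = 0 \<and> (\<forall>k>n. e k = 0)"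

lemma tr_0 [simp]: "tr p 0 e = p" by (simp add: tr_def)
lemma tr_tr: "tr (tr p r e) s e = tr p (r + s) e" by (auto simp: tr_def algebra_simps)
lemma tr_commute: "tr (tr p r e) s e' = tr (tr p s e') r e" by (auto simp: tr_def algebra_simps)
lemma tr_in_X: "p \<in> EP_X n \<Longrightarrow> flat_dir n e \<Longrightarrow> tr p r e \<in> EP_X n"
  by (auto simp: EP_X_def tr_def flat_dir_def)

lemma continuous_on_tr: "continuous_on S (\<lambda>(r, p). tr p r e)"
  unfolding tr_def split_def
  by (intro continuous_intros continuous_on_coordinatewise_then_product
      continuous_on_product_then_coordinatewise)

text \<open>The translated point may leave K, so uniform continuity is applied to the function of
  (r, p) on the compact set [-1, 1] x K instead of to \<open>f\<close> on K.\<close>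

lemma uniform_small_tr:
  fixes f :: "(nat \<Rightarrow> complex) \<Rightarrow> complex"
  assumes f: "continuous_on (EP_X n) f" and K: "compact K" "K \<subseteq> EP_X n" and e: "flat_dir n e" and "\<epsilon> > 0"
  shows "\<exists>\<delta>>0. \<forall>p\<in>K. \<forall>r. \<bar>r\<bar> < \<delta> \<longrightarrow> norm (f (tr p r e) - f p) < \<epsilon>"
proof -
  let ?g = "\<lambda>(r, p). f (tr p r e)"
  have "continuous_on ({-1..1} \<times> K) ?g"
    unfolding split_def
    by (rule continuous_on_compose2[OF f continuous_on_tr[unfolded split_def]]) (use K e tr_in_X in auto)
  moreover have "compact ({-1..1::real} \<times> K)" using K by (intro compact_Times) auto
  ultimately have "uniformly_continuous_on ({-1..1} \<times> K) ?g" by (rule compact_uniformly_continuous)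
  then obtain \<delta> where \<delta>: "\<delta> > 0" "\<And>x x'. x \<in> {-1..1} \<times> K \<Longrightarrow> x' \<in> {-1..1} \<times> K \<Longrightarrow> dist x' x < \<delta> \<Longrightarrow> dist (?g x') (?g x) < \<epsilon>"
    using \<open>\<epsilon> > 0\<close> unfolding uniformly_continuous_on_def by meson
  show ?thesis
  proof (intro exI[of _ "min \<delta> 1"] conjI ballI allI impI)
    fix p r assume "p \<in> K" "\<bar>r\<bar> < min \<delta> 1"
    then show "norm (f (tr p r e) - f p) < \<epsilon>"
      using \<delta>(2)[of "(0, p)" "(r, p)"] by (simp add: dist_prod_def dist_norm abs_less_iff)
  qed (use \<delta> in auto)
qed

text \<open>Functions are controlled on \<open>EP_X\<close> only; openness along coordinate lines
  makes their values there determine the derivatives.\<close>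

lemma eventually_update_in_X:
  assumes p: "p \<in> EP_X n" and l: "l \<le> n"
  shows "\<forall>\<^sub>F t in nhds (0::real). p(l := p l + of_real t * e) \<in> EP_X n"
proof -
  have "((\<lambda>t::real. Im (p 0 + of_real t * e)) \<longlongrightarrow> Im (p 0 + of_real 0 * e)) (nhds 0)"
    by (intro tendsto_intros filterlim_ident)
  then have "\<forall>\<^sub>F t in nhds (0::real). Im (p 0 + of_real t * e) > 0"
    using p by (intro order_tendstoD(1)) (auto simp: EP_X_def)
  then show ?thesis by eventually_elim (use p l in \<open>auto simp: EP_X_def\<close>)
qed

lemma ipd_append: "ipd (ds @ ds') f = ipd ds (ipd ds' f)"
  by (induction ds) auto

lemma smooth_on_continuous: "smooth_on n X f \<Longrightarrow> continuous_on X f"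
  unfolding smooth_on_def by (drule spec[of _ "[]"]) simp

lemma smooth_on_rpd:
  assumes f: "smooth_on n X f" and l: "l \<le> n" "e \<in> {1, \<i>}"
  shows "smooth_on n X (rpd f l e)"
  unfolding smooth_on_def
proof (intro allI impI)
  fix ds assume ds: "\<forall>(l, e)\<in>set ds. l \<le> n \<and> e \<in> {1, \<i>}"
  have eq: "ipd ds (rpd f l e) = ipd (ds @ [(l, e)]) f" by (simp add: ipd_append)
  have "\<forall>(l, e)\<in>set (ds @ [(l, e)]). l \<le> n \<and> e \<in> {1, \<i>}" using ds l by auto
  then show "continuous_on X (ipd ds (rpd f l e)) \<and> (\<forall>p\<in>X. \<forall>la\<le>n. \<forall>ea\<in>{1, \<i>}.
     (\<lambda>t::real. ipd ds (rpd f l e) (p(la := p la + of_real t * ea))) differentiable (at 0))"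
    unfolding eq by (rule mp[OF spec[OF f[unfolded smooth_on_def], of "ds @ [(l, e)]"]])
qed

lemma smooth_on_rpd_deriv:
  assumes "smooth_on n X f" "l \<le> n" "e \<in> {1, \<i>}" "p \<in> X"
  shows "((\<lambda>t. f (p(l := p l + of_real t * e))) has_vector_derivative rpd f l e p) (at 0)"
proof -
  have "(\<lambda>t::real. f (p(l := p l + of_real t * e))) differentiable (at 0)"
    using assms(1)[unfolded smooth_on_def, THEN spec[of _ "[]"]] assms(2-) by auto
  then show ?thesis unfolding rpd_def by (simp add: vector_derivative_works)
qed

text \<open>The inner derivatives stay in coordinate m and the outer ones in coordinate l, so no
  symmetry of mixed second derivatives is invoked.\<close>

lemma dz_dzb_expand:
  assumes f: "smooth_on n X f" and m: "m \<le> n" and l: "l \<le> n" and p: "p \<in> X"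
  shows "dz (dzb f m) l p = (rpd (rpd f m 1) l 1 p + \<i> * rpd (rpd f m \<i>) l 1 p
     - \<i> * rpd (rpd f m 1) l \<i> p + rpd (rpd f m \<i>) l \<i> p) / 4"
proof -
  have r: "rpd (dzb f m) l e p = (rpd (rpd f m 1) l e p + \<i> * rpd (rpd f m \<i>) l e p) / 2" if e: "e \<in> {1, \<i>}" for e
  proof -
    have D: "((\<lambda>t. rpd f m e' (p(l := p l + of_real t * e))) has_vector_derivative rpd (rpd f m e') l e p) (at 0)"
      if "e' \<in> {1, \<i>}" for e'
      by (rule smooth_on_rpd_deriv[OF smooth_on_rpd[OF f m that] l e p])
    have "((\<lambda>t. (rpd f m 1 (p(l := p l + of_real t * e)) + \<i> * rpd f m \<i> (p(l := p l + of_real t * e))) / 2)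
      has_vector_derivative (rpd (rpd f m 1) l e p + \<i> * rpd (rpd f m \<i>) l e p) / 2) (at 0)"
      by (intro has_vector_derivative_divide has_vector_derivative_add has_vector_derivative_mult_right D) auto
    then show ?thesis unfolding dzb_def rpd_def[of "\<lambda>p. (_ p + _ p) / 2"] by (rule vector_derivative_at)
  qed
  have "((a + \<i> * b) / 2 - \<i> * ((c + \<i> * d) / 2)) / 2 = (a + \<i> * b - \<i> * c + d) / 4" for a b c d
    by (simp add: complex_eq_iff field_simps)
  then show ?thesis unfolding dz_def r[OF insertI1] r[OF insertI2[OF singletonI]] by blast
qed

section \<open>Periodic functions and their averages over grids\<close>

locale torus_lattice =
  fixes n d :: nat and U :: "nat \<Rightarrow> nat \<Rightarrow> complex"
  assumes U_flat: "\<And>i. i < d \<Longrightarrow> flat_dir n (U i)"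
begin

abbreviation X :: "(nat \<Rightarrow> complex) set" where "X \<equiv> EP_X n"

definition periodic :: "((nat \<Rightarrow> complex) \<Rightarrow> complex) \<Rightarrow> bool" where
  "periodic f \<longleftrightarrow> (\<forall>p\<in>X. \<forall>i<d. f (tr p 1 (U i)) = f p)"

lemma periodic_int:
  assumes f: "periodic f" and i: "i < d" and "p \<in> X"
  shows "f (tr p (of_int m) (U i)) = f p"
  using \<open>p \<in> X\<close>
proof (induction m arbitrary: p rule: int_induct[where k = 0])
  case (step1 m)
  have "f (tr p (of_int (m + 1)) (U i)) = f (tr (tr p 1 (U i)) (of_int m) (U i))"
    by (simp add: tr_tr add.commute)
  also have "\<dots> = f p" using step1 f i tr_in_X[OF step1.prems U_flat[OF i]] by (simp add: periodic_def)
  finally show ?case .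
next
  case (step2 m)
  let ?q = "tr p (- 1) (U i)"
  have q: "?q \<in> X" using tr_in_X[OF step2.prems U_flat[OF i]] .
  have "f (tr p (of_int (m - 1)) (U i)) = f (tr ?q (of_int m) (U i))"
    by (simp add: tr_tr add.commute)
  also have "\<dots> = f ?q" using step2 q by simp
  also have "\<dots> = f (tr ?q 1 (U i))" using f i q by (simp add: periodic_def)
  finally show ?case by (simp add: tr_tr)
qed simp

lemma flat_sum: "j \<le> d \<Longrightarrow> flat_dir n (\<lambda>k. \<Sum>i<j. of_real (s i) * U i k)"
  using U_flat unfolding flat_dir_def by (auto intro!: sum.neutral)

lemma periodic_lattice:
  assumes f: "periodic f" and p: "p \<in> X"
  shows "f (tr p 1 (\<lambda>k. \<Sum>i<d. of_int (m i) * U i k)) = f p"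
proof -
  have "f (tr p 1 (\<lambda>k. \<Sum>i<j. of_real (of_int (m i)) * U i k)) = f p" if "j \<le> d" for j
    using that
  proof (induction j)
    case (Suc j)
    let ?q = "tr p 1 (\<lambda>k. \<Sum>i<j. of_real (of_int (m i)) * U i k)"
    have q: "?q \<in> X" using Suc by (intro tr_in_X[OF p] flat_sum) auto
    have "tr p 1 (\<lambda>k. \<Sum>i<Suc j. of_real (of_int (m i)) * U i k) = tr ?q (of_int (m j)) (U j)"
      by (auto simp: tr_def algebra_simps)
    then show ?case using periodic_int[OF f _ q, of j] Suc by simp
  qed (simp add: tr_def)
  from this[of d] show ?thesis by simp
qed

text \<open>Coordinates adapted to the fibration: y is the height and t the coordinates relative to
  the periods, so integral changes of t are lattice translations.\<close>

definition pt :: "real \<Rightarrow> (nat \<Rightarrow> real) \<Rightarrow> nat \<Rightarrow> complex" where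
  "pt y t = (\<lambda>k. (if k = 0 then \<i> * of_real y else 0) + (\<Sum>i<d. of_real (t i) * U i k))"

lemma pt_in_X: "y > 0 \<Longrightarrow> pt y t \<in> X"
  using U_flat unfolding EP_X_def pt_def flat_dir_def by (auto intro!: sum.neutral)

lemma tr_pt: "tr (pt y t) r (\<lambda>k. \<Sum>i<d. of_real (s i) * U i k) = pt y (\<lambda>i. t i + r * s i)"
  by (auto simp: tr_def pt_def algebra_simps sum.distrib sum_distrib_left)

lemma pt_cong: "(\<And>i. i < d \<Longrightarrow> t i = t' i) \<Longrightarrow> pt y t = pt y t'"
  by (simp add: pt_def)

text \<open>Representatives of (Z/N)^d; extensionality makes the set finite.\<close>

definition box :: "nat \<Rightarrow> (nat \<Rightarrow> int) set" where
  "box N = {..<d} \<rightarrow>\<^sub>E {0..<int N}"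

lemma finite_box [simp]: "finite (box N)" by (simp add: box_def finite_PiE)
lemma card_box: "card (box N) = N ^ d" by (simp add: box_def card_PiE)

text \<open>Averaging over a finite subgroup of the torus instead of integrating: the automorphism
  induced by the integer matrix permutes the subgroup, so its invariance needs no measure theory.\<close>
definition avg :: "nat \<Rightarrow> ((nat \<Rightarrow> complex) \<Rightarrow> complex) \<Rightarrow> real \<Rightarrow> complex" where
  "avg N f y = (\<Sum>\<kappa>\<in>box N. f (pt y (\<lambda>i. of_int (\<kappa> i) / N))) / of_nat (N ^ d)"

text \<open>Injectivity of the substitution modulo N is enough: it induces an injective, hence
  bijective, self-map of the finite group, and periodicity makes the values depend on residues
  only.\<close>

lemma avg_reindex:
  assumes f: "periodic f" and y: "y > 0" and N: "N > 0"
    and inj: "\<And>\<kappa> \<kappa>'. (\<And>i. i < d \<Longrightarrow> \<phi> \<kappa> i mod int N = \<phi> \<kappa>' i mod int N) \<Longrightarrow>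
        (\<And>i. i < d \<Longrightarrow> \<kappa> i mod int N = \<kappa>' i mod int N)"
  shows "(\<Sum>\<kappa>\<in>box N. f (pt y (\<lambda>i. of_int (\<phi> \<kappa> i) / N))) / of_nat (N ^ d) = avg N f y"
proof -
  define \<rho> where "\<rho> \<kappa> = (\<lambda>i\<in>{..<d}. \<phi> \<kappa> i mod int N)" for \<kappa>
  have \<rho>: "\<rho> ` box N \<subseteq> box N"
  proof (rule image_subsetI)
    fix \<kappa>
    have "\<phi> \<kappa> i mod int N \<in> {0..<int N}" for i using N by simp
    then show "\<rho> \<kappa> \<in> box N" unfolding box_def \<rho>_def by (simp add: PiE_iff)
  qed
  have "inj_on \<rho> (box N)"
  proof (rule inj_onI)
    fix \<kappa> \<kappa>' assume k: "\<kappa> \<in> box N" "\<kappa>' \<in> box N" and e: "\<rho> \<kappa> = \<rho> \<kappa>'"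
    have "\<phi> \<kappa> i mod int N = \<phi> \<kappa>' i mod int N" if "i < d" for i
      using fun_cong[OF e, of i] that by (simp add: \<rho>_def)
    then have "\<kappa> i mod int N = \<kappa>' i mod int N" if "i < d" for i using inj that by blast
    moreover have "\<kappa> i mod int N = \<kappa> i" "\<kappa>' i mod int N = \<kappa>' i" if "i < d" for i
      using k that by (auto simp: box_def PiE_iff)
    ultimately show "\<kappa> = \<kappa>'" using k unfolding box_def by (intro PiE_ext[of \<kappa> "{..<d}" _ \<kappa>']) auto
  qed
  then have bij: "bij_betw \<rho> (box N) (box N)"
    using endo_inj_surj[OF finite_box \<rho>] by (simp add: bij_betw_def)
  have "f (pt y (\<lambda>i. of_int (\<phi> \<kappa> i) / N)) = f (pt y (\<lambda>i. of_int (\<rho> \<kappa> i) / N))" for \<kappa>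
  proof -
    \<comment> \<open>Reducing a grid coordinate modulo N changes the point by an integral
      combination of periods.\<close>
    have dec: "real_of_int z / N = of_int (z mod int N) / N + of_int (z div int N)" for z
    proof -
      have "real_of_int (z mod int N + z div int N * int N) = z" unfolding mod_div_mult_eq ..
      then have "of_int (z mod int N) + of_int (z div int N) * real N = z"
        unfolding of_int_add of_int_mult of_int_of_nat_eq .
      then have "real_of_int z / N = (of_int (z mod int N) + of_int (z div int N) * real N) / N" by simp
      then show ?thesis using N by (simp add: add_divide_distrib)
    qed
    have "pt y (\<lambda>i. of_int (\<phi> \<kappa> i) / N) = pt y (\<lambda>i. of_int (\<rho> \<kappa> i) / N + 1 * of_int (\<phi> \<kappa> i div int N))"
      by (rule pt_cong) (subst dec, simp add: \<rho>_def)
    also have "\<dots> = tr (pt y (\<lambda>i. of_int (\<rho> \<kappa> i) / N)) 1 (\<lambda>k. \<Sum>i<d. of_int (\<phi> \<kappa> i div int N) * U i k)"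
      by (subst tr_pt[symmetric]) simp
    finally show ?thesis using periodic_lattice[OF f pt_in_X[OF y]] by simp
  qed
  then show ?thesis unfolding avg_def using sum.reindex_bij_betw[OF bij, of "\<lambda>\<kappa>. f (pt y (\<lambda>i. of_int (\<kappa> i) / N))"] by simp
qed

lemma avg_linear: "avg N (\<lambda>p. c * f p + g p) y = c * avg N f y + avg N g y"
  by (simp add: avg_def sum.distrib sum_distrib_left add_divide_distrib)

lemma avg_cong: "(\<And>p. p \<in> X \<Longrightarrow> f p = g p) \<Longrightarrow> y > 0 \<Longrightarrow> avg N f y = avg N g y"
  unfolding avg_def using pt_in_X by simp

lemma box_point:
  assumes N: "N > 0" and k: "\<kappa> \<in> box N" and "\<And>t. (\<And>i. 0 \<le> t i \<and> t i \<le> 1) \<Longrightarrow> P (pt y t)"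
  shows "P (pt y (\<lambda>i. of_int (\<kappa> i) / N))"
proof -
  \<comment> \<open>Members of \<open>box N\<close> are \<open>undefined\<close> beyond d; there the
    coordinate is replaced by 0 so that all coordinates lie in [0, 1].\<close>
  have "pt y (\<lambda>i. of_int (\<kappa> i) / N) = pt y (\<lambda>i. if i < d then of_int (\<kappa> i) / N else 0)"
    by (rule pt_cong) simp
  moreover have "0 \<le> (if i < d then real_of_int (\<kappa> i) / N else 0) \<and> (if i < d then real_of_int (\<kappa> i) / N else 0) \<le> 1" for i
  proof (cases "i < d")
    case True
    then have "0 \<le> \<kappa> i" "\<kappa> i < int N" using k by (auto simp: box_def PiE_iff)
    then have "0 \<le> real_of_int (\<kappa> i)" "real_of_int (\<kappa> i) \<le> N" by linarith+
    then show ?thesis using True N by simp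
  qed simp
  ultimately show ?thesis using assms(3) by simp
qed

lemma avg_norm_le:
  assumes N: "N > 0" and "\<And>t. (\<And>i. 0 \<le> t i \<and> t i \<le> 1) \<Longrightarrow> norm (f (pt y t)) \<le> B"
  shows "norm (avg N f y) \<le> B"
proof -
  have "norm (\<Sum>\<kappa>\<in>box N. f (pt y (\<lambda>i. of_int (\<kappa> i) / N))) \<le> of_nat (card (box N)) * B"
    by (intro sum_norm_bound box_point[OF N, where P = "\<lambda>p. norm (f p) \<le> B"]) (use assms(2) in auto)
  then show ?thesis using N by (simp add: avg_def norm_divide norm_power card_box divide_le_eq mult.commute)
qed

lemma avg_Re_ge:
  assumes N: "N > 0" and "\<And>t. (\<And>i. 0 \<le> t i \<and> t i \<le> 1) \<Longrightarrow> B \<le> Re (f (pt y t))"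
  shows "B \<le> Re (avg N f y)"
proof -
  have "of_nat (card (box N)) * B \<le> (\<Sum>\<kappa>\<in>box N. Re (f (pt y (\<lambda>i. of_int (\<kappa> i) / N))))"
    by (intro sum_bounded_below box_point[OF N, where P = "\<lambda>p. B \<le> Re (f p)"]) (use assms(2) in auto)
  moreover have "Re (avg N f y) = (\<Sum>\<kappa>\<in>box N. Re (f (pt y (\<lambda>i. of_int (\<kappa> i) / N)))) / of_nat (N ^ d)"
    unfolding avg_def by (metis Re_divide_of_nat Re_sum)
  ultimately show ?thesis using N by (simp add: card_box le_divide_eq mult.commute)
qed

text \<open>One compact set serves a whole interval of heights: a closed disc cut by a strip in
  coordinate 0, closed discs up to n, and {0} beyond. The bound \<open>0 < y1\<close> keeps it
  inside the half space.\<close>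

lemma torus_compact:
  assumes "0 < y1"
  shows "\<exists>K. compact K \<and> K \<subseteq> X \<and> (\<forall>y\<in>{y1..y2}. \<forall>t. (\<forall>i. 0 \<le> t i \<and> t i \<le> 1) \<longrightarrow> pt y t \<in> K)"
proof -
  define B where "B k = \<bar>y2\<bar> + (\<Sum>i<d. norm (U i k))" for k
  define C where "C k = (if k = 0 then cball 0 (B 0) \<inter> {z. Im z \<in> {y1..y2}} else if k \<le> n then cball 0 (B k) else {0::complex})" for k
  have "closed {z. Im z \<in> {y1..y2}}"
  proof -
    have "{z. Im z \<in> {y1..y2}} = {z. y1 \<le> Im z} \<inter> {z. Im z \<le> y2}" by auto
    then show ?thesis by (simp add: closed_halfspace_Im_ge closed_halfspace_Im_le closed_Int)
  qed
  then have "compact (C k)" for k by (auto simp: C_def compact_Int_closed)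
  then have c: "compact {p. \<forall>k. p k \<in> C k}" by (rule compact_product_UNIV)
  have X: "{p. \<forall>k. p k \<in> C k} \<subseteq> X"
  proof
    fix p assume "p \<in> {p. \<forall>k. p k \<in> C k}"
    then have p: "p k \<in> C k" for k by blast
    show "p \<in> X" using p[of 0] assms p by (auto simp: EP_X_def C_def split: if_splits) (metis less_nat_zero_code not_le singletonD)
  qed
  have "pt y t k \<in> C k" if y: "y \<in> {y1..y2}" and t: "\<forall>i. 0 \<le> t i \<and> t i \<le> 1" for y t k
  proof -
    have "norm (\<Sum>i<d. of_real (t i) * U i k) \<le> (\<Sum>i<d. norm (U i k))"
      using t by (intro sum_norm_le) (simp add: norm_mult mult_left_le_one_le)
    moreover have "norm (if k = 0 then \<i> * complex_of_real y else 0) \<le> \<bar>y2\<bar>"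
      using y assms by (simp add: norm_mult)
    ultimately have b: "norm (pt y t k) \<le> B k" unfolding pt_def B_def by (intro order_trans[OF norm_triangle_ineq]) simp
    have "Im (pt y t 0) = y" using U_flat by (simp add: pt_def flat_dir_def)
    moreover have "k > n \<Longrightarrow> pt y t k = 0" using pt_in_X[of y t] y assms by (simp add: EP_X_def)
    ultimately show ?thesis using b y by (auto simp: C_def)
  qed
  then show ?thesis using c X by (intro exI[of _ "{p. \<forall>k. p k \<in> C k}"]) auto
qed

lemma avg_bounded:
  assumes f: "continuous_on X f" and y: "y > 0"
  shows "bounded (range (\<lambda>N. avg (Suc N) f y))"
proof -
  obtain K where K: "compact K" "K \<subseteq> X" and Kp: "\<And>t. (\<And>i. 0 \<le> t i \<and> t i \<le> 1) \<Longrightarrow> pt y t \<in> K"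
    using torus_compact[OF y, of y] by auto
  have "bounded (f ` K)" by (intro compact_imp_bounded compact_continuous_image continuous_on_subset[OF f] K)
  then obtain B where B: "\<And>p. p \<in> K \<Longrightarrow> norm (f p) \<le> B" unfolding bounded_iff by auto
  have "norm (avg (Suc N) f y) \<le> B" for N by (rule avg_norm_le) (use B Kp in auto)
  then show ?thesis unfolding bounded_iff by blast
qed

text \<open>The minimum over a compact set gives a lower bound independent of N, so positivity
  survives the limit of the averages.\<close>

lemma avg_Re_positive:
  assumes f: "continuous_on X f" and y: "y > 0" and pos: "\<And>p. p \<in> X \<Longrightarrow> Re (f p) > 0"
  shows "\<exists>c>0. \<forall>N. c \<le> Re (avg (Suc N) f y)"
proof -
  obtain K where K: "compact K" "K \<subseteq> X" and Kp: "\<And>t. (\<And>i. 0 \<le> t i \<and> t i \<le> 1) \<Longrightarrow> pt y t \<in> K"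
    using torus_compact[OF y, of y] by auto
  have "K \<noteq> {}" using Kp[of "\<lambda>_. 0"] by auto
  moreover have "continuous_on K (\<lambda>p. Re (f p))" by (intro continuous_intros continuous_on_subset[OF f] K)
  ultimately obtain q where q: "q \<in> K" "\<And>p. p \<in> K \<Longrightarrow> Re (f q) \<le> Re (f p)"
    using continuous_attains_inf[OF K(1)] by blast
  have "Re (f q) \<le> Re (avg (Suc N) f y)" for N by (rule avg_Re_ge) (use q Kp in auto)
  then show ?thesis using pos q K by blast
qed

text \<open>The stand-in for having mean zero on every fibre. Uniformity on bounded intervals of
  heights away from 0 is what allows the averages to be integrated in y.\<close>

definition null :: "((nat \<Rightarrow> complex) \<Rightarrow> complex) \<Rightarrow> bool" where
  "null f \<longleftrightarrow> (\<forall>y1 y2. 0 < y1 \<longrightarrow> uniform_limit {y1..y2} (\<lambda>N y. avg N f y) (\<lambda>_. 0) sequentially)"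

lemma nullI:
  assumes "\<And>y1 y2 \<epsilon>. 0 < y1 \<Longrightarrow> 0 < \<epsilon> \<Longrightarrow> \<forall>\<^sub>F N in sequentially. \<forall>y\<in>{y1..y2}. norm (avg N f y) \<le> \<epsilon>"
  shows "null f"
  unfolding null_def uniform_limit_iff dist_norm
proof (intro allI impI)
  fix y1 y2 \<epsilon> :: real assume "0 < y1" "0 < \<epsilon>"
  from assms[OF this(1), of "\<epsilon> / 2" y2] this(2)
  have "\<forall>\<^sub>F N in sequentially. \<forall>y\<in>{y1..y2}. norm (avg N f y) \<le> \<epsilon> / 2" by simp
  then show "\<forall>\<^sub>F N in sequentially. \<forall>y\<in>{y1..y2}. norm (avg N f y - 0) < \<epsilon>"
    by eventually_elim (use \<open>0 < \<epsilon>\<close> in force)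
qed

lemma nullD:
  assumes "null f" "0 < y1" "0 < \<epsilon>"
  shows "\<forall>\<^sub>F N in sequentially. \<forall>y\<in>{y1..y2}. norm (avg N f y) \<le> \<epsilon>"
proof -
  have "\<forall>\<^sub>F N in sequentially. \<forall>y\<in>{y1..y2}. norm (avg N f y - 0) < \<epsilon>"
    using assms unfolding null_def uniform_limit_iff dist_norm by blast
  then show ?thesis by eventually_elim force
qed

lemma null_linear:
  assumes "null f" "null g"
  shows "null (\<lambda>p. c * f p + g p)"
proof (rule nullI)
  fix y1 y2 \<epsilon> :: real assume y1: "0 < y1" and \<epsilon>: "0 < \<epsilon>"
  let ?e = "\<epsilon> / (norm c + 1)"
  have e: "?e > 0" using \<epsilon> by (simp add: add_nonneg_pos)
  show "\<forall>\<^sub>F N in sequentially. \<forall>y\<in>{y1..y2}. norm (avg N (\<lambda>p. c * f p + g p) y) \<le> \<epsilon>"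
    using nullD[OF assms(1) y1 e, of y2] nullD[OF assms(2) y1 e, of y2]
  proof eventually_elim
    case (elim N)
    show ?case
    proof
      fix y assume y: "y \<in> {y1..y2}"
      have "norm (avg N (\<lambda>p. c * f p + g p) y) \<le> norm c * norm (avg N f y) + norm (avg N g y)"
        unfolding avg_linear by (rule order_trans[OF norm_triangle_ineq]) (simp add: norm_mult)
      also have "\<dots> \<le> norm c * ?e + ?e" using elim y by (intro add_mono mult_left_mono) auto
      also have "\<dots> = \<epsilon>" by (simp add: field_simps add_nonneg_eq_0_iff)
      finally show "norm (avg N (\<lambda>p. c * f p + g p) y) \<le> \<epsilon>" .
    qed
  qed
qed

lemma null_cong:
  assumes "\<And>p. p \<in> X \<Longrightarrow> f p = g p" "null f"
  shows "null g"
proof (rule nullI)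
  fix y1 y2 \<epsilon> :: real assume y1: "0 < y1" and \<epsilon>: "0 < \<epsilon>"
  have "avg N f y = avg N g y" if "y \<in> {y1..y2}" for N y
    by (rule avg_cong[OF assms(1)]) (use that y1 in auto)
  then show "\<forall>\<^sub>F N in sequentially. \<forall>y\<in>{y1..y2}. norm (avg N g y) \<le> \<epsilon>"
    using nullD[OF assms(2) y1 \<epsilon>, of y2] by simp
qed

lemma null_zero: "null (\<lambda>_. 0)" by (rule nullI) (simp add: avg_def)
lemma null_add: "null f \<Longrightarrow> null g \<Longrightarrow> null (\<lambda>p. f p + g p)" using null_linear[of f g 1] by simp
lemma null_scale: "null f \<Longrightarrow> null (\<lambda>p. c * f p)" using null_linear[OF _ null_zero, of f c] by simp

text \<open>Closure under uniform approximation over intervals of heights; it lets difference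
  quotients stand in for a derivative.\<close>

lemma null_uniform:
  assumes "\<And>y1 y2 \<epsilon>. 0 < y1 \<Longrightarrow> 0 < \<epsilon> \<Longrightarrow> \<exists>g. null g \<and>
     (\<forall>y\<in>{y1..y2}. \<forall>t. (\<forall>i. 0 \<le> t i \<and> t i \<le> 1) \<longrightarrow> norm (f (pt y t) - g (pt y t)) \<le> \<epsilon>)"
  shows "null f"
proof (rule nullI)
  fix y1 y2 \<epsilon> :: real assume y1: "0 < y1" and \<epsilon>: "0 < \<epsilon>"
  obtain g where g: "null g" and d: "\<And>y t. y \<in> {y1..y2} \<Longrightarrow> (\<And>i. 0 \<le> t i \<and> t i \<le> 1) \<Longrightarrow> norm (f (pt y t) - g (pt y t)) \<le> \<epsilon> / 2"
    using assms[OF y1, of "\<epsilon> / 2" y2] \<epsilon> by auto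
  have "\<epsilon> / 2 > 0" using \<epsilon> by simp
  show "\<forall>\<^sub>F N in sequentially. \<forall>y\<in>{y1..y2}. norm (avg N f y) \<le> \<epsilon>"
    using nullD[OF g y1 \<open>\<epsilon> / 2 > 0\<close>, of y2] eventually_gt_at_top[of 0]
  proof eventually_elim
    case (elim N)
    show ?case
    proof
      fix y assume y: "y \<in> {y1..y2}"
      have "norm (avg N (\<lambda>p. (-1) * g p + f p) y) \<le> \<epsilon> / 2"
        by (rule avg_norm_le) (use elim d[OF y] in auto)
      then have "norm (avg N f y - avg N g y) \<le> \<epsilon> / 2" unfolding avg_linear by simp
      then show "norm (avg N f y) \<le> \<epsilon>" using elim(1) y norm_triangle_sub[of "avg N f y" "avg N g y"] by fastforce
    qed
  qed
qed

lemma periodic_tr: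
  assumes "periodic f" "flat_dir n e"
  shows "periodic (\<lambda>p. f (tr p s e))"
  using assms tr_in_X unfolding periodic_def by (auto simp: tr_commute[of _ 1 _ s])

lemma continuous_tr:
  assumes "continuous_on X f" "flat_dir n e"
  shows "continuous_on X (\<lambda>p. f (tr p s e))"
proof (rule continuous_on_compose2[OF assms(1)])
  show "continuous_on X (\<lambda>p. tr p s e)" unfolding tr_def
    by (intro continuous_intros continuous_on_coordinatewise_then_product
        continuous_on_subset[OF continuous_on_product_coordinates]) auto
qed (use assms tr_in_X in auto)

text \<open>A shift by a multiple of 1/N along a period permutes the grid, so the equality is
  exact.\<close>

lemma avg_grid_shift:
  assumes f: "periodic f" and y: "y > 0" and N: "N > 0" and i: "i < d"
  shows "avg N (\<lambda>p. f (tr p (of_int m / N) (U i))) y = avg N f y"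
proof -
  let ?\<phi> = "\<lambda>\<kappa> j. \<kappa> j + (if j = i then m else 0)"
  have "tr (pt y t) r (U i) = pt y (\<lambda>j. t j + r * (if j = i then 1 else 0))" for t r
  proof -
    have "(\<lambda>k. \<Sum>j<d. of_real (if j = i then 1 else 0) * U j k) = U i"
      using i by (auto simp: if_distrib[of of_real] if_distrib[of "\<lambda>x. x * _"] cong: if_cong)
    then show ?thesis using tr_pt[of y t r "\<lambda>j. if j = i then 1 else 0"] by simp
  qed
  moreover have "of_int (\<kappa> j) / N + of_int m / N * (if j = i then 1 else 0) = real_of_int (?\<phi> \<kappa> j) / N" for \<kappa> j
    by (simp add: add_divide_distrib)
  ultimately have "avg N (\<lambda>p. f (tr p (of_int m / N) (U i))) y = (\<Sum>\<kappa>\<in>box N. f (pt y (\<lambda>j. of_int (?\<phi> \<kappa> j) / N))) / of_nat (N ^ d)"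
    unfolding avg_def by simp
  also have "\<dots> = avg N f y"
  proof (rule avg_reindex[OF f y N])
    fix \<kappa> \<kappa>' :: "nat \<Rightarrow> int" and j
    assume "\<And>j. j < d \<Longrightarrow> ?\<phi> \<kappa> j mod int N = ?\<phi> \<kappa>' j mod int N" "j < d"
    then have "?\<phi> \<kappa> j mod int N = ?\<phi> \<kappa>' j mod int N" by blast
    then have "(?\<phi> \<kappa> j - (if j = i then m else 0)) mod int N = (?\<phi> \<kappa>' j - (if j = i then m else 0)) mod int N"
      by (rule mod_diff_cong) simp
    then show "\<kappa> j mod int N = \<kappa>' j mod int N" by simp
  qed
  finally show ?thesis .
qed

text \<open>Round the shift to a multiple of 1/N, which the average does not see; the remainder is
  at most 1/N and is absorbed by uniform continuity.\<close>

lemma null_shift_single: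
  assumes fc: "continuous_on X f" and f: "periodic f" and i: "i < d"
  shows "null (\<lambda>p. f (tr p s (U i)) - f p)"
proof (rule nullI)
  fix y1 y2 \<epsilon> :: real assume y1: "0 < y1" and \<epsilon>: "0 < \<epsilon>"
  obtain K where K: "compact K" "K \<subseteq> X" and Kp: "\<And>y t. y \<in> {y1..y2} \<Longrightarrow> (\<And>i. 0 \<le> t i \<and> t i \<le> 1) \<Longrightarrow> pt y t \<in> K"
    using torus_compact[OF y1, of y2] by meson
  obtain \<delta> where \<delta>: "\<delta> > 0" and small: "\<And>p r. p \<in> K \<Longrightarrow> \<bar>r\<bar> < \<delta> \<Longrightarrow> norm (f (tr p r (U i)) - f p) < \<epsilon>"
    using uniform_small_tr[OF fc K U_flat[OF i] \<epsilon>] by blast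
  have "\<forall>\<^sub>F N in sequentially. 1 / real N < \<delta>"
    using order_tendstoD(2)[OF lim_1_over_n \<delta>] by simp
  then show "\<forall>\<^sub>F N in sequentially. \<forall>y\<in>{y1..y2}. norm (avg N (\<lambda>p. f (tr p s (U i)) - f p) y) \<le> \<epsilon>"
    using eventually_gt_at_top[of 0]
  proof eventually_elim
    case (elim N)
    define m where "m = \<lfloor>s * N\<rfloor>"
    define r where "r = s - m / N"
    have "\<bar>r\<bar> \<le> 1 / N"
    proof -
      have "real_of_int m \<le> s * N" "s * N \<le> real_of_int m + 1" unfolding m_def by linarith+
      then have "0 \<le> (s * N - m) / N" "(s * N - m) / N \<le> 1 / N"
        using elim(2) by (simp_all add: divide_le_cancel)
      moreover have "r = (s * N - m) / N" using elim(2) by (simp add: r_def diff_divide_distrib)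
      ultimately show ?thesis by simp
    qed
    then have r: "\<bar>r\<bar> < \<delta>" using elim by linarith
    show ?case
    proof
      fix y assume y: "y \<in> {y1..y2}"
      then have y0: "y > 0" using y1 by simp
      have "avg N (\<lambda>p. f (tr p s (U i))) y = avg N (\<lambda>p. f (tr (tr p (of_int m / N) (U i)) r (U i))) y"
        by (simp add: tr_tr r_def)
      also have "\<dots> = avg N (\<lambda>p. f (tr p r (U i))) y"
        by (rule avg_grid_shift[OF periodic_tr[OF f U_flat[OF i]] y0 elim(2) i])
      finally have "avg N (\<lambda>p. (-1) * f p + f (tr p s (U i))) y = avg N (\<lambda>p. (-1) * f p + f (tr p r (U i))) y"
        unfolding avg_linear by simp
      moreover have "norm (avg N (\<lambda>p. (-1) * f p + f (tr p r (U i))) y) \<le> \<epsilon>"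
        by (rule avg_norm_le[OF elim(2)]) (use small[OF Kp[OF y] r] in \<open>simp add: less_imp_le\<close>)
      ultimately show "norm (avg N (\<lambda>p. f (tr p s (U i)) - f p) y) \<le> \<epsilon>" by simp
    qed
  qed
qed

text \<open>Telescopes over the periods: one multiple of one \<open>U j\<close> is added at a
  time.\<close>

lemma null_shift:
  assumes fc: "continuous_on X f" and f: "periodic f"
    and e: "e = (\<lambda>k. \<Sum>i<d. of_real (s i) * U i k)"
  shows "null (\<lambda>p. f (tr p r e) - f p)"
proof -
  have "null (\<lambda>p. f (tr p r (\<lambda>k. \<Sum>i<j. of_real (s i) * U i k)) - f p)" if "j \<le> d" for j
    using that
  proof (induction j)
    case 0
    then show ?case using null_zero by (simp add: tr_def)
  next
    case (Suc j)
    let ?e = "\<lambda>k. \<Sum>i<j. of_real (s i) * U i k"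
    have j: "j < d" using Suc by simp
    have fl: "flat_dir n ?e" using Suc by (intro flat_sum) auto
    have "null (\<lambda>p. f (tr (tr p (r * s j) (U j)) r ?e) - f (tr p r ?e))"
      by (rule null_shift_single[OF continuous_tr[OF fc fl] periodic_tr[OF f fl] j])
    moreover have "null (\<lambda>p. f (tr p r ?e) - f p)" using Suc by simp
    ultimately have "null (\<lambda>p. (f (tr (tr p (r * s j) (U j)) r ?e) - f (tr p r ?e)) + (f (tr p r ?e) - f p))"
      by (rule null_add)
    moreover have "tr (tr p (r * s j) (U j)) r ?e = tr p r (\<lambda>k. \<Sum>i<Suc j. of_real (s i) * U i k)" for p
      by (auto simp: tr_def algebra_simps)
    ultimately show ?case by simp
  qed
  then show ?thesis unfolding e by simp
qed

text \<open>The derivative of a periodic function has mean zero: its difference quotients are null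
  by \<open>null_shift\<close>, and they approximate the continuous derivative uniformly on compact
  sets.\<close>

lemma null_derivative:
  assumes fc: "continuous_on X f" and f: "periodic f" and gc: "continuous_on X g"
    and e: "e = (\<lambda>k. \<Sum>i<d. of_real (s i) * U i k)"
    and deriv: "\<And>p. p \<in> X \<Longrightarrow> ((\<lambda>r. f (tr p r e)) has_vector_derivative g p) (at 0)"
  shows "null g"
proof (rule null_uniform)
  fix y1 y2 \<epsilon> :: real assume y1: "0 < y1" and \<epsilon>: "0 < \<epsilon>"
  have fl: "flat_dir n e" unfolding e by (rule flat_sum) simp
  obtain K where K: "compact K" "K \<subseteq> X" and Kp: "\<And>y t. y \<in> {y1..y2} \<Longrightarrow> (\<And>i. 0 \<le> t i \<and> t i \<le> 1) \<Longrightarrow> pt y t \<in> K"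
    using torus_compact[OF y1, of y2] by meson
  obtain \<delta> where \<delta>: "\<delta> > 0" and small: "\<And>p r. p \<in> K \<Longrightarrow> \<bar>r\<bar> < \<delta> \<Longrightarrow> norm (g (tr p r e) - g p) < \<epsilon>"
    using uniform_small_tr[OF gc K fl \<epsilon>] by blast
  define r where "r = \<delta> / 2"
  have r: "0 < r" "r < \<delta>" using \<delta> by (auto simp: r_def)
  show "\<exists>h. null h \<and> (\<forall>y\<in>{y1..y2}. \<forall>t. (\<forall>i. 0 \<le> t i \<and> t i \<le> 1) \<longrightarrow> norm (g (pt y t) - h (pt y t)) \<le> \<epsilon>)"
  proof (intro exI conjI ballI allI impI)
    show "null (\<lambda>p. of_real (1 / r) * (f (tr p r e) - f p))"
      by (rule null_scale[OF null_shift[OF fc f e]])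
    fix y :: real and t :: "nat \<Rightarrow> real" assume "y \<in> {y1..y2}" "\<forall>i. 0 \<le> t i \<and> t i \<le> 1"
    then have p: "pt y t \<in> K" using Kp by blast
    let ?p = "pt y t"
    \<comment> \<open>Subtracting the linear part leaves a curve whose derivative is below epsilon
      on [0, r]; the mean value inequality then bounds the error of the difference quotient.\<close>
    let ?F = "\<lambda>x. f (tr ?p x e) - x *\<^sub>R g ?p"
    have F: "(?F has_vector_derivative (g (tr ?p x e) - g ?p)) (at x)" for x
    proof -
      have "((\<lambda>z. f (tr (tr ?p x e) z e)) has_vector_derivative g (tr ?p x e)) (at 0)"
        using p K tr_in_X[OF _ fl] by (intro deriv) auto
      then have "((\<lambda>z. f (tr ?p (x + z) e)) has_vector_derivative g (tr ?p x e)) (at 0)" unfolding tr_tr .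
      then have "((\<lambda>z. f (tr ?p z e)) has_vector_derivative g (tr ?p x e)) (at x)"
        by (rule has_vector_derivative_shift_0)
      then show ?thesis by (auto intro!: derivative_eq_intros)
    qed
    have "norm (?F r - ?F 0) \<le> \<epsilon> * \<bar>r - 0\<bar>"
      by (rule vector_derivative_norm_bound[of 0 r ?F "\<lambda>x. g (tr ?p x e) - g ?p"])
        (use F small[OF p] r in \<open>auto intro: less_imp_le\<close>)
    then have le: "norm (f (tr ?p r e) - f ?p - r *\<^sub>R g ?p) \<le> \<epsilon> * r" using r by (simp add: algebra_simps)
    moreover have "g ?p - of_real (1 / r) * (f (tr ?p r e) - f ?p) = - of_real (1 / r) * (f (tr ?p r e) - f ?p - r *\<^sub>R g ?p)"
      using r by (simp add: algebra_simps scaleR_conv_of_real)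
    ultimately have "norm (g ?p - of_real (1 / r) * (f (tr ?p r e) - f ?p)) = 1 / r * norm (f (tr ?p r e) - f ?p - r *\<^sub>R g ?p)"
      using r by (simp only: norm_mult norm_minus_cancel norm_of_real) simp
    also have "\<dots> \<le> 1 / r * (\<epsilon> * r)" using le r by (intro mult_left_mono) auto
    finally show "norm (g ?p - of_real (1 / r) * (f (tr ?p r e) - f ?p)) \<le> \<epsilon>" using r by simp
  qed
qed

section \<open>Dependence of the averages on the height\<close>

lemma pt_up: "(pt y t)(0 := pt y t 0 + of_real r * \<i>) = pt (y + r) t"
  by (auto simp: pt_def algebra_simps)

lemma avg_has_derivative:
  assumes deriv: "\<And>p. p \<in> X \<Longrightarrow> ((\<lambda>r. f (p(0 := p 0 + of_real r * \<i>))) has_vector_derivative g p) (at 0)"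
    and y: "y > 0"
  shows "(avg N f has_vector_derivative avg N g y) (at y)"
proof -
  have D: "((\<lambda>y. f (pt y t)) has_vector_derivative g (pt y t)) (at y)" for t
  proof -
    have "((\<lambda>r. f (pt (y + r) t)) has_vector_derivative g (pt y t)) (at 0)"
      using deriv[OF pt_in_X[OF y], of t] unfolding pt_up .
    then show ?thesis by (rule has_vector_derivative_shift_0)
  qed
  have "((\<lambda>y. (\<Sum>\<kappa>\<in>box N. f (pt y (\<lambda>i. of_int (\<kappa> i) / N))) / of_nat (N ^ d)) has_vector_derivative
     (\<Sum>\<kappa>\<in>box N. g (pt y (\<lambda>i. of_int (\<kappa> i) / N))) / of_nat (N ^ d)) (at y)"
    by (intro has_vector_derivative_divide has_vector_derivative_sum D)
  then show ?thesis unfolding avg_def .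
qed

text \<open>Although g is null, its y-derivative g1 need not be, so g1 is never estimated.
  Integrating f2 - g1 = psi shows that the average of f1 - g is nearly constant; as the average of g
  is small, that of f1 is nearly constant, and a second integration makes that of f nearly affine.
  The formula is interpolation between heights 1 and 2.\<close>

lemma avg_asymptotically_affine:
  assumes f: "\<And>p. p \<in> X \<Longrightarrow> ((\<lambda>r. f (p(0 := p 0 + of_real r * \<i>))) has_vector_derivative f1 p) (at 0)"
    and f1: "\<And>p. p \<in> X \<Longrightarrow> ((\<lambda>r. f1 (p(0 := p 0 + of_real r * \<i>))) has_vector_derivative f2 p) (at 0)"
    and g: "\<And>p. p \<in> X \<Longrightarrow> ((\<lambda>r. g (p(0 := p 0 + of_real r * \<i>))) has_vector_derivative g1 p) (at 0)"
    and eq: "\<And>p. p \<in> X \<Longrightarrow> f2 p = g1 p + \<psi> p" and ng: "null g" and n\<psi>: "null \<psi>" and y: "y > 0"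
  shows "(\<lambda>N. avg N f y - (avg N f 1 + of_real (y - 1) * (avg N f 2 - avg N f 1))) \<longlonglongrightarrow> 0"
proof -
  \<comment> \<open>An interval of positive heights containing 1, 2 and y.\<close>
  define y1 y2 where "y1 = min 1 y" and "y2 = max 2 y"
  have y12: "0 < y1" "y1 \<le> y2" using y by (auto simp: y1_def y2_def)
  define L where "L = y2 - y1"
  have L: "L \<ge> 0" using y12 by (simp add: L_def)
  define res where "res N x = avg N f x - avg N f y1 - of_real (x - y1) * avg N f1 y1" for N x
  have res: "(\<lambda>N. res N x) \<longlonglongrightarrow> 0" if x: "x \<in> {y1..y2}" for x
  proof (rule LIMSEQ_I)
    fix \<epsilon> :: real assume \<epsilon>: "0 < \<epsilon>"
    \<comment> \<open>The two integrations cost at most L + 2 and L, where the 2 accounts for g at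
      both endpoints. The factor 2 gives strict inequality, and the summand 1 keeps the denominator
      positive even if L were 0.\<close>
    define \<eta> where "\<eta> = \<epsilon> / (2 * ((L + 2) * L + 1))"
    have \<eta>: "\<eta> > 0" using \<epsilon> L by (simp add: \<eta>_def add_nonneg_pos)
    have "\<forall>\<^sub>F N in sequentially. norm (res N x - 0) < \<epsilon>"
      using nullD[OF ng y12(1) \<eta>, of y2] nullD[OF n\<psi> y12(1) \<eta>, of y2]
    proof eventually_elim
      case (elim N)
      let ?G = "\<lambda>x. avg N f1 x - avg N g x"
      have pos: "z > 0" if "z \<in> {y1..y2}" for z using that y12 by simp
      have DG: "(?G has_vector_derivative avg N \<psi> z) (at z)" if z: "z \<in> {y1..y2}" for z
      proof -
        have "(?G has_vector_derivative (avg N f2 z - avg N g1 z)) (at z)"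
          using pos[OF z] by (intro has_vector_derivative_diff avg_has_derivative[OF f1] avg_has_derivative[OF g])
        moreover have "avg N f2 z = avg N (\<lambda>p. 1 * g1 p + \<psi> p) z" using pos[OF z] eq by (intro avg_cong) auto
        ultimately show ?thesis unfolding avg_linear by simp
      qed
      have G: "norm (avg N f1 z - avg N f1 y1) \<le> \<eta> * (L + 2)" if z: "z \<in> {y1..y2}" for z
      proof -
        have "norm (?G z - ?G y1) \<le> \<eta> * \<bar>z - y1\<bar>"
          by (rule vector_derivative_norm_bound[OF DG]) (use elim z y12 in auto)
        also have "\<dots> \<le> \<eta> * L" using z \<eta> by (intro mult_left_mono) (auto simp: L_def)
        finally have 1: "norm (?G z - ?G y1) \<le> \<eta> * L" .
        have "avg N f1 z - avg N f1 y1 = (?G z - ?G y1) + (avg N g z - avg N g y1)" by simp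
        then have "norm (avg N f1 z - avg N f1 y1) \<le> norm (?G z - ?G y1) + (norm (avg N g z) + norm (avg N g y1))"
          by (metis norm_triangle_mono norm_triangle_ineq4 order_refl)
        also have "\<dots> \<le> \<eta> * L + (\<eta> + \<eta>)" using 1 elim z y12 by (intro add_mono) auto
        finally show ?thesis by (simp add: algebra_simps)
      qed
      let ?K = "\<lambda>x. avg N f x - (x - y1) *\<^sub>R avg N f1 y1"
      have DK: "(?K has_vector_derivative (avg N f1 z - avg N f1 y1)) (at z)" if z: "z \<in> {y1..y2}" for z
        using avg_has_derivative[OF f pos[OF z], of N]
        by (auto intro!: derivative_eq_intros)
      have "norm (?K x - ?K y1) \<le> \<eta> * (L + 2) * \<bar>x - y1\<bar>"
        by (rule vector_derivative_norm_bound[OF DK]) (use G x y12 in auto)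
      also have "\<dots> \<le> \<eta> * (L + 2) * L" using x \<eta> L by (intro mult_left_mono) (auto simp: L_def)
      also have "\<dots> \<le> \<eta> * ((L + 2) * L + 1)" using \<eta> by (simp add: algebra_simps)
      also have "\<dots> = \<epsilon> / 2" using L by (simp add: \<eta>_def field_simps add_nonneg_eq_0_iff) 
      also have "\<dots> < \<epsilon>" using \<epsilon> by simp
      finally show ?case by (simp add: res_def scaleR_conv_of_real algebra_simps)
    qed
    then show "\<exists>no. \<forall>N\<ge>no. norm (res N x - 0) < \<epsilon>" unfolding eventually_sequentially .
  qed
  \<comment> \<open>Interpolation at 1 and 2 reproduces affine functions, so the expansion about
    \<open>y1\<close> subtracted in \<open>res\<close> drops out.\<close>
  have "(\<lambda>N. res N y - (res N 1 + of_real (y - 1) * (res N 2 - res N 1))) \<longlonglongrightarrow> 0 - (0 + of_real (y - 1) * (0 - 0))"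
    by (intro tendsto_intros res) (auto simp: y1_def y2_def)
  moreover have "res N y - (res N 1 + of_real (y - 1) * (res N 2 - res N 1)) =
     avg N f y - (avg N f 1 + of_real (y - 1) * (avg N f 2 - avg N f 1))" for N
    by (simp add: res_def algebra_simps)
  ultimately show ?thesis by simp
qed

lemma periodic_rpd:
  assumes f: "periodic f" and l: "l \<le> n"
  shows "periodic (rpd f l e)"
  unfolding periodic_def
proof (intro ballI allI impI)
  fix p i assume p: "p \<in> X" and i: "i < d"
  have ev: "\<forall>\<^sub>F t in nhds (0::real). p(l := p l + of_real t * e) \<in> X" by (rule eventually_update_in_X[OF p l])
  show "rpd f l e (tr p 1 (U i)) = rpd f l e p" unfolding rpd_def
  proof (rule vector_derivative_cong_eq)
    show "\<forall>\<^sub>F t in nhds 0. t \<in> UNIV \<longrightarrow> f ((tr p 1 (U i))(l := tr p 1 (U i) l + of_real t * e)) = f (p(l := p l + of_real t * e))"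
      using ev
    proof eventually_elim
      case (elim t)
      have "(tr p 1 (U i))(l := tr p 1 (U i) l + of_real t * e) = tr (p(l := p l + of_real t * e)) 1 (U i)"
        by (auto simp: tr_def)
      then show ?case using f i elim by (simp add: periodic_def)
    qed
  qed auto
qed

lemma null_rpd:
  assumes f: "smooth_on n X f" "periodic f" and l: "l \<le> n" "e \<in> {1, \<i>}"
    and s: "(\<lambda>k. if k = l then e else 0) = (\<lambda>k. \<Sum>i<d. of_real (s i) * U i k)"
  shows "null (rpd f l e)"
proof (rule null_derivative[OF smooth_on_continuous[OF f(1)] f(2) _ s])
  show "continuous_on X (rpd f l e)" using smooth_on_continuous[OF smooth_on_rpd[OF f(1) l]] .
  fix p assume p: "p \<in> X"
  have "tr p r (\<lambda>k. if k = l then e else 0) = p(l := p l + of_real r * e)" for r by (auto simp: tr_def)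
  then show "((\<lambda>r. f (tr p r (\<lambda>k. if k = l then e else 0))) has_vector_derivative rpd f l e p) (at 0)"
    using smooth_on_rpd_deriv[OF f(1) l p] by simp
qed

end

section \<open>Necessity\<close>

lemma sum_atMost_split_0: "(\<Sum>l\<le>n. f l) = f 0 + (\<Sum>l\<in>{1..n}. f l)" for f :: "nat \<Rightarrow> 'b::comm_monoid_add"
proof -
  have "{..n} = insert 0 {1..n}" by auto
  then show ?thesis by simp
qed

lemma cpd_affine:
  assumes ev: "\<forall>\<^sub>F t in nhds 0. F (p(m := p m + t)) = (\<Sum>l\<le>n. c l * (p(m := p m + t)) l) + c0" and m: "m \<le> n"
  shows "cpd F m p = c m"
proof -
  have "(\<Sum>l\<le>n. c l * (p(m := p m + t)) l) = (\<Sum>l\<le>n. c l * p l) + c m * t" for t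
  proof -
    have "(\<Sum>l\<le>n. c l * (p(m := p m + t)) l) = (\<Sum>l\<le>n. c l * p l + (if l = m then c m * t else 0))"
      by (intro sum.cong) (auto simp: algebra_simps)
    then show ?thesis using m by (simp add: sum.distrib)
  qed
  then have "cpd F m p = deriv (\<lambda>t. (\<Sum>l\<le>n. c l * p l) + c m * t + c0) 0"
    unfolding cpd_def using ev by (intro deriv_cong_ev) auto
  also have "\<dots> = c m" by (rule DERIV_imp_deriv) (auto intro!: derivative_eq_intros)
  finally show ?thesis .
qed

text \<open>The averages are only known to be bounded; all matrix entries and both heights must
  converge along the same subsequence.\<close>

lemma common_convergent_subsequence:
  fixes x :: "'i \<Rightarrow> nat \<Rightarrow> complex"
  assumes "finite I" "\<And>i. i \<in> I \<Longrightarrow> bounded (range (x i))"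
  shows "\<exists>r. strict_mono (r :: nat \<Rightarrow> nat) \<and> (\<forall>i\<in>I. convergent (x i \<circ> r))"
  using assms
proof (induction I rule: finite_induct)
  case empty
  then show ?case by (intro exI[of _ id]) (auto simp: strict_mono_def)
next
  case (insert i I)
  obtain r where r: "strict_mono (r :: nat \<Rightarrow> nat)" "\<forall>i\<in>I. convergent (x i \<circ> r)" using insert by blast
  have "bounded (range (x i \<circ> r))"
    by (rule bounded_subset[OF insert.prems[of i]]) auto
  then obtain l s where s: "strict_mono (s :: nat \<Rightarrow> nat)" "((x i \<circ> r) \<circ> s) \<longlonglongrightarrow> l"
    using bounded_imp_convergent_subsequence by blast
  have "convergent (x j \<circ> (r \<circ> s))" if "j \<in> insert i I" for j
  proof (cases "j = i")
    case True
    then show ?thesis using s(2) by (auto simp: convergent_def o_assoc)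
  next
    case False
    then have "convergent (x j \<circ> r)" using that r by auto
    then have "convergent ((x j \<circ> r) \<circ> s)" using s(1) by (rule convergent_subseq_convergent)
    then show ?thesis by (simp add: o_assoc)
  qed
  moreover have "strict_mono (r \<circ> s)" using r(1) s(1) by (rule strict_mono_o)
  ultimately show ?case by blast
qed

text \<open>Isolates the second derivative of the averaged coefficient in the direction Im w; apart from it,
  every second derivative occurring here involves a direction tangent to the torus.\<close>
lemma pluriclosed_split:
  fixes t1 :: complex
  assumes "t1 - t2 - t3 + t4 = 0" "4 * t1 = r1 + \<i> * r2 - \<i> * r3 + f2" "4 * t3 = s1 + \<i> * s2 - \<i> * s3 + s4"
  shows "f2 = \<i> * r3 + ((-\<i>) * s3 + s4) + ((-1) * r1 + ((-\<i>) * r2 + (4 * t2 + (s1 + (\<i> * s2 + (-4) * t4)))))"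
proof -
  have t1: "t1 = t2 + t3 - t4" using assms(1) by (metis add_diff_cancel_right' diff_add_cancel diff_diff_eq2 diff_0 diff_minus_eq_add minus_diff_eq diff_diff_add)
  have "f2 = 4 * t1 - (r1 + \<i> * r2 - \<i> * r3)" using assms(2) by simp
  also have "4 * t1 = 4 * t2 + (s1 + \<i> * s2 - \<i> * s3 + s4) - 4 * t4"
    unfolding t1 assms(3)[symmetric] by (simp add: algebra_simps)
  finally show ?thesis by (simp add: algebra_simps)
qed

text \<open>The linear part of \<open>g_0\<close>, block diagonal with blocks r and the transpose of
  S. The parameters also cover the inverse map.\<close>

definition g0_coeff :: "real \<Rightarrow> (nat \<Rightarrow> nat \<Rightarrow> complex) \<Rightarrow> nat \<Rightarrow> nat \<Rightarrow> complex" where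
  "g0_coeff r S j l = (if j = 0 then (if l = 0 then of_real r else 0) else if l = 0 then 0 else S l j)"

lemma g0_linear: "j \<le> n \<Longrightarrow> EP_g0 n r S q j = (\<Sum>l\<le>n. g0_coeff r S j l * q l)"
  by (auto simp: EP_g0_def g0_coeff_def sum_atMost_split_0)

section \<open>The lattice and the monodromy of the group\<close>

context endo_pajitnov
begin

definition U :: "nat \<Rightarrow> nat \<Rightarrow> complex" where
  "U i k = (if k = 0 then of_real (a $ i) else if k \<le> n then b k $ i else 0)"

sublocale TL: torus_lattice n d U
  by unfold_locales (auto simp: flat_dir_def U_def)

text \<open>Every real coordinate direction except Im w is a real combination of the periods. Im w
  is excluded because all periods have real coordinate 0.\<close>

lemma U_spans:
  assumes "l \<le> n" "e \<in> {1, \<i>}" "\<not> (l = 0 \<and> e = \<i>)"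
  obtains s :: "nat \<Rightarrow> real" where "(\<lambda>k. if k = l then e else 0) = (\<lambda>k. \<Sum>i<d. of_real (s i) * U i k)"
proof -
  obtain s :: "nat \<Rightarrow> real" where s: "(\<Sum>i<d. s i * a $ i) = (if l = 0 then 1 else 0)"
      "\<And>k. k \<in> {1..n} \<Longrightarrow> (\<Sum>i<d. of_real (s i) * b k $ i) = (if k = l then e else 0)"
    using lattice_spans[of "if l = 0 then 1 else 0" "\<lambda>k. if k = l then e else 0"] by auto
  have "(if k = l then e else 0) = (\<Sum>i<d. of_real (s i) * U i k)" for k
  proof (cases "k = 0")
    case True
    have "(\<Sum>i<d. of_real (s i) * U i k) = of_real (\<Sum>i<d. s i * a $ i)" using True by (simp add: U_def)
    then show ?thesis using True assms by (auto simp: s)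
  next
    case False
    then show ?thesis using s(2)[of k] assms by (cases "k \<le> n") (auto simp: U_def)
  qed
  then show ?thesis using that by blast
qed

lemma null_rpd':
  assumes "smooth_on n (EP_X n) f" "TL.periodic f" "l \<le> n" "e \<in> {1, \<i>}" "\<not> (l = 0 \<and> e = \<i>)"
  shows "TL.null (rpd f l e)"
proof -
  obtain s :: "nat \<Rightarrow> real" where "(\<lambda>k. if k = l then e else 0) = (\<lambda>k. \<Sum>i<d. of_real (s i) * U i k)"
    using U_spans[OF assms(3-5)] by blast
  then show ?thesis by (rule TL.null_rpd[OF assms(1-4)])
qed

lemma gi_affine: "j \<le> n \<Longrightarrow> EP_gi n a b (Suc i) q j = (\<Sum>l\<le>n. (if l = j then 1 else 0) * q l) + U i j"
  by (auto simp: EP_gi_def U_def if_distrib[of "\<lambda>x. x * _"] cong: if_cong)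

lemma gi_eq_tr: "q \<in> EP_X n \<Longrightarrow> EP_gi n a b (Suc i) q = tr q 1 (U i)"
  by (auto simp: EP_gi_def tr_def U_def EP_X_def)

lemma g0_coeff_sum:
  assumes "i \<in> {1..n}" "j \<in> {1..n}"
  shows "(\<Sum>k\<le>n. \<Sum>l\<le>n. H k l * g0_coeff alpha R k i * cnj (g0_coeff alpha R l j)) =
    (\<Sum>k\<in>{1..n}. \<Sum>l\<in>{1..n}. H k l * R i k * cnj (R j l))"
  using assms by (simp add: sum_atMost_split_0 g0_coeff_def)

text \<open>The transpose of \<open>M\<close> acting on lattice coordinates: the linear map
  \<open>g_0\<close> sends u_i to the sum of M_(im) u_m over m.\<close>

definition torus_map :: "(nat \<Rightarrow> int) \<Rightarrow> nat \<Rightarrow> int" where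
  "torus_map \<kappa> m = (\<Sum>i<d. M $$ (i, m) * \<kappa> i)"

text \<open>\<open>g_0\<close> carries the grid in the fibre over y to the grid in the fibre over
  \<open>alpha * y\<close>. In coordinate 0 this is the eigenvector equation for a, in the others
  the defining equation of \<open>R\<close>.\<close>

lemma g0_pt: "EP_g0 n alpha R (TL.pt y (\<lambda>i. of_int (\<kappa> i) / N)) = TL.pt (alpha * y) (\<lambda>m. of_int (torus_map \<kappa> m) / of_nat N)"
proof
  fix k
  let ?t = "\<lambda>i. real_of_int (\<kappa> i) / N"
  have gen: "(\<Sum>m<d. complex_of_real (of_int (torus_map \<kappa> m) / N) * u m) = (\<Sum>i<d. of_real (?t i) * (\<Sum>m<d. of_int (M $$ (i, m)) * u m))"
    for u :: "nat \<Rightarrow> complex"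
  proof -
    have "(\<Sum>m<d. complex_of_real (of_int (torus_map \<kappa> m) / N) * u m) = (\<Sum>m<d. \<Sum>i<d. of_real (?t i) * (of_int (M $$ (i, m)) * u m))"
    proof (rule sum.cong[OF refl])
      fix m
      have "complex_of_real (of_int (torus_map \<kappa> m) / N) = (\<Sum>i<d. of_real (?t i) * of_int (M $$ (i, m)))"
        unfolding torus_map_def by (simp add: sum_divide_distrib mult.commute)
      then show "complex_of_real (of_int (torus_map \<kappa> m) / N) * u m = (\<Sum>i<d. of_real (?t i) * (of_int (M $$ (i, m)) * u m))"
        by (simp add: sum_distrib_right mult.assoc)
    qed
    then show ?thesis unfolding sum_distrib_left by (subst (asm) sum.swap)
  qed
  consider "k = 0" | "k \<in> {1..n}" | "k > n" by force
  then show "EP_g0 n alpha R (TL.pt y ?t) k = TL.pt (alpha * y) (\<lambda>m. of_int (torus_map \<kappa> m) / N) k"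
  proof cases
    case 1
    have "(\<Sum>m<d. of_int (M $$ (i, m)) * complex_of_real (a $ m)) = of_real (alpha * a $ i)" if "i < d" for i
      unfolding M_a[OF that, symmetric] by simp
    then have "(\<Sum>i<d. of_real (?t i) * (\<Sum>m<d. of_int (M $$ (i, m)) * U m 0)) = (\<Sum>i<d. of_real (?t i) * (of_real alpha * U i 0))"
      by (intro sum.cong) (auto simp: U_def)
    then show ?thesis using 1 unfolding TL.pt_def gen
      by (simp add: EP_g0_def algebra_simps sum_distrib_left)
  next
    case 2
    have "(\<Sum>m<d. of_int (M $$ (i, m)) * U m k) = (\<Sum>l\<in>{1..n}. R l k * U i l)" if "i < d" for i
      using Mc_b[OF 2 that] 2 by (simp add: U_def)
    then have "(\<Sum>i<d. of_real (?t i) * (\<Sum>m<d. of_int (M $$ (i, m)) * U m k)) = (\<Sum>i<d. of_real (?t i) * (\<Sum>l\<in>{1..n}. R l k * U i l))"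
      by (intro sum.cong) auto
    also have "\<dots> = (\<Sum>l\<in>{1..n}. R l k * (\<Sum>i<d. of_real (?t i) * U i l))"
      unfolding sum_distrib_left by (subst sum.swap) (simp add: mult_ac)
    finally show ?thesis using 2 unfolding TL.pt_def gen by (auto simp: EP_g0_def intro!: sum.cong)
  next
    case 3
    then show ?thesis by (simp add: EP_g0_def TL.pt_def U_def)
  qed
qed

text \<open>As \<open>det M = 1\<close>, the adjugate is an integral inverse, and it recovers the
  residues of the argument from those of the image.\<close>

lemma torus_map_inj:
  assumes e: "\<And>m. m < d \<Longrightarrow> torus_map \<kappa> m mod N = torus_map \<kappa>' m mod N" and i: "i < d"
  shows "\<kappa> i mod N = \<kappa>' i mod N"
proof -
  let ?B = "adj_mat M"
  have B: "?B \<in> carrier_mat d d" "M * ?B = 1\<^sub>m d"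
    using adj_mat[OF M_carrier] M_SL by (auto simp: smult_mat_def intro!: eq_matI)
  have inv: "(\<Sum>m<d. ?B $$ (m, i) * torus_map \<kappa> m) = \<kappa> i" for \<kappa>
  proof -
    have "(\<Sum>m<d. ?B $$ (m, i) * torus_map \<kappa> m) = (\<Sum>j<d. (\<Sum>m<d. M $$ (j, m) * ?B $$ (m, i)) * \<kappa> j)"
      unfolding torus_map_def sum_distrib_left sum_distrib_right by (subst sum.swap) (simp add: mult_ac)
    also have "\<dots> = (\<Sum>j<d. (M * ?B) $$ (j, i) * \<kappa> j)"
      using B(1) i M_carrier by (intro sum.cong) (auto simp: scalar_prod_def lessThan_atLeast0)
    also have "\<dots> = (\<Sum>j<d. if j = i then \<kappa> i else 0)" unfolding B(2) using i by (intro sum.cong) auto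
    finally show ?thesis using i by simp
  qed
  have "N dvd (\<Sum>m<d. ?B $$ (m, i) * (torus_map \<kappa> m - torus_map \<kappa>' m))"
    by (intro dvd_sum dvd_mult) (use e in \<open>auto simp: mod_eq_dvd_iff\<close>)
  then show ?thesis by (simp add: right_diff_distrib sum_subtractf inv mod_eq_dvd_iff)
qed

lemma necessity:
  assumes "EP_admits_pluriclosed n alpha R a b"
  shows "diagonalizable_C Mc \<and>
     (\<exists>i0\<in>{1..n}. complex_of_real alpha * beta i0 * cnj (beta i0) = 1 \<and>
        (\<forall>i\<in>{1..n}. i \<noteq> i0 \<longrightarrow> cmod (beta i) = 1))"
proof -
  let ?X = "EP_X n"
  obtain h where hm: "hermitian_metric n ?X h" and pc: "pluriclosed n ?X h"
    and inv: "\<And>g. g \<in> gen_group ?X (EP_gens n alpha R a b) \<Longrightarrow> invariant_metric n ?X h g"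
    using assms unfolding EP_admits_pluriclosed_def by blast
  have smooth: "smooth_on n ?X (\<lambda>p. h p j k)" if "j \<le> n" "k \<le> n" for j k
    using hm that unfolding hermitian_metric_def by blast
  have inv_gen: "invariant_metric n ?X h g" if "g \<in> EP_gens n alpha R a b" for g
    using inv[OF gen_group.gg_gen[OF that gen_group.gg_id]] by simp

  have per: "TL.periodic (\<lambda>p. h p j k)" if jk: "j \<le> n" "k \<le> n" for j k
    unfolding TL.periodic_def
  proof (intro ballI allI impI)
    fix p i assume p: "p \<in> ?X" and i: "i < d"
    let ?g = "EP_gi n a b (Suc i)"
    have "?g \<in> EP_gens n alpha R a b" unfolding EP_gens_def using i by (auto simp: d_def)
    from inv_gen[OF this] have "h p j k = (\<Sum>j'\<le>n. \<Sum>k'\<le>n. h (?g p) j' k' * cpd (\<lambda>q. ?g q j') j p * cnj (cpd (\<lambda>q. ?g q k') k p))"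
      using p jk unfolding invariant_metric_def by blast
    \<comment> \<open>Translations have identity derivative, so invariance of the metric is
      periodicity of each coefficient.\<close>
    also have "\<dots> = (\<Sum>j'\<le>n. \<Sum>k'\<le>n. h (?g p) j' k' * (if j = j' then 1 else 0) * cnj (if k = k' then 1 else 0))"
      using jk by (intro sum.cong refl) (simp add: cpd_affine[OF always_eventually[OF allI[OF gi_affine]]])
    also have "\<dots> = h (?g p) j k"
      using jk by (simp add: if_distrib[of cnj] if_distrib[of "\<lambda>x. _ * x"] cong: if_cong)
    finally show "h (tr p 1 (U i)) j k = h p j k" using gi_eq_tr[OF p] by simp
  qed

  have g0inv: "h p i j = (\<Sum>k\<in>{1..n}. \<Sum>l\<in>{1..n}. h (EP_g0 n alpha R p) k l * R i k * cnj (R j l))"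
    if p: "p \<in> ?X" and ij: "i \<in> {1..n}" "j \<in> {1..n}" for p i j
  proof -
    let ?g = "EP_g0 n alpha R"
    have "?g \<in> EP_gens n alpha R a b" unfolding EP_gens_def by simp
    from inv_gen[OF this] have "h p i j = (\<Sum>k\<le>n. \<Sum>l\<le>n. h (?g p) k l * cpd (\<lambda>q. ?g q k) i p * cnj (cpd (\<lambda>q. ?g q l) j p))"
      using p ij unfolding invariant_metric_def by auto
    also have "\<dots> = (\<Sum>k\<le>n. \<Sum>l\<le>n. h (?g p) k l * g0_coeff alpha R k i * cnj (g0_coeff alpha R l j))"
    proof (intro sum.cong refl)
      have "cpd (\<lambda>q. ?g q k) i p = g0_coeff alpha R k i" if "k \<in> {..n}" "i \<in> {1..n}" for k i
        by (rule cpd_affine[where n = n and c = "g0_coeff alpha R k" and ?c0.0 = 0]) (use that in \<open>auto simp: g0_linear\<close>)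
      then show "h (?g p) k l * cpd (\<lambda>q. ?g q k) i p * cnj (cpd (\<lambda>q. ?g q l) j p) = h (?g p) k l * g0_coeff alpha R k i * cnj (g0_coeff alpha R l j)"
        if "k \<in> {..n}" "l \<in> {..n}" for k l using that ij by simp
    qed
    finally show ?thesis unfolding g0_coeff_sum[OF ij] .
  qed

  \<comment> \<open>For l at least 1 both outer derivatives, along z_l and i z_l, are tangent to the
    torus.\<close>
  have nullT: "TL.null (dz (dzb (\<lambda>q. h q j k) m) l)" if "j \<le> n" "k \<le> n" "m \<le> n" "l \<in> {1..n}" for j k m l
  proof -
    let ?f = "\<lambda>q. h q j k"
    have l: "l \<le> n" "l \<noteq> 0" using that by auto
    have s: "smooth_on n ?X (rpd ?f m e)" "TL.periodic (rpd ?f m e)" if "e \<in> {1, \<i>}" for e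
      using that \<open>j \<le> n\<close> \<open>k \<le> n\<close> \<open>m \<le> n\<close> by (auto intro!: smooth_on_rpd smooth TL.periodic_rpd per)
    have N: "TL.null (rpd (rpd ?f m e') l e)" if "e \<in> {1, \<i>}" "e' \<in> {1, \<i>}" for e e'
      by (rule null_rpd'[OF s[OF that(2)] l(1) that(1)]) (use l in auto)
    have "TL.null (\<lambda>p. (1/4) * rpd (rpd ?f m 1) l 1 p + ((\<i>/4) * rpd (rpd ?f m \<i>) l 1 p
     + ((-\<i>/4) * rpd (rpd ?f m 1) l \<i> p + (1/4) * rpd (rpd ?f m \<i>) l \<i> p)))"
      by (intro TL.null_linear TL.null_scale N) auto
    then show ?thesis
    proof (rule TL.null_cong[rotated])
      fix p assume p: "p \<in> ?X"
      show "(1/4) * rpd (rpd ?f m 1) l 1 p + ((\<i>/4) * rpd (rpd ?f m \<i>) l 1 p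
     + ((-\<i>/4) * rpd (rpd ?f m 1) l \<i> p + (1/4) * rpd (rpd ?f m \<i>) l \<i> p)) = dz (dzb ?f m) l p"
        unfolding dz_dzb_expand[OF smooth[OF that(1,2)] that(3) l(1) p] by (simp add: field_simps)
    qed
  qed

  have affine: "(\<lambda>N. TL.avg N (\<lambda>p. h p j k) y - (TL.avg N (\<lambda>p. h p j k) 1 +
      of_real (y - 1) * (TL.avg N (\<lambda>p. h p j k) 2 - TL.avg N (\<lambda>p. h p j k) 1))) \<longlonglongrightarrow> 0"
    if jk: "j \<in> {1..n}" "k \<in> {1..n}" and y: "y > 0" for j k y
  proof -
    let ?f = "\<lambda>q. h q j k" and ?f' = "\<lambda>q. h q j 0"
    have jk': "j \<le> n" "k \<le> n" "k \<noteq> 0" using jk by auto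
    have f: "smooth_on n ?X ?f" "TL.periodic ?f" and f': "smooth_on n ?X ?f'" "TL.periodic ?f'"
      using smooth per jk' by auto
    have rs: "smooth_on n ?X (rpd F l e)" if "smooth_on n ?X F" "l \<le> n" "e \<in> {1, \<i>}" for F l e
      using that by (rule smooth_on_rpd)
    have D: "((\<lambda>r. F (p(0 := p 0 + of_real r * \<i>))) has_vector_derivative rpd F 0 \<i> p) (at 0)"
      if "smooth_on n ?X F" "p \<in> ?X" for F p
      using smooth_on_rpd_deriv[OF that(1) _ _ that(2), of 0 \<i>] by simp
    \<comment> \<open>In \<open>?g1\<close> every term has outer derivative in Im w and an inner
      derivative tangent to the torus; \<open>?g\<close> holds these inner derivatives. Every term
      of the remainder psi has its outer derivative tangent to the torus.\<close>
    let ?g = "\<lambda>p. \<i> * rpd ?f 0 1 p + ((-\<i>) * rpd ?f' k 1 p + rpd ?f' k \<i> p)"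
    let ?g1 = "\<lambda>p. \<i> * rpd (rpd ?f 0 1) 0 \<i> p + ((-\<i>) * rpd (rpd ?f' k 1) 0 \<i> p + rpd (rpd ?f' k \<i>) 0 \<i> p)"
    let ?\<psi> = "\<lambda>p. (-1) * rpd (rpd ?f 0 1) 0 1 p + ((-\<i>) * rpd (rpd ?f 0 \<i>) 0 1 p
       + (4 * dz (dzb (\<lambda>q. h q 0 k) 0) j p + (rpd (rpd ?f' k 1) 0 1 p + (\<i> * rpd (rpd ?f' k \<i>) 0 1 p
       + (-4) * dz (dzb (\<lambda>q. h q 0 0) k) j p))))"
    show ?thesis
    proof (rule TL.avg_asymptotically_affine[where g = ?g and ?g1.0 = ?g1 and \<psi> = ?\<psi>, OF D[OF f(1)] D[OF rs[OF f(1)]] _ _ _ _ y])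
      fix p assume p: "p \<in> ?X"
      show "((\<lambda>r. ?g (p(0 := p 0 + of_real r * \<i>))) has_vector_derivative ?g1 p) (at 0)"
        by (intro has_vector_derivative_add has_vector_derivative_mult_right D rs f f' p) (use jk' in auto)
      have "dz (dzb ?f 0) 0 p - dz (dzb (\<lambda>q. h q 0 k) 0) j p - dz (dzb ?f' k) 0 p + dz (dzb (\<lambda>q. h q 0 0) k) j p = 0"
        \<comment> \<open>With l = m = 0 the first term contains the second derivative of
          \<open>h j k\<close> in Im w; the second and fourth have outer derivative in z_j.\<close>
        using pc[unfolded pluriclosed_def Let_def, rule_format, OF p, of 0 j 0 k] jk' by simp
      moreover have "4 * dz (dzb ?f 0) 0 p = rpd (rpd ?f 0 1) 0 1 p + \<i> * rpd (rpd ?f 0 \<i>) 0 1 p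
          - \<i> * rpd (rpd ?f 0 1) 0 \<i> p + rpd (rpd ?f 0 \<i>) 0 \<i> p"
        unfolding dz_dzb_expand[OF f(1) le0 le0 p] by simp
      moreover have "4 * dz (dzb ?f' k) 0 p = rpd (rpd ?f' k 1) 0 1 p + \<i> * rpd (rpd ?f' k \<i>) 0 1 p
          - \<i> * rpd (rpd ?f' k 1) 0 \<i> p + rpd (rpd ?f' k \<i>) 0 \<i> p"
        unfolding dz_dzb_expand[OF f'(1) jk'(2) le0 p] by simp
      ultimately show "rpd (rpd ?f 0 \<i>) 0 \<i> p = ?g1 p + ?\<psi> p"
        by (rule pluriclosed_split)
    next
      show "TL.null ?g"
        by (intro TL.null_linear TL.null_add null_rpd' f f') (use jk' in auto)
      have N2: "TL.null (rpd (rpd F m e') 0 1)" if "smooth_on n ?X F" "TL.periodic F" "m \<le> n" "e' \<in> {1, \<i>}" for F m e'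
        by (intro null_rpd' rs that TL.periodic_rpd) auto
      show "TL.null ?\<psi>"
        by (intro TL.null_linear TL.null_add TL.null_scale nullT N2 f f') (use jk jk' in auto)
    qed auto
  qed

  \<comment> \<open>\<open>Suc N\<close> avoids the degenerate grid N = 0. Convergence is arranged
    at heights 1 and 2 only; \<open>affine\<close> then yields it at all others.\<close>
  let ?av = "\<lambda>j k N y. TL.avg (Suc N) (\<lambda>p. h p j k) y"
  have "\<exists>r. strict_mono (r :: nat \<Rightarrow> nat) \<and> (\<forall>i\<in>{1..n} \<times> {1..n} \<times> {1, 2}. convergent ((\<lambda>(j, k, y) N. ?av j k N y) i \<circ> r))"
    by (rule common_convergent_subsequence) (auto intro!: TL.avg_bounded smooth_on_continuous[OF smooth])
  then obtain r where r: "strict_mono (r :: nat \<Rightarrow> nat)"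
    and conv: "\<And>j k y. j \<in> {1..n} \<Longrightarrow> k \<in> {1..n} \<Longrightarrow> y \<in> {1, 2} \<Longrightarrow> convergent (\<lambda>N. ?av j k (r N) y)"
    by (fastforce simp: o_def)
  define P Q where "P j k = lim (\<lambda>N. ?av j k (r N) 1)" and "Q j k = lim (\<lambda>N. ?av j k (r N) 2)" for j k
  have lim12: "(\<lambda>N. ?av j k (r N) 1) \<longlonglongrightarrow> P j k" "(\<lambda>N. ?av j k (r N) 2) \<longlonglongrightarrow> Q j k"
    if "j \<in> {1..n}" "k \<in> {1..n}" for j k
    using conv[OF that, of 1] conv[OF that, of 2] by (auto simp: P_def Q_def convergent_LIMSEQ_iff)
  define H where "H y j k = P j k + of_real (y - 1) * (Q j k - P j k)" for y :: real and j k
  have H: "(\<lambda>N. ?av j k (r N) y) \<longlonglongrightarrow> H y j k" if jk: "j \<in> {1..n}" "k \<in> {1..n}" and y: "y > 0" for j k y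
  proof -
    have "filterlim (\<lambda>N. Suc (r N)) at_top sequentially"
      using filterlim_compose[OF filterlim_Suc filterlim_subseq[OF r]] .
    from filterlim_compose[OF affine[OF jk y] this]
    have "(\<lambda>N. ?av j k (r N) y - (?av j k (r N) 1 + of_real (y - 1) * (?av j k (r N) 2 - ?av j k (r N) 1))) \<longlonglongrightarrow> 0" .
    moreover have "(\<lambda>N. ?av j k (r N) 1 + of_real (y - 1) * (?av j k (r N) 2 - ?av j k (r N) 1)) \<longlonglongrightarrow> H y j k"
      unfolding H_def by (intro tendsto_intros lim12 jk)
    ultimately have "(\<lambda>N. (?av j k (r N) y - (?av j k (r N) 1 + of_real (y - 1) * (?av j k (r N) 2 - ?av j k (r N) 1))) +
      (?av j k (r N) 1 + of_real (y - 1) * (?av j k (r N) 2 - ?av j k (r N) 1))) \<longlonglongrightarrow> 0 + H y j k" by (rule tendsto_add)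
    then show ?thesis by simp
  qed

  have avg_inv: "?av i j N y = (\<Sum>k\<in>{1..n}. \<Sum>l\<in>{1..n}. ?av k l N (alpha * y) * R i k * cnj (R j l))"
    if ij: "i \<in> {1..n}" "j \<in> {1..n}" and y: "y > 0" for i j N y
  proof -
    let ?N = "Suc N"
    \<comment> \<open>The average over the fibre at \<open>alpha * y\<close> is rewritten over the
      images under \<open>g_0\<close> of the grid points at height y, where pointwise invariance
      applies.\<close>
    have "?av k l N (alpha * y) = (\<Sum>\<kappa>\<in>TL.box ?N. h (TL.pt (alpha * y) (\<lambda>i. of_int (torus_map \<kappa> i) / ?N)) k l) / of_nat (?N ^ d)"
      if "k \<in> {1..n}" "l \<in> {1..n}" for k l
    proof (rule TL.avg_reindex[where f = "\<lambda>p. h p k l" and \<phi> = torus_map, symmetric])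
      show "\<kappa> i mod int ?N = \<kappa>' i mod int ?N"
        if "\<And>i. i < d \<Longrightarrow> torus_map \<kappa> i mod int ?N = torus_map \<kappa>' i mod int ?N" "i < d" for \<kappa> \<kappa>' i
        using that by (rule torus_map_inj)
    qed (use per that alpha_pos y in auto)
    then have "(\<Sum>k\<in>{1..n}. \<Sum>l\<in>{1..n}. ?av k l N (alpha * y) * R i k * cnj (R j l)) =
      (\<Sum>k\<in>{1..n}. \<Sum>l\<in>{1..n}. \<Sum>\<kappa>\<in>TL.box ?N. h (TL.pt (alpha * y) (\<lambda>i. of_int (torus_map \<kappa> i) / ?N)) k l * R i k * cnj (R j l) / of_nat (?N ^ d))"
      by (simp add: sum_distrib_right sum_divide_distrib del: of_nat_Suc)
    also have "\<dots> = (\<Sum>\<kappa>\<in>TL.box ?N. \<Sum>k\<in>{1..n}. \<Sum>l\<in>{1..n}. h (TL.pt (alpha * y) (\<lambda>i. of_int (torus_map \<kappa> i) / ?N)) k l * R i k * cnj (R j l) / of_nat (?N ^ d))"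
      by (subst sum.swap, subst (2) sum.swap, rule refl)
    also have "\<dots> = (\<Sum>\<kappa>\<in>TL.box ?N. h (TL.pt y (\<lambda>i. of_int (\<kappa> i) / ?N)) i j / of_nat (?N ^ d))"
    proof (intro sum.cong refl)
      fix \<kappa>
      show "(\<Sum>k\<in>{1..n}. \<Sum>l\<in>{1..n}. h (TL.pt (alpha * y) (\<lambda>i. of_int (torus_map \<kappa> i) / ?N)) k l * R i k * cnj (R j l) / of_nat (?N ^ d))
        = h (TL.pt y (\<lambda>i. of_int (\<kappa> i) / ?N)) i j / of_nat (?N ^ d)"
        unfolding g0inv[OF TL.pt_in_X[OF y] ij] g0_pt sum_divide_distrib ..
    qed
    finally show ?thesis unfolding TL.avg_def sum_divide_distrib by simp
  qed
  have H_inv: "H y i j = (\<Sum>k\<in>{1..n}. \<Sum>l\<in>{1..n}. H (alpha * y) k l * R i k * cnj (R j l))"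
    if ij: "i \<in> {1..n}" "j \<in> {1..n}" and y: "y > 0" for i j y
  proof (rule LIMSEQ_unique[OF H[OF ij y]])
    have "alpha * y > 0" using alpha_pos y by simp
    then show "(\<lambda>N. ?av i j (r N) y) \<longlonglongrightarrow> (\<Sum>k\<in>{1..n}. \<Sum>l\<in>{1..n}. H (alpha * y) k l * R i k * cnj (R j l))"
      unfolding avg_inv[OF ij y] by (intro tendsto_intros H)
  qed

  \<comment> \<open>Solves A + B = P and A + 2 B = Q, the values at heights 1 and 2.\<close>
  define A B where "A j k = 2 * P j k - Q j k" and "B j k = Q j k - P j k" for j k
  have HAB: "H y j k = A j k + of_real y * B j k" for y j k by (simp add: H_def A_def B_def algebra_simps)
  define S where "S F i j = (\<Sum>k\<in>{1..n}. \<Sum>l\<in>{1..n}. F k l * R i k * cnj (R j l))" for F :: "nat \<Rightarrow> nat \<Rightarrow> complex" and i j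
  have S_lin: "S (\<lambda>k l. A k l + c * B k l) i j = S A i j + c * S B i j" for c i j
    by (simp add: S_def sum.distrib sum_distrib_left algebra_simps)
  have AB: "A i j + of_real y * B i j = S A i j + of_real (alpha * y) * S B i j"
    if "i \<in> {1..n}" "j \<in> {1..n}" "y > 0" for i j y
    using H_inv[OF that] unfolding HAB S_def[symmetric] S_lin .
  have A: "A i j = S A i j" and B: "B i j = alpha * S B i j" if ij: "i \<in> {1..n}" "j \<in> {1..n}" for i j
  proof -
    have e1: "A i j + B i j = S A i j + alpha * S B i j" using AB[OF ij, of 1] by simp
    have e2: "A i j + 2 * B i j = S A i j + 2 * (alpha * S B i j)" using AB[OF ij, of 2] by (simp add: algebra_simps)
    have "B i j = (A i j + 2 * B i j) - (A i j + B i j)" by simp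
    also have "\<dots> = alpha * S B i j" unfolding e1 e2 by simp
    finally show "B i j = alpha * S B i j" .
    with e1 show "A i j = S A i j" by simp
  qed
  show ?thesis
  proof (rule forms_imp_spectrum[of A B])
    fix v :: "nat \<Rightarrow> complex" assume v: "\<exists>k\<in>{1..n}. v k \<noteq> 0"
    let ?q = "\<lambda>p. sesq n (h p) v v"
    \<comment> \<open>Extending v by zero in coordinate 0 reduces positivity of the block with
      indices from 1 on to that of the full matrix.\<close>
    define w where "w k = (if k = 0 then 0 else v k)" for k
    have "Re (?q p) > 0" if p: "p \<in> ?X" for p
    proof -
      obtain k where "k \<in> {1..n}" "v k \<noteq> 0" using v by blast
      then have "k \<le> n \<and> w k \<noteq> 0" by (auto simp: w_def)
      then have "\<exists>k\<le>n. w k \<noteq> 0" by blast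
      then have "0 < Re (\<Sum>j\<le>n. \<Sum>k\<le>n. h p j k * w j * cnj (w k))"
        using conjunct2[OF conjunct2[OF hm[unfolded hermitian_metric_def]], rule_format, OF p] by blast
      also have "(\<Sum>j\<le>n. \<Sum>k\<le>n. h p j k * w j * cnj (w k)) = ?q p"
        unfolding sum_atMost_split_0 sesq_def by (auto simp: w_def intro!: sum.cong)
      finally show ?thesis .
    qed
    moreover have "continuous_on ?X ?q" unfolding sesq_def
      by (intro continuous_intros smooth_on_continuous[OF smooth]) auto
    ultimately obtain c where c: "c > 0" "\<And>N. c \<le> Re (TL.avg (Suc N) ?q 1)"
      using TL.avg_Re_positive[of ?q 1] by auto
    have "TL.avg (Suc N) ?q 1 = sesq n (\<lambda>j k. ?av j k N 1) v v" for N
    proof -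
      have "TL.avg (Suc N) ?q 1 = (\<Sum>\<kappa>\<in>TL.box (Suc N). \<Sum>j\<in>{1..n}. \<Sum>k\<in>{1..n}. h (TL.pt 1 (\<lambda>i. of_int (\<kappa> i) / Suc N)) j k * v j * cnj (v k) / of_nat (Suc N ^ d))"
        unfolding TL.avg_def sesq_def sum_divide_distrib ..
      also have "\<dots> = (\<Sum>j\<in>{1..n}. \<Sum>k\<in>{1..n}. \<Sum>\<kappa>\<in>TL.box (Suc N). h (TL.pt 1 (\<lambda>i. of_int (\<kappa> i) / Suc N)) j k * v j * cnj (v k) / of_nat (Suc N ^ d))"
        by (subst sum.swap, subst (2) sum.swap, rule refl)
      also have "\<dots> = sesq n (\<lambda>j k. ?av j k N 1) v v"
        unfolding sesq_def TL.avg_def by (simp add: sum_distrib_right sum_divide_distrib del: of_nat_Suc)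
      finally show ?thesis .
    qed
    then have "(\<lambda>N. TL.avg (Suc (r N)) ?q 1) \<longlonglongrightarrow> sesq n P v v"
      unfolding sesq_def by (auto intro!: tendsto_intros lim12)
    then have "(\<lambda>N. Re (TL.avg (Suc (r N)) ?q 1)) \<longlonglongrightarrow> Re (sesq n P v v)" by (rule tendsto_Re)
    \<comment> \<open>The bound c, uniform in N, keeps the limit strictly positive.\<close>
    then have "c \<le> Re (sesq n P v v)" using c(2) by (intro LIMSEQ_le_const) auto
    moreover have "(\<lambda>j k. A j k + B j k) = P" by (auto simp: A_def B_def)
    ultimately show "sesq n (\<lambda>j k. A j k + B j k) v v \<noteq> 0" using c(1) by auto
  next
    fix i j assume ij: "i \<in> {1..n}" "j \<in> {1..n}"
    show "A i j = (\<Sum>k\<in>{1..n}. \<Sum>l\<in>{1..n}. A k l * R i k * cnj (R j l))" by (rule A[OF ij, unfolded S_def])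
    show "B i j = alpha * (\<Sum>k\<in>{1..n}. \<Sum>l\<in>{1..n}. B k l * R i k * cnj (R j l))" by (rule B[OF ij, unfolded S_def])
  qed
qed

end

section \<open>Sufficiency\<close>

text \<open>Laurent polynomials in Im w. The class contains all metric coefficients used below and
  is closed under every \<open>rpd\<close>, so smoothness to all orders follows by induction on the
  list of directions.\<close>

definition laurent_Im :: "nat \<Rightarrow> ((nat \<Rightarrow> complex) \<Rightarrow> complex) \<Rightarrow> complex poly \<Rightarrow> nat \<Rightarrow> bool" where
  "laurent_Im n f q m \<longleftrightarrow> (\<forall>p\<in>EP_X n. f p = poly q (of_real (Im (p 0))) / of_real (Im (p 0)) ^ m)"

text \<open>The quotient rule: the derivative of q / y^m is (y q' - m q) / y^(m+1). Only the
  direction i in coordinate 0 changes Im w.\<close>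

lemma laurent_Im_deriv:
  assumes f: "laurent_Im n f q m" and p: "p \<in> EP_X n" and l: "l \<le> n" and e: "e \<in> {1, \<i>}"
  shows "((\<lambda>t. f (p(l := p l + of_real t * e))) has_vector_derivative
     (if l = 0 \<and> e = \<i> then poly ([:0, 1:] * pderiv q - [:of_nat m:] * q) (of_real (Im (p 0))) / of_real (Im (p 0)) ^ Suc m else 0)) (at 0)"
proof -
  let ?d = "if l = 0 \<and> e = \<i> then 1 else 0 :: complex"
  let ?y = "complex_of_real (Im (p 0))"
  let ?F = "\<lambda>z. poly q z / z ^ m"
  have y: "?y \<noteq> 0" using p by (auto simp: EP_X_def)
  have "(?F has_field_derivative (poly (pderiv q) ?y * ?y ^ m - poly q ?y * (of_nat m * ?y ^ (m - 1))) / (?y ^ m * ?y ^ m)) (at ?y)"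
    by (rule DERIV_divide[OF poly_DERIV]) (use y in \<open>auto intro!: derivative_eq_intros simp: One_nat_def\<close>)
  also have "(poly (pderiv q) ?y * ?y ^ m - poly q ?y * (of_nat m * ?y ^ (m - 1))) / (?y ^ m * ?y ^ m) =
      poly ([:0, 1:] * pderiv q - [:of_nat m:] * q) ?y / ?y ^ Suc m"
    using y by (cases m) (auto simp: field_simps)
  finally have F: "(?F has_field_derivative poly ([:0, 1:] * pderiv q - [:of_nat m:] * q) ?y / ?y ^ Suc m) (at (?y + of_real 0 * ?d))"
    by simp
  have "((\<lambda>t. ?y + of_real t * ?d) has_vector_derivative ?d) (at 0)"
    by (auto intro!: derivative_eq_intros simp: has_vector_derivative_def scaleR_conv_of_real)
  from field_vector_diff_chain_at[OF this F]
  have "((\<lambda>t. ?F (?y + of_real t * ?d)) has_vector_derivative ?d * (poly ([:0, 1:] * pderiv q - [:of_nat m:] * q) ?y / ?y ^ Suc m)) (at 0)"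
    by (simp add: o_def)
  moreover have ev: "\<forall>\<^sub>F t in nhds 0. ?F (?y + of_real t * ?d) = f (p(l := p l + of_real t * e))"
    using eventually_update_in_X[OF p l, of e]
  proof eventually_elim
    case (elim t)
    have "complex_of_real (Im ((p(l := p l + of_real t * e)) 0)) = ?y + of_real t * ?d" using e by auto
    then show ?case using f elim unfolding laurent_Im_def by metis
  qed
  have "((\<lambda>t. ?F (?y + of_real t * ?d)) has_vector_derivative D) (at 0) =
      ((\<lambda>t. f (p(l := p l + of_real t * e))) has_vector_derivative D) (at 0)" for D
  proof (rule has_vector_derivative_cong_ev)
    show "\<forall>\<^sub>F t in nhds 0. t \<in> UNIV \<longrightarrow> ?F (?y + of_real t * ?d) = f (p(l := p l + of_real t * e))"
      using ev by simp
    show "?F (?y + of_real 0 * ?d) = f (p(l := p l + of_real 0 * e))"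
      using eventually_nhds_x_imp_x[OF ev] .
  qed
  ultimately have "((\<lambda>t. f (p(l := p l + of_real t * e))) has_vector_derivative
      ?d * (poly ([:0, 1:] * pderiv q - [:of_nat m:] * q) ?y / ?y ^ Suc m)) (at 0)" by blast
  then show ?thesis by (cases "l = 0 \<and> e = \<i>") auto
qed

lemma laurent_Im_rpd:
  assumes f: "laurent_Im n f q m" and l: "l \<le> n" and e: "e \<in> {1, \<i>}"
  shows "\<exists>q' m'. laurent_Im n (rpd f l e) q' m'"
proof (cases "l = 0 \<and> e = \<i>")
  case True
  then have "laurent_Im n (rpd f l e) ([:0, 1:] * pderiv q - [:of_nat m:] * q) (Suc m)"
    unfolding laurent_Im_def rpd_def using laurent_Im_deriv[OF f _ l e] by (simp add: vector_derivative_at)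
  then show ?thesis by blast
next
  case False
  then have "laurent_Im n (rpd f l e) 0 0"
    unfolding laurent_Im_def rpd_def using laurent_Im_deriv[OF f _ l e] by (auto simp: vector_derivative_at)
  then show ?thesis by blast
qed

lemma rpd_laurent_Im_zero:
  assumes "laurent_Im n f q m" "p \<in> EP_X n" "l \<le> n" "e \<in> {1, \<i>}" "\<not> (l = 0 \<and> e = \<i>)"
  shows "rpd f l e p = 0"
  using laurent_Im_deriv[OF assms(1-4)] assms(5) unfolding rpd_def by (auto simp: vector_derivative_at)

lemma laurent_Im_ipd:
  assumes "laurent_Im n f q m" "\<forall>(l, e)\<in>set ds. l \<le> n \<and> e \<in> {1, \<i>}"
  shows "\<exists>q' m'. laurent_Im n (ipd ds f) q' m'"
  using assms(2)
proof (induction ds)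
  case Nil
  then show ?case using assms(1) by auto
next
  case (Cons x ds)
  obtain l e where x: "x = (l, e)" by (cases x)
  then have "\<exists>q' m'. laurent_Im n (ipd ds f) q' m'" "l \<le> n" "e \<in> {1, \<i>}" using Cons by auto
  then show ?case using laurent_Im_rpd unfolding x by auto
qed

lemma laurent_Im_smooth:
  assumes f: "laurent_Im n f q m"
  shows "smooth_on n (EP_X n) f"
  unfolding smooth_on_def
proof (intro allI impI conjI ballI)
  fix ds assume ds: "\<forall>(l, e)\<in>set ds. l \<le> n \<and> e \<in> {1, \<i>}"
  obtain q' m' where g: "laurent_Im n (ipd ds f) q' m'" using laurent_Im_ipd[OF f ds] by blast
  have "continuous_on (EP_X n) (\<lambda>p. poly q' (of_real (Im (p 0))) / of_real (Im (p 0)) ^ m')"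
    by (intro continuous_intros continuous_on_subset[OF continuous_on_product_coordinates]) (auto simp: EP_X_def)
  then show "continuous_on (EP_X n) (ipd ds f)"
    by (rule continuous_on_eq) (use g in \<open>simp add: laurent_Im_def\<close>)
  fix p l e assume "p \<in> EP_X n" "l \<le> n" "e \<in> {1, \<i>}"
  from laurent_Im_deriv[OF g this] show "(\<lambda>t::real. ipd ds f (p(l := p l + of_real t * e))) differentiable (at 0)"
    by (rule differentiableI_vector)
qed

lemma dz_dzb_laurent_Im:
  assumes f: "laurent_Im n f q r" and m: "m \<le> n" and l: "l \<le> n" and p: "p \<in> EP_X n"
  shows "dz (dzb f m) l p = (if l = 0 \<and> m = 0 then rpd (rpd f 0 \<i>) 0 \<i> p / 4 else 0)"
proof -
  have z: "rpd (rpd f m e') l e p = 0" if e: "e \<in> {1, \<i>}" "e' \<in> {1, \<i>}" and n: "\<not> (l = 0 \<and> e = \<i> \<and> m = 0 \<and> e' = \<i>)" for e e'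
  proof (cases "l = 0 \<and> e = \<i>")
    case False
    obtain q' m' where "laurent_Im n (rpd f m e') q' m'" using laurent_Im_rpd[OF f m e(2)] by blast
    from rpd_laurent_Im_zero[OF this p l e(1) False] show ?thesis .
  next
    case True
    then have "\<not> (m = 0 \<and> e' = \<i>)" using n by blast
    then have "laurent_Im n (rpd f m e') 0 0"
      unfolding laurent_Im_def using rpd_laurent_Im_zero[OF f _ m e(2)] by auto
    from laurent_Im_deriv[OF this p l e(1)] show ?thesis unfolding rpd_def[of "rpd f m e'"] by (auto simp: vector_derivative_at)
  qed
  have i1: "(1::complex) \<noteq> \<i>" by (simp add: complex_eq_iff)
  show ?thesis unfolding dz_dzb_expand[OF laurent_Im_smooth[OF f] m l p]
    using z[of 1 1] z[of 1 \<i>] z[of \<i> 1] z[of \<i> \<i>] i1 by auto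
qed

lemma dz_dzb_affine_Im:
  assumes f: "\<And>p. p \<in> EP_X n \<Longrightarrow> f p = c1 * of_real (Im (p 0)) + c0" and m: "m \<le> n" and l: "l \<le> n" and p: "p \<in> EP_X n"
  shows "dz (dzb f m) l p = 0"
proof -
  have L: "laurent_Im n f [:c0, c1:] 0" unfolding laurent_Im_def using f by (simp add: algebra_simps)
  have "rpd f 0 \<i> q = c1" if "q \<in> EP_X n" for q
    using laurent_Im_deriv[OF L that, of 0 \<i>] that unfolding rpd_def
    by (simp add: vector_derivative_at pderiv_pCons EP_X_def)
  then have "laurent_Im n (rpd f 0 \<i>) [:c1:] 0" by (simp add: laurent_Im_def)
  from laurent_Im_deriv[OF this p, of 0 \<i>] have "rpd (rpd f 0 \<i>) 0 \<i> p = 0"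
    unfolding rpd_def[of "rpd f 0 \<i>"] by (simp add: vector_derivative_at pderiv_pCons)
  then show ?thesis unfolding dz_dzb_laurent_Im[OF L m l p] by simp
qed

section \<open>Pullbacks of metrics under affine maps\<close>

definition pullback :: "nat \<Rightarrow> (nat \<Rightarrow> nat \<Rightarrow> complex) \<Rightarrow> (nat \<Rightarrow> nat \<Rightarrow> complex) \<Rightarrow> nat \<Rightarrow> nat \<Rightarrow> complex" where
  "pullback n L H u v = (\<Sum>j\<le>n. \<Sum>k\<le>n. H j k * L j u * cnj (L k v))"

lemma pullback_pullback:
  "pullback n L' (pullback n L H) u v = pullback n (\<lambda>j u. \<Sum>c\<le>n. L j c * L' c u) H u v"
proof -
  have "pullback n L' (pullback n L H) u v =
    (\<Sum>c\<le>n. \<Sum>c'\<le>n. \<Sum>j\<le>n. \<Sum>k\<le>n. H j k * (L j c * L' c u) * cnj (L k c' * L' c' v))"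
    unfolding pullback_def by (simp add: sum_distrib_left sum_distrib_right mult_ac)
  also have "\<dots> = (\<Sum>c\<le>n. \<Sum>j\<le>n. \<Sum>k\<le>n. \<Sum>c'\<le>n. H j k * (L j c * L' c u) * cnj (L k c' * L' c' v))"
    by (rule sum.cong[OF refl], subst sum.swap, rule sum.cong[OF refl], subst sum.swap) simp
  also have "\<dots> = (\<Sum>j\<le>n. \<Sum>k\<le>n. \<Sum>c\<le>n. \<Sum>c'\<le>n. H j k * (L j c * L' c u) * cnj (L k c' * L' c' v))"
    by (subst sum.swap, rule sum.cong[OF refl], subst sum.swap) simp
  also have "\<dots> = pullback n (\<lambda>j u. \<Sum>c\<le>n. L j c * L' c u) H u v"
    unfolding pullback_def cnj_sum sum_distrib_left sum_distrib_right
    by (rule sum.cong[OF refl], rule sum.cong[OF refl], rule sum.swap)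
  finally show ?thesis .
qed

lemma pullback_cong:
  "(\<And>j k. j \<le> n \<Longrightarrow> k \<le> n \<Longrightarrow> H j k = H' j k) \<Longrightarrow> (\<And>j. j \<le> n \<Longrightarrow> L j u = L' j u) \<Longrightarrow> (\<And>j. j \<le> n \<Longrightarrow> L j v = L' j v) \<Longrightarrow>
   pullback n L H u v = pullback n L' H' u v"
  by (simp add: pullback_def)

lemma pullback_id: "u \<le> n \<Longrightarrow> v \<le> n \<Longrightarrow> pullback n (\<lambda>j u. if j = u then 1 else 0) H u v = H u v"
  by (simp add: pullback_def if_distrib[of cnj] if_distrib[of "\<lambda>x. _ * x"] cong: if_cong)

text \<open>On the half space the group elements are affine; \<open>inv_into\<close> and \<open>EP_g0\<close> are only
  controlled there, hence the restriction to \<open>EP_X\<close>.\<close>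
definition affine_isometry :: "nat \<Rightarrow> ((nat \<Rightarrow> complex) \<Rightarrow> nat \<Rightarrow> nat \<Rightarrow> complex) \<Rightarrow> ((nat \<Rightarrow> complex) \<Rightarrow> nat \<Rightarrow> complex) \<Rightarrow> bool" where
  "affine_isometry n h g \<longleftrightarrow> (\<forall>p\<in>EP_X n. g p \<in> EP_X n) \<and>
     (\<exists>L c. (\<forall>p\<in>EP_X n. \<forall>k\<le>n. g p k = (\<Sum>l\<le>n. L k l * p l) + c k) \<and>
       (\<forall>p\<in>EP_X n. \<forall>u\<le>n. \<forall>v\<le>n. h p u v = pullback n L (h (g p)) u v))"

lemma affine_isometry_invariant:
  assumes "affine_isometry n h g"
  shows "invariant_metric n (EP_X n) h g"
proof -
  obtain L c where aff: "\<And>p k. p \<in> EP_X n \<Longrightarrow> k \<le> n \<Longrightarrow> g p k = (\<Sum>l\<le>n. L k l * p l) + c k"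
    and h: "\<And>p u v. p \<in> EP_X n \<Longrightarrow> u \<le> n \<Longrightarrow> v \<le> n \<Longrightarrow> h p u v = pullback n L (h (g p)) u v"
    using assms unfolding affine_isometry_def by blast
  have cpd: "cpd (\<lambda>q. g q j) m p = L j m" if p: "p \<in> EP_X n" and "j \<le> n" "m \<le> n" for p j m
  proof (rule cpd_affine[where n = n and c = "L j" and ?c0.0 = "c j"])
    have "((\<lambda>t. Im (p 0 + t)) \<longlongrightarrow> Im (p 0 + 0)) (nhds 0)"
      by (intro tendsto_intros filterlim_ident)
    then have "\<forall>\<^sub>F t in nhds 0. Im (p 0 + t) > 0"
      using p by (intro order_tendstoD(1)) (auto simp: EP_X_def)
    then show "\<forall>\<^sub>F t in nhds 0. g (p(m := p m + t)) j = (\<Sum>l\<le>n. L j l * (p(m := p m + t)) l) + c j"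
    proof eventually_elim
      case (elim t)
      then have "p(m := p m + t) \<in> EP_X n" using p that by (auto simp: EP_X_def)
      then show ?case using aff that by blast
    qed
  qed (rule that)
  show ?thesis unfolding invariant_metric_def
  proof (intro ballI allI impI)
    fix p u v assume p: "p \<in> EP_X n" and uv: "u \<le> n" "v \<le> n"
    show "h p u v = (\<Sum>j\<le>n. \<Sum>k\<le>n. h (g p) j k * cpd (\<lambda>q. g q j) u p * cnj (cpd (\<lambda>q. g q k) v p))"
      unfolding h[OF p uv] pullback_def using cpd[OF p] uv by (intro sum.cong refl) simp
  qed
qed

lemma affine_isometry_cong:
  assumes "affine_isometry n h g" "\<And>p. p \<in> EP_X n \<Longrightarrow> g' p = g p"
  shows "affine_isometry n h g'"
  using assms unfolding affine_isometry_def by simp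

lemma affine_isometry_comp:
  assumes "affine_isometry n h g" "affine_isometry n h f"
  shows "affine_isometry n h (g \<circ> f)"
proof -
  obtain L c where g: "\<And>p. p \<in> EP_X n \<Longrightarrow> g p \<in> EP_X n" "\<And>p k. p \<in> EP_X n \<Longrightarrow> k \<le> n \<Longrightarrow> g p k = (\<Sum>l\<le>n. L k l * p l) + c k"
    "\<And>p u v. p \<in> EP_X n \<Longrightarrow> u \<le> n \<Longrightarrow> v \<le> n \<Longrightarrow> h p u v = pullback n L (h (g p)) u v"
    using assms(1) unfolding affine_isometry_def by blast
  obtain L' c' where f: "\<And>p. p \<in> EP_X n \<Longrightarrow> f p \<in> EP_X n" "\<And>p k. p \<in> EP_X n \<Longrightarrow> k \<le> n \<Longrightarrow> f p k = (\<Sum>l\<le>n. L' k l * p l) + c' k"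
    "\<And>p u v. p \<in> EP_X n \<Longrightarrow> u \<le> n \<Longrightarrow> v \<le> n \<Longrightarrow> h p u v = pullback n L' (h (f p)) u v"
    using assms(2) unfolding affine_isometry_def by blast
  let ?L = "\<lambda>j u. \<Sum>i\<le>n. L j i * L' i u" and ?c = "\<lambda>j. (\<Sum>i\<le>n. L j i * c' i) + c j"
  have "(g \<circ> f) p k = (\<Sum>l\<le>n. ?L k l * p l) + ?c k" if p: "p \<in> EP_X n" and k: "k \<le> n" for p k
  proof -
    have "(g \<circ> f) p k = (\<Sum>i\<le>n. L k i * ((\<Sum>l\<le>n. L' i l * p l) + c' i)) + c k"
      using g(2)[OF f(1)[OF p] k] f(2)[OF p] by simp
    also have "\<dots> = (\<Sum>i\<le>n. \<Sum>l\<le>n. L k i * L' i l * p l) + ?c k"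
      by (simp add: distrib_left sum.distrib sum_distrib_left mult.assoc)
    also have "(\<Sum>i\<le>n. \<Sum>l\<le>n. L k i * L' i l * p l) = (\<Sum>l\<le>n. ?L k l * p l)"
      unfolding sum_distrib_right by (rule sum.swap)
    finally show ?thesis .
  qed
  moreover have "h p u v = pullback n ?L (h ((g \<circ> f) p)) u v" if "p \<in> EP_X n" "u \<le> n" "v \<le> n" for p u v
  proof -
    have "h p u v = pullback n L' (h (f p)) u v" by (rule f(3)[OF that])
    also have "\<dots> = pullback n L' (pullback n L (h (g (f p)))) u v"
      by (rule pullback_cong) (use g(3)[OF f(1)[OF that(1)]] in auto)
    finally show ?thesis unfolding pullback_pullback by simp
  qed
  ultimately show ?thesis unfolding affine_isometry_def using g(1) f(1)
    by (intro conjI ballI exI[of _ ?L] exI[of _ ?c]) auto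
qed

lemma affine_isometry_gen_group:
  assumes "\<And>g. g \<in> S \<Longrightarrow> affine_isometry n h g" "\<And>g. g \<in> S \<Longrightarrow> affine_isometry n h (inv_into (EP_X n) g)"
    and "f \<in> gen_group (EP_X n) S"
  shows "affine_isometry n h f"
  using assms(3)
proof (induction rule: gen_group.induct)
  case gg_id
  have "p k = (\<Sum>l\<le>n. (if k = l then 1 else 0) * p l) + 0" if "k \<le> n" for p :: "nat \<Rightarrow> complex" and k
    using that by (simp add: if_distrib[of "\<lambda>x. x * _"] cong: if_cong)
  then show ?case unfolding affine_isometry_def
    by (intro conjI exI[of _ "\<lambda>k l. if k = l then 1 else 0"] exI[of _ "\<lambda>_. 0"]) (auto simp: pullback_id)
qed (use assms affine_isometry_comp in blast)+

section \<open>Inverses of the generators on the half space\<close>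

lemma inv_into_X:
  assumes "p \<in> EP_X n" "\<And>q. q \<in> EP_X n \<Longrightarrow> g' q \<in> EP_X n" "\<And>q. q \<in> EP_X n \<Longrightarrow> g (g' q) = q" "\<And>q. q \<in> EP_X n \<Longrightarrow> g' (g q) = q"
  shows "inv_into (EP_X n) g p = g' p"
proof (rule inv_into_f_eq)
  show "inj_on g (EP_X n)" using assms(4) by (metis inj_onI)
qed (use assms in auto)

text \<open>The blocks are transposed, so composing the map of S with that of S' multiplies the
  matrices in the order S' S, as in the assumption.\<close>

lemma g0_coeff_mult:
  assumes "r * r' = 1" "\<And>i j. i \<in> {1..n} \<Longrightarrow> j \<in> {1..n} \<Longrightarrow> (\<Sum>l\<in>{1..n}. S' i l * S l j) = (if i = j then 1 else 0)"
    and "j \<le> n" "u \<le> n"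
  shows "(\<Sum>i\<le>n. g0_coeff r S j i * g0_coeff r' S' i u) = (if j = u then 1 else 0)"
proof (cases "j = 0 \<or> u = 0")
  case True
  have "complex_of_real r * of_real r' = 1" using assms(1) by (metis of_real_1 of_real_mult)
  then show ?thesis using True unfolding sum_atMost_split_0 g0_coeff_def by auto
next
  case False
  then have "(\<Sum>i\<le>n. g0_coeff r S j i * g0_coeff r' S' i u) = (\<Sum>i\<in>{1..n}. S' u i * S i j)"
    unfolding sum_atMost_split_0 g0_coeff_def by (auto intro!: sum.cong)
  then show ?thesis using assms False by auto
qed

lemma g0_g0:
  assumes "r * r' = 1" "\<And>i j. i \<in> {1..n} \<Longrightarrow> j \<in> {1..n} \<Longrightarrow> (\<Sum>l\<in>{1..n}. S' i l * S l j) = (if i = j then 1 else 0)"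
    and p: "p \<in> EP_X n"
  shows "EP_g0 n r S (EP_g0 n r' S' p) = p"
proof
  fix k
  show "EP_g0 n r S (EP_g0 n r' S' p) k = p k"
  proof (cases "k \<le> n")
    case True
    have "EP_g0 n r S (EP_g0 n r' S' p) k = (\<Sum>l\<le>n. g0_coeff r S k l * (\<Sum>m\<le>n. g0_coeff r' S' l m * p m))"
      using True by (simp add: g0_linear)
    also have "\<dots> = (\<Sum>m\<le>n. (\<Sum>l\<le>n. g0_coeff r S k l * g0_coeff r' S' l m) * p m)"
      unfolding sum_distrib_left sum_distrib_right by (subst sum.swap) (simp add: mult_ac)
    also have "\<dots> = (\<Sum>m\<le>n. if k = m then p k else 0)"
      using g0_coeff_mult[OF assms(1,2) True] by (intro sum.cong) auto
    finally show ?thesis using True by simp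
  qed (use p in \<open>auto simp: EP_g0_def EP_X_def\<close>)
qed

lemma g0_in_X: "r > 0 \<Longrightarrow> p \<in> EP_X n \<Longrightarrow> EP_g0 n r S p \<in> EP_X n"
  by (auto simp: EP_g0_def EP_X_def)

section \<open>The invariant metric built from eigencomponents\<close>

context endo_pajitnov
begin

text \<open>\<open>x s t\<close> holds the coordinates of the component of b_s in the generalized
  eigenspace of \<open>beta t\<close>, an eigenvector or zero once \<open>M\<close> is
  diagonalizable. Repeated betas make the components non-unique, but only their sum b_s and the
  eigenvector equations matter.\<close>

lemma eigenvector_decomposition:
  assumes "diagonalizable_C Mc"
  obtains x :: "nat \<Rightarrow> nat \<Rightarrow> nat \<Rightarrow> complex" where
    "\<And>s t i. s \<in> {1..n} \<Longrightarrow> t \<in> {1..n} \<Longrightarrow> i \<in> {1..n} \<Longrightarrow> (\<Sum>j\<in>{1..n}. R i j * x s t j) = beta t * x s t i"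
    "\<And>s i. s \<in> {1..n} \<Longrightarrow> i \<in> {1..n} \<Longrightarrow> (\<Sum>t\<in>{1..n}. x s t i) = (if i = s then 1 else 0)"
proof -
  have cf: "chain_free Mc" using assms diagonalizable_iff_chain_free[OF Mc_carrier] by simp
  have "\<exists>y. (\<forall>t\<in>{1..n}. \<forall>i\<in>{1..n}. (\<Sum>j\<in>{1..n}. R i j * y t j) = beta t * y t i) \<and>
      (\<forall>i\<in>{1..n}. (\<Sum>t\<in>{1..n}. y t i) = (if i = s then 1 else 0))" if s: "s \<in> {1..n}" for s
  proof -
    have "b s \<in> W" using b_basis s unfolding is_basis_of_def by blast
    then obtain z where z: "\<forall>t\<in>{1..n}. z t \<in> gen_eigenspace Mc (beta t)" and bs: "b s = vec d (\<lambda>i. \<Sum>t\<in>{1..n}. z t $ i)"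
      unfolding EP_W_def by auto
    have "\<exists>c. z t = comb c" if "t \<in> {1..n}" for t using W_comb gen_subset_W[OF that] z that by blast
    then obtain y where y: "\<And>t. t \<in> {1..n} \<Longrightarrow> z t = comb (y t)" by metis
    have "(\<Sum>j\<in>{1..n}. R i j * y t j) = beta t * y t i" if t: "t \<in> {1..n}" and i: "i \<in> {1..n}" for t i
    proof -
      have "z t \<in> gen_eigenspace Mc (beta t)" using z t by blast
      then obtain N where "shiftms Mc (replicate N (beta t)) (z t) = 0\<^sub>v d" and zt: "z t \<in> carrier_vec d"
        unfolding gen_eigenspace_iff[OF Mc_carrier] by blast
      from chain_free_replicate[OF Mc_carrier cf zt this(1)] have "shiftm Mc (beta t) *\<^sub>v comb (y t) = 0\<^sub>v d"
        using y[OF t] by simp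
      from comb_zero[OF this[unfolded shiftm_comb] i] show ?thesis by simp
    qed
    moreover have "(\<Sum>t\<in>{1..n}. y t i) = (if i = s then 1 else 0)" if i: "i \<in> {1..n}" for i
    proof (rule comb_eq[OF _ i])
      have "comb (\<lambda>i. \<Sum>t\<in>{1..n}. y t i) = vec d (\<lambda>i. \<Sum>t\<in>{1..n}. comb (y t) $ i)"
      proof (intro eq_vecI)
        fix i assume "i < dim_vec (vec d (\<lambda>i. \<Sum>t\<in>{1..n}. comb (y t) $ i))"
        then show "comb (\<lambda>i. \<Sum>t\<in>{1..n}. y t i) $ i = vec d (\<lambda>i. \<Sum>t\<in>{1..n}. comb (y t) $ i) $ i"
          by (simp add: comb_def sum_distrib_right) (rule sum.swap)
      qed simp
      also have "\<dots> = b s" unfolding bs using y by simp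
      also have "\<dots> = comb (\<lambda>i. if i = s then 1 else 0)"
        using s b_carrier[OF s] by (intro eq_vecI) (auto simp: comb_def if_distrib[of "\<lambda>x. x * _"] cong: if_cong)
      finally show "comb (\<lambda>i. \<Sum>t\<in>{1..n}. y t i) = comb (\<lambda>i. if i = s then 1 else 0)" .
    qed
    ultimately show ?thesis by blast
  qed
  then obtain x where "\<forall>s\<in>{1..n}. (\<forall>t\<in>{1..n}. \<forall>i\<in>{1..n}. (\<Sum>j\<in>{1..n}. R i j * x s t j) = beta t * x s t i) \<and>
      (\<forall>i\<in>{1..n}. (\<Sum>t\<in>{1..n}. x s t i) = (if i = s then 1 else 0))"
    using bchoice[of "{1..n}" "\<lambda>s y. (\<forall>t\<in>{1..n}. \<forall>i\<in>{1..n}. (\<Sum>j\<in>{1..n}. R i j * y t j) = beta t * y t i) \<and>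
      (\<forall>i\<in>{1..n}. (\<Sum>t\<in>{1..n}. y t i) = (if i = s then 1 else 0))"] by blast
  then show ?thesis using that[of x] by blast
qed

text \<open>A kernel vector of \<open>R\<close> would give an element of W killed by
  \<open>M\<close>, contradicting \<open>det M = 1\<close>.\<close>

lemma R_inverse:
  obtains R' :: "nat \<Rightarrow> nat \<Rightarrow> complex" where
    "\<And>i j. i \<in> {1..n} \<Longrightarrow> j \<in> {1..n} \<Longrightarrow> (\<Sum>l\<in>{1..n}. R i l * R' l j) = (if i = j then 1 else 0)"
    "\<And>i j. i \<in> {1..n} \<Longrightarrow> j \<in> {1..n} \<Longrightarrow> (\<Sum>l\<in>{1..n}. R' i l * R l j) = (if i = j then 1 else 0)"
proof -
  have "v = 0\<^sub>v n" if v: "v \<in> carrier_vec n" and 0: "Rm *\<^sub>v v = 0\<^sub>v n" for v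
  proof -
    obtain c where c: "v = pack c" using pack_surj[OF v] by blast
    have "Mc *\<^sub>v comb c = 0\<^sub>v d" using 0 unfolding c Rm_mult Mc_comb comb_zero_iff .
    moreover have "det Mc \<noteq> 0" using M_SL by simp
    ultimately have "comb c = 0\<^sub>v d" using det_0_iff_vec_prod_zero[OF Mc_carrier] comb_carrier by blast
    then show ?thesis unfolding c comb_zero_iff .
  qed
  then obtain B where B: "B \<in> carrier_mat n n" "Rm * B = 1\<^sub>m n" "B * Rm = 1\<^sub>m n"
    using obtain_inverse[OF Rm_carrier] by blast
  have mult: "(\<Sum>l\<in>{1..n}. C $$ (i - 1, l - 1) * D $$ (l - 1, j - 1)) = (C * D) $$ (i - 1, j - 1)"
    if "C \<in> carrier_mat n n" "D \<in> carrier_mat n n" "i \<in> {1..n}" "j \<in> {1..n}" for C D :: "complex mat" and i j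
  proof -
    have "i - 1 < n" "j - 1 < n" using that by auto
    then show ?thesis unfolding sum_1n using that by (auto simp: scalar_prod_def lessThan_atLeast0)
  qed
  have Rm_R: "Rm $$ (i - 1, j - 1) = R i j" if "i \<in> {1..n}" "j \<in> {1..n}" for i j
    using that by (auto simp: Rm_def)
  have one: "1\<^sub>m n $$ (i - 1, j - 1) = (if i = j then 1 else 0 :: complex)" if "i \<in> {1..n}" "j \<in> {1..n}" for i j
    using that by auto
  show ?thesis
  proof (rule that[of "\<lambda>i j. B $$ (i - 1, j - 1)"])
    fix i j assume ij: "i \<in> {1..n}" "j \<in> {1..n}"
    show "(\<Sum>l\<in>{1..n}. R i l * B $$ (l - 1, j - 1)) = (if i = j then 1 else 0)"
      using mult[OF Rm_carrier B(1) ij] Rm_R[OF ij(1)] one[OF ij] unfolding B(2) by simp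
    show "(\<Sum>l\<in>{1..n}. B $$ (i - 1, l - 1) * R l j) = (if i = j then 1 else 0)"
      using mult[OF B(1) Rm_carrier ij] Rm_R[OF _ ij(2)] one[OF ij] unfolding B(3) by simp
  qed
qed

lemma sufficiency:
  assumes diag: "diagonalizable_C Mc" and i0: "i0 \<in> {1..n}" "complex_of_real alpha * beta i0 * cnj (beta i0) = 1"
    and unit: "\<And>i. i \<in> {1..n} \<Longrightarrow> i \<noteq> i0 \<Longrightarrow> cmod (beta i) = 1"
  shows "EP_admits_pluriclosed n alpha R a b"
proof -
  let ?X = "EP_X n"
  obtain x :: "nat \<Rightarrow> nat \<Rightarrow> nat \<Rightarrow> complex" where
    x: "\<And>s t i. s \<in> {1..n} \<Longrightarrow> t \<in> {1..n} \<Longrightarrow> i \<in> {1..n} \<Longrightarrow> (\<Sum>j\<in>{1..n}. R i j * x s t j) = beta t * x s t i"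
    and x_sum: "\<And>s i. s \<in> {1..n} \<Longrightarrow> i \<in> {1..n} \<Longrightarrow> (\<Sum>t\<in>{1..n}. x s t i) = (if i = s then 1 else 0)"
    using eigenvector_decomposition[OF diag] by blast
  obtain R' where R': "\<And>i j. i \<in> {1..n} \<Longrightarrow> j \<in> {1..n} \<Longrightarrow> (\<Sum>l\<in>{1..n}. R i l * R' l j) = (if i = j then 1 else 0)"
    "\<And>i j. i \<in> {1..n} \<Longrightarrow> j \<in> {1..n} \<Longrightarrow> (\<Sum>l\<in>{1..n}. R' i l * R l j) = (if i = j then 1 else 0)"
    using R_inverse by blast
  \<comment> \<open>Under \<open>g_0\<close> the height is multiplied by \<open>alpha\<close> and
    the square of the i0-component by |beta_i0|^2; the weight y makes these factors cancel, and the
    other components already have factor 1.\<close>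
  define wt :: "nat \<Rightarrow> real \<Rightarrow> real" where "wt t y = (if t = i0 then y else 1)" for t y
  \<comment> \<open>The weighted sum of the squared moduli of the linear forms mapping v to the sum
    of \<open>v j * x s t j\<close>; each of them is multiplied by \<open>beta t\<close> under
    \<open>g_0\<close>.\<close>
  define G where "G y j k = (\<Sum>s\<in>{1..n}. \<Sum>t\<in>{1..n}. of_real (wt t y) * (x s t j * cnj (x s t k)))" for y j k
  \<comment> \<open>The coefficient 1/y^2 is the hyperbolic metric on the half plane, invariant
    under scaling and real translations.\<close>
  define h where "h p j k = (if j = 0 \<and> k = 0 then 1 / of_real (Im (p 0)) ^ 2
      else if j = 0 \<or> k = 0 then 0 else G (Im (p 0)) j k)" for p :: "nat \<Rightarrow> complex" and j k
  have h_Im: "Im (p 0) = Im (q 0) \<Longrightarrow> h p = h q" for p q by (intro ext) (simp add: h_def)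

  define C1 C0 where "C1 j k = (\<Sum>s\<in>{1..n}. \<Sum>t\<in>{1..n}. if t = i0 then x s t j * cnj (x s t k) else 0)"
    and "C0 j k = (\<Sum>s\<in>{1..n}. \<Sum>t\<in>{1..n}. if t = i0 then 0 else x s t j * cnj (x s t k))" for j k
  have G_affine: "G y j k = C1 j k * of_real y + C0 j k" for y j k
    unfolding G_def C1_def C0_def sum_distrib_right sum.distrib[symmetric] by (intro sum.cong refl) (auto simp: wt_def)
  have h_affine: "\<exists>c1 c0. \<forall>p\<in>?X. h p j k = c1 * of_real (Im (p 0)) + c0" if "\<not> (j = 0 \<and> k = 0)" for j k
  proof (cases "j = 0 \<or> k = 0")
    case True
    then show ?thesis using that by (intro exI[of _ 0]) (auto simp: h_def)
  next
    case False
    then show ?thesis by (intro exI[of _ "C1 j k"] exI[of _ "C0 j k"]) (auto simp: h_def G_affine)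
  qed
  have L00: "laurent_Im n (\<lambda>p. h p 0 0) 1 2" by (simp add: laurent_Im_def h_def)
  have L: "\<exists>q m. laurent_Im n (\<lambda>p. h p j k) q m" for j k
  proof (cases "j = 0 \<and> k = 0")
    case False
    then obtain c1 c0 where "\<forall>p\<in>?X. h p j k = c1 * of_real (Im (p 0)) + c0" using h_affine by blast
    then have "laurent_Im n (\<lambda>p. h p j k) [:c0, c1:] 0" by (simp add: laurent_Im_def algebra_simps)
    then show ?thesis by blast
  qed (use L00 in auto)
  have G_form: "(\<Sum>j\<in>{1..n}. \<Sum>k\<in>{1..n}. G y j k * u j * cnj (v k)) =
      (\<Sum>s\<in>{1..n}. \<Sum>t\<in>{1..n}. of_real (wt t y) * ((\<Sum>j\<in>{1..n}. u j * x s t j) * cnj (\<Sum>k\<in>{1..n}. cnj (cnj (v k) * cnj (x s t k)))))"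
    for y and u v :: "nat \<Rightarrow> complex"
  proof -
    have "(\<Sum>j\<in>{1..n}. \<Sum>k\<in>{1..n}. G y j k * u j * cnj (v k)) =
      (\<Sum>j\<in>{1..n}. \<Sum>k\<in>{1..n}. \<Sum>s\<in>{1..n}. \<Sum>t\<in>{1..n}. of_real (wt t y) * (u j * x s t j * (cnj (v k) * cnj (x s t k))))"
      unfolding G_def by (simp add: sum_distrib_left sum_distrib_right mult_ac)
    also have "\<dots> = (\<Sum>j\<in>{1..n}. \<Sum>s\<in>{1..n}. \<Sum>t\<in>{1..n}. \<Sum>k\<in>{1..n}. of_real (wt t y) * (u j * x s t j * (cnj (v k) * cnj (x s t k))))"
      by (rule sum.cong[OF refl], subst sum.swap, rule sum.cong[OF refl], subst sum.swap) simp
    also have "\<dots> = (\<Sum>s\<in>{1..n}. \<Sum>t\<in>{1..n}. \<Sum>j\<in>{1..n}. \<Sum>k\<in>{1..n}. of_real (wt t y) * (u j * x s t j * (cnj (v k) * cnj (x s t k))))"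
      by (subst sum.swap, rule sum.cong[OF refl], subst sum.swap) simp
    also have "\<dots> = (\<Sum>s\<in>{1..n}. \<Sum>t\<in>{1..n}. of_real (wt t y) * ((\<Sum>j\<in>{1..n}. u j * x s t j) * (\<Sum>k\<in>{1..n}. cnj (v k) * cnj (x s t k))))"
      unfolding sum_product by (simp add: sum_distrib_left)
    finally show ?thesis by simp
  qed

  have "hermitian_metric n ?X h" unfolding hermitian_metric_def
  proof (intro conjI allI impI ballI)
    fix j k show "smooth_on n ?X (\<lambda>p. h p j k)" using L[of j k] laurent_Im_smooth by blast
  next
    fix p j k show "h p j k = cnj (h p k j)" by (auto simp: h_def G_def mult_ac)
  next
    fix p and v :: "nat \<Rightarrow> complex" assume p: "p \<in> ?X" and v: "\<exists>k\<le>n. v k \<noteq> 0"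
    let ?y = "Im (p 0)"
    have y: "?y > 0" using p by (simp add: EP_X_def)
    define l where "l s t = (\<Sum>j\<in>{1..n}. v j * x s t j)" for s t
    have "(\<Sum>j\<le>n. \<Sum>k\<le>n. h p j k * v j * cnj (v k)) = v 0 * cnj (v 0) / of_real ?y ^ 2 +
        (\<Sum>j\<in>{1..n}. \<Sum>k\<in>{1..n}. G ?y j k * v j * cnj (v k))"
      unfolding sum_atMost_split_0 by (simp add: h_def)
    also have "(\<Sum>j\<in>{1..n}. \<Sum>k\<in>{1..n}. G ?y j k * v j * cnj (v k)) = (\<Sum>s\<in>{1..n}. \<Sum>t\<in>{1..n}. of_real (wt t ?y) * (l s t * cnj (l s t)))"
      unfolding G_form l_def by simp
    also have "v 0 * cnj (v 0) / of_real ?y ^ 2 + \<dots> = of_real ((cmod (v 0))\<^sup>2 / ?y ^ 2 + (\<Sum>s\<in>{1..n}. \<Sum>t\<in>{1..n}. wt t ?y * (cmod (l s t))\<^sup>2))"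
      by (simp add: complex_norm_square[symmetric])
    finally have e: "Re (\<Sum>j\<le>n. \<Sum>k\<le>n. h p j k * v j * cnj (v k)) = (cmod (v 0))\<^sup>2 / ?y ^ 2 + (\<Sum>s\<in>{1..n}. \<Sum>t\<in>{1..n}. wt t ?y * (cmod (l s t))\<^sup>2)"
      by (simp only: Re_complex_of_real)
    have wt: "wt t ?y > 0" for t using y by (simp add: wt_def)
    have nn1: "0 \<le> wt t ?y * (cmod (l s t))\<^sup>2" for s t using less_imp_le[OF wt] by simp
    have nn: "0 \<le> (\<Sum>t\<in>{1..n}. wt t ?y * (cmod (l s t))\<^sup>2)" for s
      by (intro sum_nonneg nn1)
    show "0 < Re (\<Sum>j\<le>n. \<Sum>k\<le>n. h p j k * v j * cnj (v k))"
    proof (cases "v 0 = 0")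
      case False
      then have "0 < (cmod (v 0))\<^sup>2 / ?y ^ 2" using y by simp
      then show ?thesis unfolding e by (rule add_pos_nonneg[OF _ sum_nonneg[OF nn]])
    next
      case True
      obtain s where s: "s \<le> n" "v s \<noteq> 0" using v by blast
      then have s': "s \<in> {1..n}" using True by (cases s) auto
      \<comment> \<open>For fixed s the forms add up to the coordinate \<open>v s\<close>, so they
        cannot all vanish at v.\<close>
      have "(\<Sum>t\<in>{1..n}. l s t) = (\<Sum>j\<in>{1..n}. v j * (\<Sum>t\<in>{1..n}. x s t j))"
        unfolding l_def sum_distrib_left by (rule sum.swap)
      also have "\<dots> = (\<Sum>j\<in>{1..n}. if j = s then v s else 0)"
        using x_sum[OF s'] by (intro sum.cong) auto
      also have "\<dots> = v s" using s' by simp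
      finally have "(\<Sum>t\<in>{1..n}. l s t) \<noteq> 0" using s by simp
      then obtain t where t: "t \<in> {1..n}" "l s t \<noteq> 0" by (meson sum.neutral)
      have "0 < wt t ?y * (cmod (l s t))\<^sup>2" using wt t by simp
      also have "\<dots> \<le> (\<Sum>t\<in>{1..n}. wt t ?y * (cmod (l s t))\<^sup>2)"
        using t nn1 by (intro member_le_sum) auto
      also have "\<dots> \<le> (\<Sum>s\<in>{1..n}. \<Sum>t\<in>{1..n}. wt t ?y * (cmod (l s t))\<^sup>2)"
        using s' nn by (intro member_le_sum) auto
      finally show ?thesis unfolding e using True by simp
    qed
  qed

  moreover have "pluriclosed n ?X h" unfolding pluriclosed_def Let_def
  proof (intro ballI allI impI)
    fix p l j m k assume p: "p \<in> ?X" and le: "l \<le> n" "j \<le> n" "m \<le> n" "k \<le> n"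
    have T: "dz (dzb (\<lambda>q. h q j k) m) l p = 0" if "\<not> (l = 0 \<and> j = 0 \<and> m = 0 \<and> k = 0)" "l \<le> n" "m \<le> n" for l j m k
    proof (cases "j = 0 \<and> k = 0")
      case True
      then show ?thesis using dz_dzb_laurent_Im[OF L00 that(3,2) p] that by auto
    next
      case False
      then obtain c1 c0 where "\<forall>p\<in>?X. h p j k = c1 * of_real (Im (p 0)) + c0" using h_affine by blast
      then show ?thesis by (intro dz_dzb_affine_Im[of n _ c1 c0] that p) auto
    qed
    show "dz (dzb (\<lambda>q. h q j k) m) l p - dz (dzb (\<lambda>q. h q l k) m) j p - dz (dzb (\<lambda>q. h q j m) k) l p + dz (dzb (\<lambda>q. h q l m) k) j p = 0"
    \<comment> \<open>With all indices zero the four terms are equal and cancel in pairs. This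
      disposes of 1/y^2, the only coefficient not affine in Im w.\<close>
    proof (cases "l = 0 \<and> j = 0 \<and> m = 0 \<and> k = 0")
      case False
      then have "dz (dzb (\<lambda>q. h q j k) m) l p = 0" "dz (dzb (\<lambda>q. h q l k) m) j p = 0"
        "dz (dzb (\<lambda>q. h q j m) k) l p = 0" "dz (dzb (\<lambda>q. h q l m) k) j p = 0"
        using le by (intro T; blast)+
      then show ?thesis by simp
    qed simp
  qed

  moreover have "affine_isometry n h g" if "g \<in> gen_group ?X (EP_gens n alpha R a b)" for g
    using that
  proof (rule affine_isometry_gen_group[rotated -1])
    have tr: "affine_isometry n h (\<lambda>p. tr p r e)" if "flat_dir n e" for r e
    proof -
      have "h (tr p r e) = h p" for p using that by (intro h_Im) (simp add: tr_def flat_dir_def)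
      moreover have "tr p r e k = (\<Sum>l\<le>n. (if k = l then 1 else 0) * p l) + of_real r * e k" if "k \<le> n" for p k
        using that by (simp add: tr_def if_distrib[of "\<lambda>x. x * _"] cong: if_cong)
      ultimately show ?thesis unfolding affine_isometry_def using tr_in_X[OF _ that]
        by (intro conjI exI[of _ "\<lambda>k l. if k = l then 1 else 0"] exI[of _ "\<lambda>k. of_real r * e k"]) (auto simp: pullback_id)
    qed
    have wt_scale: "of_real (wt t (alpha * y)) * (beta t * cnj (beta t)) = complex_of_real (wt t y)" if "t \<in> {1..n}" for t y
    proof (cases "t = i0")
      case True
      then show ?thesis using i0(2) by (simp add: wt_def mult_ac)
    next
      case False
      then show ?thesis using unit[OF that] by (simp add: wt_def complex_norm_square[symmetric])
    qed
    have G_inv: "(\<Sum>k\<in>{1..n}. \<Sum>l\<in>{1..n}. G (alpha * y) k l * R u k * cnj (R v l)) = G y u v"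
      if u: "u \<in> {1..n}" and v: "v \<in> {1..n}" for y u v
    proof -
      have "(\<Sum>k\<in>{1..n}. \<Sum>l\<in>{1..n}. G (alpha * y) k l * R u k * cnj (R v l)) =
        (\<Sum>s\<in>{1..n}. \<Sum>t\<in>{1..n}. of_real (wt t (alpha * y)) * ((\<Sum>j\<in>{1..n}. R u j * x s t j) * cnj (\<Sum>k\<in>{1..n}. R v k * x s t k)))"
        unfolding G_form by simp
      \<comment> \<open>The transpose of \<open>R\<close> is moved from the argument of the linear
        form onto its coefficients, where it becomes \<open>R\<close> applied to an
        eigenvector.\<close>
      also have "\<dots> = (\<Sum>s\<in>{1..n}. \<Sum>t\<in>{1..n}. of_real (wt t (alpha * y)) * (beta t * cnj (beta t)) * (x s t u * cnj (x s t v)))"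
        using x u v by (intro sum.cong refl) (simp add: mult_ac)
      also have "\<dots> = G y u v" unfolding G_def using wt_scale by (intro sum.cong refl) simp
      finally show ?thesis .
    qed
    have g0_pull: "h p u v = pullback n (g0_coeff alpha R) (h (EP_g0 n alpha R p)) u v" if p: "p \<in> ?X" and uv: "u \<le> n" "v \<le> n" for p u v
    proof -
      have Im0: "Im (EP_g0 n alpha R p 0) = alpha * Im (p 0)" by (simp add: EP_g0_def)
      consider "u = 0" "v = 0" | "u = 0" "v \<noteq> 0" | "u \<noteq> 0" "v = 0" | "u \<in> {1..n}" "v \<in> {1..n}" using uv by force
      then show ?thesis
      proof cases
        case 4
        have "pullback n (g0_coeff alpha R) (h (EP_g0 n alpha R p)) u v =
          (\<Sum>k\<in>{1..n}. \<Sum>l\<in>{1..n}. h (EP_g0 n alpha R p) k l * R u k * cnj (R v l))"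
          unfolding pullback_def g0_coeff_sum[OF 4] ..
        also have "\<dots> = (\<Sum>k\<in>{1..n}. \<Sum>l\<in>{1..n}. G (alpha * Im (p 0)) k l * R u k * cnj (R v l))"
          by (intro sum.cong refl) (simp add: h_def Im0)
        also have "\<dots> = h p u v" unfolding G_inv[OF 4] using 4 by (simp add: h_def)
        finally show ?thesis by simp
      qed (use alpha_pos in \<open>auto simp: pullback_def sum_atMost_split_0 g0_coeff_def h_def Im0 power2_eq_square\<close>)
    qed
    have g0: "affine_isometry n h (EP_g0 n alpha R)"
      unfolding affine_isometry_def
      by (intro conjI exI[of _ "g0_coeff alpha R"] exI[of _ "\<lambda>_. 0"])
        (use g0_pull g0_in_X[OF alpha_pos] in \<open>auto simp: g0_linear\<close>)
    let ?g' = "EP_g0 n (1 / alpha) R'"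
    have g'X: "?g' p \<in> ?X" if "p \<in> ?X" for p using that alpha_pos by (intro g0_in_X) auto
    have gg': "EP_g0 n alpha R (?g' p) = p" if "p \<in> ?X" for p
      by (rule g0_g0) (use alpha_pos R' that in auto)
    have g'g: "?g' (EP_g0 n alpha R p) = p" if "p \<in> ?X" for p
      by (rule g0_g0) (use alpha_pos R' that in auto)
    have g0': "affine_isometry n h ?g'"
      unfolding affine_isometry_def
    proof (intro conjI exI[of _ "g0_coeff (1 / alpha) R'"] exI[of _ "\<lambda>_. 0"] ballI allI impI)
      fix p u v assume p: "p \<in> ?X" and uv: "u \<le> n" "v \<le> n"
      \<comment> \<open>The isometry property of \<open>g_0\<close> at the point
        \<open>?g' p\<close> is pulled back by the inverse, so the composite pullback is the
        identity.\<close>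
      have "pullback n (g0_coeff (1 / alpha) R') (h (?g' p)) u v = pullback n (g0_coeff (1 / alpha) R') (pullback n (g0_coeff alpha R) (h p)) u v"
        by (rule pullback_cong) (use g0_pull[OF g'X[OF p]] gg'[OF p] in auto)
      also have "\<dots> = pullback n (\<lambda>j u. if j = u then 1 else 0) (h p) u v"
        unfolding pullback_pullback
        by (rule pullback_cong) (use g0_coeff_mult[of alpha "1 / alpha" n R' R] R'(2) alpha_pos uv in auto)
      finally show "h p u v = pullback n (g0_coeff (1 / alpha) R') (h (?g' p)) u v" using pullback_id[OF uv] by simp
    qed (use g'X in \<open>auto simp: g0_linear\<close>)
    fix g assume "g \<in> EP_gens n alpha R a b"
    then consider "g = EP_g0 n alpha R" | i where "i < d" "g = EP_gi n a b (Suc i)"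
      unfolding EP_gens_def d_def by (auto, metis Suc_le_D Suc_le_lessD less_Suc_eq_le One_nat_def Suc_eq_plus1)
    then have "affine_isometry n h g \<and> affine_isometry n h (inv_into ?X g)"
    proof cases
      case 1
      have "inv_into ?X g p = ?g' p" if "p \<in> ?X" for p
        unfolding 1 by (rule inv_into_X[OF that g'X gg' g'g])
      then show ?thesis using g0 affine_isometry_cong[OF g0'] unfolding 1 by blast
    next
      case (2 i)
      have fl: "flat_dir n (U i)" by (rule TL.U_flat[OF 2(1)])
      have g: "g p = tr p 1 (U i)" if "p \<in> ?X" for p unfolding 2(2) by (rule gi_eq_tr[OF that])
      have "inv_into ?X g p = tr p (-1) (U i)" if "p \<in> ?X" for p
        by (rule inv_into_X[OF that]) (use g tr_in_X[OF _ fl] in \<open>auto simp: tr_tr\<close>)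
      then show ?thesis using affine_isometry_cong[OF tr[OF fl]] g by blast
    qed
    then show "affine_isometry n h g" "affine_isometry n h (inv_into ?X g)" by blast+
  qed
  then have "\<forall>g\<in>gen_group ?X (EP_gens n alpha R a b). invariant_metric n ?X h g"
    using affine_isometry_invariant by blast
  ultimately show ?thesis unfolding EP_admits_pluriclosed_def by blast
qed

end

theorem theorem5p8:
  fixes n :: nat and M :: "int mat" and alpha :: real and beta :: "nat \<Rightarrow> complex"
    and a :: "real vec" and b :: "nat \<Rightarrow> complex vec" and R :: "nat \<Rightarrow> nat \<Rightarrow> complex"
  assumes n2: "n \<ge> 2"
    and M_carrier: "M \<in> carrier_mat (2*n+1) (2*n+1)"
    and M_SL: "det M = 1"
    and eig: "char_poly (map_mat of_int M :: complex mat) =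
              [:- complex_of_real alpha, 1:] * (\<Prod>j\<in>{1..n}. [:- beta j, 1:] * [:- cnj (beta j), 1:])"
    and alpha_pos: "alpha > 0" and alpha_ne1: "alpha \<noteq> 1"
    and beta_im: "\<forall>j\<in>{1..n}. Im (beta j) > 0"
    and a_carrier: "a \<in> carrier_vec (2*n+1)" and a_nz: "a \<noteq> 0\<^sub>v (2*n+1)"
    and a_eig: "(map_mat of_int M :: real mat) *\<^sub>v a = alpha \<cdot>\<^sub>v a"
    and b_carrier: "\<forall>j\<in>{1..n}. b j \<in> carrier_vec (2*n+1)"
    and b_basis: "is_basis_of (2*n+1) n b (EP_W (map_mat of_int M) n beta)"
    and R_def: "\<forall>j\<in>{1..n}. (map_mat of_int M :: complex mat) *\<^sub>v b j =
                 vec (2*n+1) (\<lambda>k. \<Sum>i\<in>{1..n}. R i j * b i $ k)"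
  shows "EP_admits_pluriclosed n alpha R a b \<longleftrightarrow>
    (diagonalizable_C (map_mat of_int M) \<and>
     (\<exists>i0\<in>{1..n}. complex_of_real alpha * beta i0 * cnj (beta i0) = 1 \<and>
        (\<forall>i\<in>{1..n}. i \<noteq> i0 \<longrightarrow> cmod (beta i) = 1)))"
proof -
  interpret endo_pajitnov n M alpha beta a b R
    by unfold_locales (use assms in auto)
  show ?thesis using necessity sufficiency by blast
qed

end
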